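(* Let $(a,b)\subseteq\mathbb{R}$ be a finite or infinite interval, and let $V:(a,b)\to\mathcal{B}(\mathcal{H})$ be a weakly measurable operator-valued function with $\|V(\cdot)\|_{\mathcal{B}(\mathcal{H})}\in L^1_{\mathrm{loc}}((a,b);dx)$ and $V(x)=V(x)^*$ for a.e. $x\in(a,b)$. Then the operator $\dot H_{\min}$ is densely defined. Moreover, $H_{\max}$ is the adjoint of $\dot H_{\min}$, $$H_{\max}=(\dot H_{\min})^*.$$ In particular, $H_{\max}$ is closed. In addition, $\dot H_{\min}$ is symmetric and $H_{\max}^*$ is the closure of $\dot H_{\min}$, that is, $$H_{\max}^*=\overline{\dot H_{\min}}=H_{\min}.$$
   Context: $\mathcal{H}$ is a complex separable Hilbert space with inner product $(\cdot,\cdot)_{\mathcal{H}}$ linear in the second argument; $\mathcal{B}(\mathcal{H})$ is the space of bounded linear operators on $\mathcal{H}$. Weak measurability of $V$ means $x\mapsto(f,V(x)g)_{\mathcal{H}}$ is Lebesgue measurable for all $f,g\in\mathcal{H}$. $L^2((a,b);dx;\mathcal{H})$ is the Hilbert space of (classes of) strongly measurable $\mathcal{H}$-valued functions with inner product $\int_a^b (f(x),g(x))_{\mathcal{H}}\,dx$. $W^{2,1}_{\mathrm{loc}}((a,b);dx;\mathcal{H})$ is the set of $y:(a,b)\to\mathcal{H}$ such that $y(x)=y(x_1)+\int_{x_1}^x y'(t)\,dt$ and $y'(x)=y'(x_1)+\int_{x_1}^x y''(t)\,dt$ (Bochner integrals) with $y',y''\in L^1_{\mathrm{loc}}((a,b);dx;\mathcal{H})$.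 Let $\tau=-(d^2/dx^2)+V(\cdot)$. The maximal operator $H_{\max}$ in $L^2((a,b);dx;\mathcal{H})$ is $H_{\max}f=\tau f$ with domain $\operatorname{dom}(H_{\max})=\{g\in L^2((a,b);dx;\mathcal{H}) : g\in W^{2,1}_{\mathrm{loc}}((a,b);dx;\mathcal{H}),\ \tau g\in L^2((a,b);dx;\mathcal{H})\}$. The operator $\dot H_{\min}$ is the restriction of $H_{\max}$ to $\operatorname{dom}(\dot H_{\min})=\{g\in\operatorname{dom}(H_{\max}) : \operatorname{supp}(g)\text{ is compact in }(a,b)\}$. The minimal operator is the closure $H_{\min}=\overline{\dot H_{\min}}$. *)

theory Defs
  imports "HOL-Analysis.Analysis"
begin

section \<open>Complex Hilbert spaces\<close>

text \<open>
  The real Banach space structure (needed for the Bochner integral) comes from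
  \<^class>\<open>banach\<close>; the inner product is linear in its second argument.
  Separability is expressed by adding the sort \<^class>\<open>second_countable_topology\<close>.
\<close>

class complex_hilbert = banach +
  fixes scaleC :: "complex \<Rightarrow> 'a \<Rightarrow> 'a" (infixr "*\<^sub>C" 75)
    and cinner :: "'a \<Rightarrow> 'a \<Rightarrow> complex"
  assumes scaleC_of_real: "complex_of_real r *\<^sub>C x = r *\<^sub>R x"
    and scaleC_scaleC: "c *\<^sub>C (d *\<^sub>C x) = (c * d) *\<^sub>C x"
    and scaleC_add_left: "(c + d) *\<^sub>C x = c *\<^sub>C x + d *\<^sub>C x"
    and scaleC_add_right: "c *\<^sub>C (x + y) = c *\<^sub>C x + c *\<^sub>C y"
    and cinner_commute: "cinner x y = cnj (cinner y x)"
    and cinner_add_right: "cinner x (y + z) = cinner x y + cinner x z"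
    and cinner_scaleC_right: "cinner x (c *\<^sub>C y) = c * cinner x y"
    and cinner_self: "cinner x x = complex_of_real ((norm x)\<^sup>2)"

instantiation complex :: complex_hilbert
begin
definition scaleC_complex :: "complex \<Rightarrow> complex \<Rightarrow> complex"
  where "scaleC_complex c x = c * x"
definition cinner_complex :: "complex \<Rightarrow> complex \<Rightarrow> complex"
  where "cinner_complex x y = cnj x * y"
instance
  by standard
    (auto simp: scaleC_complex_def cinner_complex_def algebra_simps scaleR_conv_of_real
      complex_norm_square simp flip: of_real_power)
end

text \<open>
  \<^typ>\<open>'h \<Rightarrow>\<^sub>L 'h\<close> is the space of bounded real-linear operators; the
  complex-linear ones among them form the bounded operators on the complex space, and the
  operator norm is the same.
\<close>

definition bounded_ops :: "('h::complex_hilbert \<Rightarrow>\<^sub>L 'h) set"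
  where "bounded_ops = {T. \<forall>c x. blinfun_apply T (c *\<^sub>C x) = c *\<^sub>C blinfun_apply T x}"

definition is_adjoint_of ::
    "('h::complex_hilbert \<Rightarrow>\<^sub>L 'h) \<Rightarrow> ('h \<Rightarrow>\<^sub>L 'h) \<Rightarrow> bool"
  where "is_adjoint_of S T \<longleftrightarrow>
    (\<forall>f g. cinner (blinfun_apply S f) g = cinner f (blinfun_apply T g))"


section \<open>Function spaces\<close>

text \<open>
  Throughout, \<open>J\<close> is the open interval on which functions live; values outside
  \<open>J\<close> are irrelevant.  As the target spaces are second countable, Borel measurability
  coincides with strong measurability.
\<close>

definition weakly_measurable_on ::
    "real set \<Rightarrow> (real \<Rightarrow> ('h::complex_hilbert \<Rightarrow>\<^sub>L 'h)) \<Rightarrow> bool"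
  where "weakly_measurable_on J V \<longleftrightarrow>
    (\<forall>f g. (\<lambda>x. cinner f (blinfun_apply (V x) g)) \<in> borel_measurable (lebesgue_on J))"

definition L1_loc :: "real set \<Rightarrow> (real \<Rightarrow> 'b::{banach, second_countable_topology}) set"
  where "L1_loc J = {f. \<forall>K. compact K \<and> K \<subseteq> J \<longrightarrow> set_integrable lebesgue K f}"

text \<open>
  \<open>W21_loc_derivs J y y1 y2\<close>: the function \<open>y\<close> belongs to the local Sobolev
  space, with first and second derivatives \<open>y1\<close> and \<open>y2\<close>.  The function
  \<open>y1\<close> is determined on \<open>J\<close>, and \<open>y2\<close> almost everywhere.
\<close>

definition W21_loc_derivs ::
    "real set \<Rightarrow> (real \<Rightarrow> 'b::{banach, second_countable_topology}) \<Rightarrow>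
      (real \<Rightarrow> 'b) \<Rightarrow> (real \<Rightarrow> 'b) \<Rightarrow> bool"
  where "W21_loc_derivs J y y1 y2 \<longleftrightarrow>
    y1 \<in> L1_loc J \<and> y2 \<in> L1_loc J \<and>
    (\<forall>x\<^sub>1\<in>J. \<forall>x\<in>J.
      y x = y x\<^sub>1 + (LINT t=x\<^sub>1..x|lebesgue. y1 t) \<and>
      y1 x = y1 x\<^sub>1 + (LINT t=x\<^sub>1..x|lebesgue. y2 t))"

definition W21_loc :: "real set \<Rightarrow> (real \<Rightarrow> 'b::{banach, second_countable_topology}) set"
  where "W21_loc J = {y. \<exists>y1 y2. W21_loc_derivs J y y1 y2}"

text \<open>The support relative to \<open>J\<close>.\<close>

definition supp_in :: "real set \<Rightarrow> (real \<Rightarrow> 'b::real_normed_vector) \<Rightarrow> real set"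
  where "supp_in J f = J \<inter> closure {x \<in> J. f x \<noteq> 0}"


section \<open>The Hilbert space of square integrable functions\<close>

definition sq_integrable ::
    "real set \<Rightarrow> (real \<Rightarrow> 'h::{complex_hilbert, second_countable_topology}) set"
  where "sq_integrable J = {f \<in> borel_measurable (lebesgue_on J).
    integrable (lebesgue_on J) (\<lambda>x. (norm (f x))\<^sup>2)}"

definition ae_rel ::
    "real set \<Rightarrow> (real \<Rightarrow> 'h::{complex_hilbert, second_countable_topology}) rel"
  where "ae_rel J = {(f, g). f \<in> sq_integrable J \<and> g \<in> sq_integrable J \<and>
    (AE x in lebesgue_on J. f x = g x)}"

type_synonym 'h L2_elem = "(real \<Rightarrow> 'h) set"

definition L2 :: "real set \<Rightarrow> 'h::{complex_hilbert, second_countable_topology} L2_elem set"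
  where "L2 J = sq_integrable J // ae_rel J"

definition L2_class ::
    "real set \<Rightarrow> (real \<Rightarrow> 'h::{complex_hilbert, second_countable_topology}) \<Rightarrow> 'h L2_elem"
  where "L2_class J f = ae_rel J `` {f}"

text \<open>
  The operations are defined through arbitrary representatives; on \<^const>\<open>L2\<close> they do
  not depend on that choice.
\<close>

definition L2_rep :: "'h L2_elem \<Rightarrow> real \<Rightarrow> 'h"
  where "L2_rep F = (SOME f. f \<in> F)"

definition L2_add ::
    "real set \<Rightarrow> 'h::{complex_hilbert, second_countable_topology} L2_elem \<Rightarrow> 'h L2_elem \<Rightarrow> 'h L2_elem"
  where "L2_add J F G = L2_class J (\<lambda>x. L2_rep F x + L2_rep G x)"

definition L2_scale ::
    "real set \<Rightarrow> complex \<Rightarrow> 'h::{complex_hilbert, second_countable_topology} L2_elem \<Rightarrow> 'h L2_elem"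
  where "L2_scale J c F = L2_class J (\<lambda>x. c *\<^sub>C L2_rep F x)"

definition L2_inner ::
    "real set \<Rightarrow> 'h::{complex_hilbert, second_countable_topology} L2_elem \<Rightarrow> 'h L2_elem \<Rightarrow> complex"
  where "L2_inner J F G = (LINT x|lebesgue_on J. cinner (L2_rep F x) (L2_rep G x))"

text \<open>
  The metric of the norm induced by \<^const>\<open>L2_inner\<close>, as
  \<open>cinner v v = \<parallel>v\<parallel>\<^sup>2\<close> in \<open>'h\<close>.
\<close>

definition L2_dist ::
    "real set \<Rightarrow> 'h::{complex_hilbert, second_countable_topology} L2_elem \<Rightarrow> 'h L2_elem \<Rightarrow> real"
  where "L2_dist J F G = sqrt (LINT x|lebesgue_on J. (norm (L2_rep F x - L2_rep G x))\<^sup>2)"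

lemma equiv_ae_rel: "equiv (sq_integrable J) (ae_rel J)"
proof (rule equivI)
  show "trans (ae_rel J)"
  proof (rule transI)
    fix f g h assume *: "(f, g) \<in> ae_rel J" "(g, h) \<in> ae_rel J"
    then have "AE x in lebesgue_on J. f x = g x" "AE x in lebesgue_on J. g x = h x"
      by (auto simp: ae_rel_def)
    then have "AE x in lebesgue_on J. f x = h x"
      by eventually_elim simp
    with * show "(f, h) \<in> ae_rel J"
      by (simp add: ae_rel_def)
  qed
  show "sym (ae_rel J)"
    by (rule symI) (auto simp: ae_rel_def eq_commute)
qed (auto simp: ae_rel_def refl_on_def)

lemma L2_rep_in:
  assumes "F \<in> L2 J"
  shows "L2_rep F \<in> F" "L2_rep F \<in> sq_integrable J" "L2_class J (L2_rep F) = F"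
proof -
  have "F \<noteq> {}" "F \<subseteq> sq_integrable J"
    using assms in_quotient_imp_non_empty[OF equiv_ae_rel] in_quotient_imp_subset[OF equiv_ae_rel]
    unfolding L2_def by blast+
  then show *: "L2_rep F \<in> F"
    unfolding L2_rep_def by (simp add: some_in_eq)
  with \<open>F \<subseteq> sq_integrable J\<close> show "L2_rep F \<in> sq_integrable J"
    by blast
  obtain f where f: "F = ae_rel J `` {f}"
    using assms unfolding L2_def by (auto elim: quotientE)
  with * have "(f, L2_rep F) \<in> ae_rel J"
    by simp
  from equiv_class_eq[OF equiv_ae_rel this] show "L2_class J (L2_rep F) = F"
    by (simp add: f L2_class_def)
qed

lemma integrable_norm_diff_square:
  assumes "f \<in> sq_integrable J" "g \<in> sq_integrable J"
  shows "integrable (lebesgue_on J) (\<lambda>x. (norm (f x - g x))\<^sup>2)"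
proof (rule Bochner_Integration.integrable_bound)
  show "integrable (lebesgue_on J) (\<lambda>x. 2 * (norm (f x))\<^sup>2 + 2 * (norm (g x))\<^sup>2)"
    using assms by (auto simp: sq_integrable_def)
  have [measurable]: "f \<in> borel_measurable (lebesgue_on J)" "g \<in> borel_measurable (lebesgue_on J)"
    using assms by (auto simp: sq_integrable_def)
  show "(\<lambda>x. (norm (f x - g x))\<^sup>2) \<in> borel_measurable (lebesgue_on J)"
    by measurable
  have "(norm (f x - g x))\<^sup>2 \<le> 2 * (norm (f x))\<^sup>2 + 2 * (norm (g x))\<^sup>2" for x
  proof -
    have "(norm (f x - g x))\<^sup>2 \<le> (norm (f x) + norm (g x))\<^sup>2"
      by (intro power_mono norm_triangle_ineq4) auto
    also have "\<dots> \<le> 2 * (norm (f x))\<^sup>2 + 2 * (norm (g x))\<^sup>2"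
      using zero_le_power2[of "norm (f x) - norm (g x)"] by (simp add: power2_eq_square algebra_simps)
    finally show ?thesis .
  qed
  then show "AE x in lebesgue_on J. norm ((norm (f x - g x))\<^sup>2)
      \<le> norm (2 * (norm (f x))\<^sup>2 + 2 * (norm (g x))\<^sup>2)"
    by simp
qed

lemma sqrt_integral_Minkowski:
  fixes u v w :: "'a \<Rightarrow> real"
  assumes u: "integrable M (\<lambda>x. (u x)\<^sup>2)" and v: "integrable M (\<lambda>x. (v x)\<^sup>2)"
    and w: "integrable M (\<lambda>x. (w x)\<^sup>2)"
    and le: "\<And>x. \<bar>w x\<bar> \<le> u x + v x"
  shows "sqrt (LINT x|M. (w x)\<^sup>2) \<le> sqrt (LINT x|M. (u x)\<^sup>2) + sqrt (LINT x|M. (v x)\<^sup>2)"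
proof (rule field_le_epsilon)
  fix e :: real assume "0 < e"
  define \<alpha> where "\<alpha> = sqrt (LINT x|M. (u x)\<^sup>2) + e / 2"
  define \<beta> where "\<beta> = sqrt (LINT x|M. (v x)\<^sup>2) + e / 2"
  have "0 \<le> (LINT x|M. (u x)\<^sup>2)" "0 \<le> (LINT x|M. (v x)\<^sup>2)"
    by simp_all
  with \<open>0 < e\<close> have pos: "0 < \<alpha>" "0 < \<beta>"
    by (simp_all add: \<alpha>_def \<beta>_def add_nonneg_pos)
  have bounds: "(LINT x|M. (u x)\<^sup>2) \<le> \<alpha>\<^sup>2" "(LINT x|M. (v x)\<^sup>2) \<le> \<beta>\<^sup>2"
    using \<open>0 < e\<close> by (simp_all add: \<alpha>_def \<beta>_def sqrt_le_D)
  have pw: "(w x)\<^sup>2 \<le> (1 + \<beta> / \<alpha>) * (u x)\<^sup>2 + (1 + \<alpha> / \<beta>) * (v x)\<^sup>2" for x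
  proof -
    have "(w x)\<^sup>2 \<le> (u x + v x)\<^sup>2"
      using le[of x] by (metis abs_le_square_iff abs_of_nonneg abs_ge_zero order_trans)
    moreover have "0 \<le> (\<beta> * u x - \<alpha> * v x)\<^sup>2 / (\<alpha> * \<beta>)"
      using pos by simp
    moreover have "(\<beta> * u x - \<alpha> * v x)\<^sup>2 / (\<alpha> * \<beta>) =
        (1 + \<beta> / \<alpha>) * (u x)\<^sup>2 + (1 + \<alpha> / \<beta>) * (v x)\<^sup>2 - (u x + v x)\<^sup>2"
      using pos by (simp add: field_simps power2_eq_square)
    ultimately show ?thesis
      by linarith
  qed
  have "(LINT x|M. (w x)\<^sup>2) \<le> (LINT x|M. (1 + \<beta> / \<alpha>) * (u x)\<^sup>2 + (1 + \<alpha> / \<beta>) * (v x)\<^sup>2)"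
    by (intro integral_mono w Bochner_Integration.integrable_add integrable_mult_right u v pw)
  also have "\<dots> = (1 + \<beta> / \<alpha>) * (LINT x|M. (u x)\<^sup>2) + (1 + \<alpha> / \<beta>) * (LINT x|M. (v x)\<^sup>2)"
    using u v by simp
  also have "\<dots> \<le> (1 + \<beta> / \<alpha>) * \<alpha>\<^sup>2 + (1 + \<alpha> / \<beta>) * \<beta>\<^sup>2"
    using pos by (intro add_mono mult_left_mono bounds) auto
  also have "\<dots> = (\<alpha> + \<beta>)\<^sup>2"
    using pos by (simp add: field_simps power2_eq_square)
  finally have "sqrt (LINT x|M. (w x)\<^sup>2) \<le> \<alpha> + \<beta>"
    using pos by (intro real_le_lsqrt) auto
  then show "sqrt (LINT x|M. (w x)\<^sup>2) \<le>
      sqrt (LINT x|M. (u x)\<^sup>2) + sqrt (LINT x|M. (v x)\<^sup>2) + e"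
    by (simp add: \<alpha>_def \<beta>_def)
qed

lemma Metric_space_L2: "Metric_space (L2 J) (L2_dist J)"
proof
  fix F G :: "'h::{complex_hilbert, second_countable_topology} L2_elem"
  show "0 \<le> L2_dist J F G"
    by (simp add: L2_dist_def)
  show "L2_dist J F G = L2_dist J G F"
    by (simp add: L2_dist_def norm_minus_commute)
  assume FG: "F \<in> L2 J" "G \<in> L2 J"
  have "L2_dist J F G = 0 \<longleftrightarrow> (AE x in lebesgue_on J. L2_rep F x = L2_rep G x)"
    using integral_nonneg_eq_0_iff_AE[OF integrable_norm_diff_square[OF L2_rep_in(2)[OF FG(1)] L2_rep_in(2)[OF FG(2)]]]
    by (simp add: L2_dist_def)
  also have "\<dots> \<longleftrightarrow> (L2_rep F, L2_rep G) \<in> ae_rel J"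
    using L2_rep_in(2)[OF FG(1)] L2_rep_in(2)[OF FG(2)] by (simp add: ae_rel_def)
  also have "\<dots> \<longleftrightarrow> L2_class J (L2_rep F) = L2_class J (L2_rep G)"
    using eq_equiv_class_iff[OF equiv_ae_rel L2_rep_in(2)[OF FG(1)] L2_rep_in(2)[OF FG(2)]]
    by (simp add: L2_class_def)
  finally show "L2_dist J F G = 0 \<longleftrightarrow> F = G"
    using L2_rep_in(3)[OF FG(1)] L2_rep_in(3)[OF FG(2)] by simp
next
  fix F G H :: "'h::{complex_hilbert, second_countable_topology} L2_elem"
  assume FGH: "F \<in> L2 J" "G \<in> L2 J" "H \<in> L2 J"
  have "norm (L2_rep F x - L2_rep H x)
      \<le> norm (L2_rep F x - L2_rep G x) + norm (L2_rep G x - L2_rep H x)" for x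
    using norm_triangle_ineq[of "L2_rep F x - L2_rep G x" "L2_rep G x - L2_rep H x"] by simp
  then show "L2_dist J F H \<le> L2_dist J F G + L2_dist J G H"
    unfolding L2_dist_def using FGH
    by (intro sqrt_integral_Minkowski integrable_norm_diff_square L2_rep_in(2)) auto
qed

definition L2_topology ::
    "real set \<Rightarrow> 'h::{complex_hilbert, second_countable_topology} L2_elem topology"
  where "L2_topology J = Metric_space.mtopology (L2 J) (L2_dist J)"


section \<open>Unbounded operators\<close>

text \<open>
  An operator in the Hilbert space \<^term>\<open>L2 J\<close> is identified with its graph, so that
  \<^const>\<open>Domain\<close> yields its domain, inclusion of operators is \<open>\<subseteq>\<close>, and
  equality of operators is equality of domains and values.
\<close>

type_synonym 'h L2_graph = "('h L2_elem \<times> 'h L2_elem) set"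

definition linear_operator ::
    "real set \<Rightarrow> 'h::{complex_hilbert, second_countable_topology} L2_graph \<Rightarrow> bool"
  where "linear_operator J A \<longleftrightarrow>
    A \<subseteq> L2 J \<times> L2 J \<and> A \<noteq> {} \<and> single_valued A \<and>
    (\<forall>(F, F')\<in>A. \<forall>(G, G')\<in>A. (L2_add J F G, L2_add J F' G') \<in> A) \<and>
    (\<forall>c. \<forall>(F, F')\<in>A. (L2_scale J c F, L2_scale J c F') \<in> A)"

definition densely_defined ::
    "real set \<Rightarrow> 'h::{complex_hilbert, second_countable_topology} L2_graph \<Rightarrow> bool"
  where "densely_defined J A \<longleftrightarrow>
    linear_operator J A \<and> L2_topology J closure_of Domain A = L2 J"

definition closed_operator ::
    "real set \<Rightarrow> 'h::{complex_hilbert, second_countable_topology} L2_graph \<Rightarrow> bool"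
  where "closed_operator J A \<longleftrightarrow>
    linear_operator J A \<and> closedin (prod_topology (L2_topology J) (L2_topology J)) A"

definition op_closure ::
    "real set \<Rightarrow> 'h::{complex_hilbert, second_countable_topology} L2_graph \<Rightarrow> 'h L2_graph"
  where "op_closure J A = prod_topology (L2_topology J) (L2_topology J) closure_of A"

text \<open>
  The adjoint consists of the pairs \<open>(G, G')\<close> with \<open>\<langle>G, A F\<rangle> = \<langle>G', F\<rangle>\<close> for all
  \<open>F\<close> in the domain of \<open>A\<close>; it is single valued precisely when \<open>A\<close> is densely defined.
\<close>

definition op_adjoint ::
    "real set \<Rightarrow> 'h::{complex_hilbert, second_countable_topology} L2_graph \<Rightarrow> 'h L2_graph"
  where "op_adjoint J A = {(G, G') \<in> L2 J \<times> L2 J.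
    \<forall>(F, F')\<in>A. L2_inner J G F' = L2_inner J G' F}"

definition symmetric_operator ::
    "real set \<Rightarrow> 'h::{complex_hilbert, second_countable_topology} L2_graph \<Rightarrow> bool"
  where "symmetric_operator J A \<longleftrightarrow>
    densely_defined J A \<and>
    (\<forall>(F, F')\<in>A. \<forall>(G, G')\<in>A. L2_inner J F G' = L2_inner J F' G)"


section \<open>Maximal and minimal operators\<close>

text \<open>\<open>schroedinger V y y2\<close> is \<open>- y'' + V y\<close>, with \<open>y2\<close> for \<open>y''\<close>.\<close>

definition schroedinger ::
    "(real \<Rightarrow> ('h::complex_hilbert \<Rightarrow>\<^sub>L 'h)) \<Rightarrow> (real \<Rightarrow> 'h) \<Rightarrow> (real \<Rightarrow> 'h) \<Rightarrow> real \<Rightarrow> 'h"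
  where "schroedinger V y y2 = (\<lambda>x. - y2 x + blinfun_apply (V x) (y x))"

definition H_max ::
    "real set \<Rightarrow> (real \<Rightarrow> ('h::{complex_hilbert, second_countable_topology} \<Rightarrow>\<^sub>L 'h)) \<Rightarrow> 'h L2_graph"
  where "H_max J V = {(L2_class J g, L2_class J (schroedinger V g g2)) | g g1 g2.
    g \<in> sq_integrable J \<and> W21_loc_derivs J g g1 g2 \<and> schroedinger V g g2 \<in> sq_integrable J}"

definition dom_H_min_dot ::
    "real set \<Rightarrow> (real \<Rightarrow> ('h::{complex_hilbert, second_countable_topology} \<Rightarrow>\<^sub>L 'h)) \<Rightarrow> 'h L2_elem set"
  where "dom_H_min_dot J V =
    {F \<in> Domain (H_max J V). \<exists>g\<in>F. g \<in> W21_loc J \<and> compact (supp_in J g)}"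

definition H_min_dot ::
    "real set \<Rightarrow> (real \<Rightarrow> ('h::{complex_hilbert, second_countable_topology} \<Rightarrow>\<^sub>L 'h)) \<Rightarrow> 'h L2_graph"
  where "H_min_dot J V = {(F, F') \<in> H_max J V. F \<in> dom_H_min_dot J V}"

definition H_min ::
    "real set \<Rightarrow> (real \<Rightarrow> ('h::{complex_hilbert, second_countable_topology} \<Rightarrow>\<^sub>L 'h)) \<Rightarrow> 'h L2_graph"
  where "H_min J V = op_closure J (H_min_dot J V)"

end

theory Submission
  imports Defs
begin

text \<open>
  The core is the identity of \<open>H_max\<close> with the adjoint of \<open>H_min_dot\<close>.  One inclusion is
  Green's formula: two integrations by parts on a compact interval outside of which the second
  function vanishes (\<open>Green\<close>).  The other inclusion is regularity of weak solutions.  Suppose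
  \<open>\<langle>G, \<tau> F\<rangle> = \<langle>G', F\<rangle>\<close> for all compactly supported \<open>F\<close> with \<open>F\<close> and \<open>\<tau> F\<close> square integrable.
  As \<open>V\<close> is only locally integrable, smooth functions need not be admissible for \<open>F\<close>, so the
  test functions have to be manufactured from \<open>V\<close> itself.

  This is done on a fixed compact interval \<open>{c..d}\<close>.  Split \<open>V = W + Vb\<close>, where \<open>W\<close> is \<open>V\<close> cut
  off to the set where its norm exceeds a large \<open>n\<close>.  Then the integral of the norm of \<open>W\<close> is as
  small as desired, and \<open>Vb\<close> is bounded, so that it preserves square integrability and can be
  moved to the right-hand side.  There is an explicit continuous scalar kernel \<open>k\<close> whose integral
  operator \<open>K\<close> produces functions \<open>K q\<close> with vanishing Cauchy data at both ends and
  \<open>- (K q)'' = q - P q\<close>; here \<open>P q\<close> is the affine function having the same integral and the same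
  first moment as \<open>q\<close>, which is exactly the obstruction to meeting the four boundary conditions.
  Since \<open>W\<close> is small, the equation \<open>F = K (f - W F)\<close> has a continuous solution for each
  square integrable \<open>f\<close>, by Banach's fixed point theorem (\<open>kernel_equation_solution\<close>).  Extended
  by zero, \<open>F\<close> is admissible, and \<open>\<tau> F = f - P (f - W F) + Vb F\<close> on \<open>{c..d}\<close>.

  Now let \<open>A\<close> be the affine function obtained by applying the transpose of \<open>P\<close> to \<open>G\<close>, let
  \<open>g = G' - Vb G - W A\<close>, and solve the transposed equation \<open>z = K\<^sup>T (g - W z)\<close>.  Fubini's theorem
  turns the assumption into \<open>\<langle>G - A, f\<rangle> = \<langle>g, F\<rangle> = \<langle>z, f\<rangle>\<close> for all \<open>f\<close>.  Hence \<open>G = A + z\<close> almost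
  everywhere, and the right-hand side is a Sobolev function with \<open>- (A + z)'' = g - W z\<close>, that is,
  \<open>\<tau> G = G'\<close> (\<open>weak_solution_regular\<close>).  Uniqueness of the continuous representatives and of
  their derivatives glues the solutions on the compact subintervals together (\<open>W21_loc_glue\<close>).

  The remaining claims are soft.  With \<open>G = 0\<close> the regularity result says that only zero is
  orthogonal to the domain of \<open>H_min_dot\<close>, which gives density by completeness of \<open>L\<^sup>2\<close> and also
  single-valuedness of \<open>H_max\<close>.  Adjoints are closed, and \<open>H_min_dot\<close> is symmetric because it is
  contained in \<open>H_max\<close>.  Finally, the second adjoint is the closure: this is the
  same orthogonality argument (\<open>L2_double_orthogonal\<close>) applied to graphs, which are subspaces of the
  square integrable functions with values in \<open>'h \<times> 'h\<close>.
\<close>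

section \<open>Calculus of the inner product\<close>

lemma cinner_add_left: "cinner (x + y) z = cinner x z + cinner y z"
  by (metis cinner_add_right cinner_commute complex_cnj_add)

lemma cinner_scaleC_left: "cinner (c *\<^sub>C x) y = cnj c * cinner x y"
  by (metis cinner_scaleC_right cinner_commute complex_cnj_mult)

lemma cinner_scaleR_right: "cinner x (r *\<^sub>R y) = r *\<^sub>R cinner x y"
  by (metis cinner_scaleC_right scaleC_of_real scaleR_conv_of_real)

lemma cinner_scaleR_left: "cinner (r *\<^sub>R x) y = r *\<^sub>R cinner x y"
  by (metis cinner_scaleC_left scaleC_of_real scaleR_conv_of_real complex_cnj_complex_of_real)

lemma cinner_minus_right: "cinner x (- y) = - cinner x y"
  using cinner_scaleR_right[of x "-1" y] by simp

lemma cinner_minus_left: "cinner (- x) y = - cinner x y"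
  using cinner_scaleR_left[of "-1" x y] by simp

lemma cinner_diff_right: "cinner x (y - z) = cinner x y - cinner x z"
  using cinner_add_right[of x y "- z"] by (simp add: cinner_minus_right)

lemma cinner_diff_left: "cinner (x - y) z = cinner x z - cinner y z"
  using cinner_add_left[of x "- y" z] by (simp add: cinner_minus_left)

lemma cinner_zero_right [simp]: "cinner x 0 = 0"
  using cinner_scaleR_right[of x 0 0] by simp

lemma cinner_zero_left [simp]: "cinner 0 x = 0"
  using cinner_scaleR_left[of 0 0 x] by simp

lemmas cinner_simps = cinner_add_left cinner_add_right cinner_scaleC_left cinner_scaleC_right
  cinner_scaleR_left cinner_scaleR_right cinner_minus_left cinner_minus_right
  cinner_diff_left cinner_diff_right

lemma scaleC_zero_right [simp]: "c *\<^sub>C (0::'h::complex_hilbert) = 0"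
  using scaleC_add_right[of c 0 "0::'h"] by simp

lemma norm_sq_eq_cinner: "(norm x)\<^sup>2 = Re (cinner x x)"
  by (simp add: cinner_self)

lemma norm_scaleC: "norm (c *\<^sub>C x) = cmod c * norm (x::'h::complex_hilbert)"
proof -
  have "cinner (c *\<^sub>C x) (c *\<^sub>C x) = (c * cnj c) * of_real ((norm x)\<^sup>2)"
    unfolding cinner_scaleC_left cinner_scaleC_right cinner_self[of x] by simp
  also have "c * cnj c = of_real ((cmod c)\<^sup>2)"
    using complex_norm_square[of c] by simp
  finally have "(norm (c *\<^sub>C x))\<^sup>2 = (cmod c)\<^sup>2 * (norm x)\<^sup>2"
    unfolding norm_sq_eq_cinner[of "c *\<^sub>C x"] of_real_mult[symmetric] by (metis Re_complex_of_real)
  then have "(norm (c *\<^sub>C x))\<^sup>2 = (cmod c * norm x)\<^sup>2"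
    unfolding power_mult_distrib .
  then show ?thesis by (rule power2_eq_imp_eq) auto
qed

lemma scaleC_diff_right: "c *\<^sub>C (x - y) = c *\<^sub>C x - c *\<^sub>C (y::'h::complex_hilbert)"
  by (metis add_diff_cancel diff_add_cancel scaleC_add_right)

lemma scaleC_scaleR: "c *\<^sub>C (r *\<^sub>R x) = r *\<^sub>R (c *\<^sub>C (x::'h::complex_hilbert))"
  by (metis scaleC_of_real scaleC_scaleC mult.commute)

lemma bounded_linear_scaleC: "bounded_linear (\<lambda>x::'h::complex_hilbert. c *\<^sub>C x)"
  by (rule bounded_linear_intro[where K = "cmod c"])
     (auto simp: scaleC_add_right scaleC_scaleR norm_scaleC mult.commute)

text \<open>
  The square of the norm of \<open>x - c y\<close> is nonnegative for the minimizing coefficient \<open>c\<close>.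
\<close>

lemma Cauchy_Schwarz_cinner: "norm (cinner x y) \<le> norm x * norm (y::'h::complex_hilbert)"
proof (cases "y = 0")
  case False
  define n where "n = (norm y)\<^sup>2"
  have n: "n > 0" using False by (simp add: n_def)
  define c where "c = cinner y x / of_real n"
  have yy: "cinner y y = of_real n" by (simp add: n_def cinner_self)
  have xy: "cinner x y = cnj (cinner y x)" by (rule cinner_commute)
  have "cinner (x - c *\<^sub>C y) (x - c *\<^sub>C y) =
      cinner x x - cinner y x * cnj (cinner y x) / of_real n"
    using n by (simp add: cinner_simps c_def yy xy field_simps)
  also have "\<dots> = of_real ((norm x)\<^sup>2 - (norm (cinner y x))\<^sup>2 / n)"
    by (simp add: cinner_self complex_norm_square flip: of_real_power)
  finally have "0 \<le> (norm x)\<^sup>2 - (norm (cinner y x))\<^sup>2 / n"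
    unfolding cinner_self using of_real_eq_iff by (metis zero_le_power2)
  then have "(norm (cinner y x))\<^sup>2 \<le> (norm x * norm y)\<^sup>2"
    using n by (simp add: field_simps n_def)
  then have "norm (cinner y x) \<le> norm x * norm y"
    by (rule power2_le_imp_le) simp
  then show ?thesis by (simp add: xy)
qed simp

lemma bounded_bilinear_cinner: "bounded_bilinear (cinner :: 'h::complex_hilbert \<Rightarrow> 'h \<Rightarrow> complex)"
  by standard (auto simp: cinner_simps intro!: exI[of _ 1] Cauchy_Schwarz_cinner)

lemma isCont_cinner: "continuous_on UNIV (\<lambda>(x, y). cinner x (y::'h::complex_hilbert))"
  unfolding case_prod_beta
  by (intro bounded_bilinear.continuous_on[OF bounded_bilinear_cinner] continuous_intros)

lemma borel_measurable_cinner [measurable (raw)]: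
  fixes f g :: "'a \<Rightarrow> 'h::{complex_hilbert, second_countable_topology}"
  assumes [measurable]: "f \<in> borel_measurable M" "g \<in> borel_measurable M"
  shows "(\<lambda>x. cinner (f x) (g x)) \<in> borel_measurable M"
  using borel_measurable_continuous_Pair[OF assms isCont_cinner[unfolded case_prod_beta], simplified]
  by simp

lemma borel_measurable_scaleC [measurable (raw)]:
  fixes f :: "'a \<Rightarrow> 'h::{complex_hilbert, second_countable_topology}"
  assumes "f \<in> borel_measurable M"
  shows "(\<lambda>x. c *\<^sub>C f x) \<in> borel_measurable M"
  using borel_measurable_continuous_on[OF linear_continuous_on[OF bounded_linear_scaleC] assms] by simp

text \<open>
  The Hilbert space structure on pairs makes a graph in \<open>L\<^sup>2 \<times> L\<^sup>2\<close> a space of square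
  integrable functions again, so that general facts about subspaces apply to graphs.
\<close>

instantiation prod :: (complex_hilbert, complex_hilbert) complex_hilbert
begin
definition scaleC_prod :: "complex \<Rightarrow> 'a \<times> 'b \<Rightarrow> 'a \<times> 'b"
  where "scaleC_prod c x = (c *\<^sub>C fst x, c *\<^sub>C snd x)"
definition cinner_prod :: "'a \<times> 'b \<Rightarrow> 'a \<times> 'b \<Rightarrow> complex"
  where "cinner_prod x y = cinner (fst x) (fst y) + cinner (snd x) (snd y)"
instance
proof
  fix x y :: "'a \<times> 'b"
  show "cinner x y = cnj (cinner y x)"
    by (simp add: cinner_prod_def) (metis cinner_commute)
  show "cinner x x = complex_of_real ((norm x)\<^sup>2)"
    by (simp add: cinner_prod_def norm_prod_def cinner_self)
qed (auto simp: scaleC_prod_def cinner_prod_def scaleC_of_real scaleC_scaleC scaleC_add_left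
      scaleC_add_right cinner_simps algebra_simps scaleR_prod_def)
end

section \<open>Square integrable functions\<close>

definition L2_norm_sq :: "real set \<Rightarrow> (real \<Rightarrow> 'h::{complex_hilbert, second_countable_topology}) \<Rightarrow> real"
  where "L2_norm_sq J f = (LINT x|lebesgue_on J. (norm (f x))\<^sup>2)"

definition fun_inner ::
    "real set \<Rightarrow> (real \<Rightarrow> 'h::{complex_hilbert, second_countable_topology}) \<Rightarrow> (real \<Rightarrow> 'h) \<Rightarrow> complex"
  where "fun_inner J f g = (LINT x|lebesgue_on J. cinner (f x) (g x))"

lemma sq_integrable_measurable: "f \<in> sq_integrable J \<Longrightarrow> f \<in> borel_measurable (lebesgue_on J)"
  by (simp add: sq_integrable_def)

lemma sq_integrable_norm_sq: "f \<in> sq_integrable J \<Longrightarrow> integrable (lebesgue_on J) (\<lambda>x. (norm (f x))\<^sup>2)"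
  by (simp add: sq_integrable_def)

lemma sq_integrable_zero [simp]: "(\<lambda>x. 0) \<in> sq_integrable J"
  by (simp add: sq_integrable_def)

lemma sq_integrable_diff:
  "f \<in> sq_integrable J \<Longrightarrow> g \<in> sq_integrable J \<Longrightarrow> (\<lambda>x. f x - g x) \<in> sq_integrable J"
  using integrable_norm_diff_square by (auto simp: sq_integrable_def)

lemma sq_integrable_minus: "f \<in> sq_integrable J \<Longrightarrow> (\<lambda>x. - f x) \<in> sq_integrable J"
  by (auto simp: sq_integrable_def)

lemma sq_integrable_add:
  "f \<in> sq_integrable J \<Longrightarrow> g \<in> sq_integrable J \<Longrightarrow> (\<lambda>x. f x + g x) \<in> sq_integrable J"
  using sq_integrable_diff[OF _ sq_integrable_minus] by force

lemma sq_integrable_scaleC: "f \<in> sq_integrable J \<Longrightarrow> (\<lambda>x. c *\<^sub>C f x) \<in> sq_integrable J"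
  by (auto simp: sq_integrable_def norm_scaleC power_mult_distrib)

lemma sq_integrable_AE_cong:
  assumes "f \<in> sq_integrable J" "AE x in lebesgue_on J. f x = g x" "g \<in> borel_measurable (lebesgue_on J)"
  shows "g \<in> sq_integrable J"
proof -
  have "integrable (lebesgue_on J) (\<lambda>x. (norm (f x))\<^sup>2) =
    integrable (lebesgue_on J) (\<lambda>x. (norm (g x))\<^sup>2)"
    using assms by (intro integrable_cong_AE) (auto simp: sq_integrable_def)
  then show ?thesis using assms by (simp add: sq_integrable_def)
qed

lemma sq_integrable_cinner:
  assumes "f \<in> sq_integrable J" "g \<in> sq_integrable J"
  shows "integrable (lebesgue_on J) (\<lambda>x. cinner (f x) (g x))"
proof (rule Bochner_Integration.integrable_bound)
  have [measurable]: "f \<in> borel_measurable (lebesgue_on J)" "g \<in> borel_measurable (lebesgue_on J)"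
    using assms by (auto simp: sq_integrable_def)
  show "integrable (lebesgue_on J) (\<lambda>x. (norm (f x))\<^sup>2 + (norm (g x))\<^sup>2)"
    using assms by (auto simp: sq_integrable_def)
  show "(\<lambda>x. cinner (f x) (g x)) \<in> borel_measurable (lebesgue_on J)" by measurable
  have "norm (cinner (f x) (g x)) \<le> norm ((norm (f x))\<^sup>2 + (norm (g x))\<^sup>2)" for x
  proof -
    have "norm (cinner (f x) (g x)) \<le> norm (f x) * norm (g x)" by (rule Cauchy_Schwarz_cinner)
    also have "\<dots> \<le> (norm (f x))\<^sup>2 + (norm (g x))\<^sup>2"
      using sum_squares_bound[of "norm (f x)" "norm (g x)"]
        mult_nonneg_nonneg[OF norm_ge_zero norm_ge_zero, of "f x" "g x"]
      unfolding mult.assoc by linarith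
    finally show ?thesis by simp
  qed
  then show "AE x in lebesgue_on J. norm (cinner (f x) (g x)) \<le> norm ((norm (f x))\<^sup>2 + (norm (g x))\<^sup>2)"
    by simp
qed

lemma fun_inner_simps:
  assumes "f \<in> sq_integrable J" "g \<in> sq_integrable J" "h \<in> sq_integrable J"
  shows "fun_inner J (\<lambda>x. f x + g x) h = fun_inner J f h + fun_inner J g h"
    "fun_inner J (\<lambda>x. f x - g x) h = fun_inner J f h - fun_inner J g h"
    "fun_inner J h (\<lambda>x. f x + g x) = fun_inner J h f + fun_inner J h g"
    "fun_inner J h (\<lambda>x. f x - g x) = fun_inner J h f - fun_inner J h g"
  using assms by (auto simp: fun_inner_def cinner_simps sq_integrable_cinner)

lemma fun_inner_scaleC_right: "fun_inner J f (\<lambda>x. c *\<^sub>C g x) = c * fun_inner J f g"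
  by (simp add: fun_inner_def cinner_simps)

lemma fun_inner_minus:
  "fun_inner J f (\<lambda>x. - g x) = - fun_inner J f g" "fun_inner J (\<lambda>x. - f x) g = - fun_inner J f g"
  by (simp_all add: fun_inner_def cinner_simps)

lemma fun_inner_commute: "fun_inner J f g = cnj (fun_inner J g f)"
proof -
  have "fun_inner J f g = (LINT x|lebesgue_on J. cnj (cinner (g x) (f x)))"
    unfolding fun_inner_def
    by (rule Bochner_Integration.integral_cong[OF refl]) (rule cinner_commute)
  also have "\<dots> = cnj (fun_inner J g f)"
    unfolding fun_inner_def by (rule Bochner_Integration.integral_cnj)
  finally show ?thesis .
qed

lemma fun_inner_self: "fun_inner J f f = of_real (L2_norm_sq J f)"
  by (simp add: fun_inner_def L2_norm_sq_def cinner_self flip: of_real_power)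

lemma fun_inner_zero [simp]: "fun_inner J (\<lambda>x. 0) g = 0" "fun_inner J g (\<lambda>x. 0) = 0"
  by (simp_all add: fun_inner_def)

lemma fun_inner_cong_AE:
  assumes "AE x in lebesgue_on J. f x = f' x" "AE x in lebesgue_on J. g x = g' x"
    "f \<in> borel_measurable (lebesgue_on J)" "f' \<in> borel_measurable (lebesgue_on J)"
    "g \<in> borel_measurable (lebesgue_on J)" "g' \<in> borel_measurable (lebesgue_on J)"
  shows "fun_inner J f g = fun_inner J f' g'"
  unfolding fun_inner_def
proof (rule integral_cong_AE)
  show "AE x in lebesgue_on J. cinner (f x) (g x) = cinner (f' x) (g' x)"
    using assms(1,2) by eventually_elim simp
qed (use assms(3-6) in \<open>auto intro!: borel_measurable_cinner\<close>)

lemma L2_norm_sq_nonneg [simp]: "0 \<le> L2_norm_sq J f"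
  by (simp add: L2_norm_sq_def)

lemma L2_norm_sq_eq_0:
  assumes "f \<in> sq_integrable J" "L2_norm_sq J f = 0"
  shows "AE x in lebesgue_on J. f x = 0"
  using integral_nonneg_eq_0_iff_AE[OF sq_integrable_norm_sq[OF assms(1)]] assms(2)
  by (simp add: L2_norm_sq_def)

lemma L2_norm_triangle:
  assumes "f \<in> sq_integrable J" "g \<in> sq_integrable J"
  shows "sqrt (L2_norm_sq J (\<lambda>x. f x + g x)) \<le> sqrt (L2_norm_sq J f) + sqrt (L2_norm_sq J g)"
  unfolding L2_norm_sq_def using assms sq_integrable_add[OF assms]
  by (intro sqrt_integral_Minkowski) (auto simp: sq_integrable_def norm_triangle_ineq)

lemma L2_norm_triangle_diff:
  assumes "f \<in> sq_integrable J" "g \<in> sq_integrable J" "h \<in> sq_integrable J"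
  shows "sqrt (L2_norm_sq J (\<lambda>x. f x - h x))
    \<le> sqrt (L2_norm_sq J (\<lambda>x. f x - g x)) + sqrt (L2_norm_sq J (\<lambda>x. g x - h x))"
  using L2_norm_triangle[of "\<lambda>x. f x - g x" J "\<lambda>x. g x - h x"] assms
  by (simp add: sq_integrable_diff)

lemma parallelogram:
  fixes x y :: "'h::complex_hilbert"
  shows "(norm (x + y))\<^sup>2 + (norm (x - y))\<^sup>2 = 2 * (norm x)\<^sup>2 + 2 * (norm y)\<^sup>2"
  by (simp add: norm_sq_eq_cinner cinner_simps)

lemma L2_norm_sq_parallelogram:
  assumes "f \<in> sq_integrable J" "g \<in> sq_integrable J"
  shows "L2_norm_sq J (\<lambda>x. f x + g x) + L2_norm_sq J (\<lambda>x. f x - g x) =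
    2 * L2_norm_sq J f + 2 * L2_norm_sq J g"
proof -
  note int = sq_integrable_norm_sq[OF sq_integrable_add[OF assms]]
    sq_integrable_norm_sq[OF sq_integrable_diff[OF assms]] assms[THEN sq_integrable_norm_sq]
  have "L2_norm_sq J (\<lambda>x. f x + g x) + L2_norm_sq J (\<lambda>x. f x - g x) =
      (LINT x|lebesgue_on J. (norm (f x + g x))\<^sup>2 + (norm (f x - g x))\<^sup>2)"
    unfolding L2_norm_sq_def by (rule Bochner_Integration.integral_add[OF int(1,2), symmetric])
  also have "\<dots> = (LINT x|lebesgue_on J. 2 * (norm (f x))\<^sup>2 + 2 * (norm (g x))\<^sup>2)"
    by (simp only: parallelogram)
  also have "\<dots> = 2 * L2_norm_sq J f + 2 * L2_norm_sq J g"
    using int(3,4) by (simp add: L2_norm_sq_def)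
  finally show ?thesis .
qed

lemma L2_norm_sq_scale: "L2_norm_sq J (\<lambda>x. c *\<^sub>C f x) = (cmod c)\<^sup>2 * L2_norm_sq J f"
  by (simp add: L2_norm_sq_def norm_scaleC power_mult_distrib)

text \<open>
  Integrating \<open>2 \<bar>u v\<bar> \<le> t u\<^sup>2 + v\<^sup>2 / t\<close> and optimizing over \<open>t\<close> yields the product bound; the
  degenerate case is reached by letting \<open>t\<close> be large.
\<close>

lemma fun_inner_Cauchy_Schwarz:
  assumes f: "f \<in> sq_integrable J" and g: "g \<in> sq_integrable J"
  shows "cmod (fun_inner J f g) \<le> sqrt (L2_norm_sq J f) * sqrt (L2_norm_sq J g)"
proof -
  let ?a = "sqrt (L2_norm_sq J f)" and ?b = "sqrt (L2_norm_sq J g)"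
  have *: "cmod (fun_inner J f g) \<le> (t * L2_norm_sq J f + L2_norm_sq J g / t) / 2" if "t > 0" for t
  proof -
    have "cmod (fun_inner J f g) \<le> (LINT x|lebesgue_on J. norm (cinner (f x) (g x)))"
      unfolding fun_inner_def by simp
    also have "\<dots> \<le> (LINT x|lebesgue_on J. (t / 2) * (norm (f x))\<^sup>2 + (1 / (2 * t)) * (norm (g x))\<^sup>2)"
    proof (rule integral_mono)
      fix x
      have "0 \<le> (t * norm (f x) - norm (g x))\<^sup>2 / (2 * t)" using that by simp
      also have "\<dots> = (t / 2) * (norm (f x))\<^sup>2 + (1 / (2 * t)) * (norm (g x))\<^sup>2 - norm (f x) * norm (g x)"
        using that by (simp add: power2_eq_square field_simps)
      finally show "norm (cinner (f x) (g x)) \<le> (t / 2) * (norm (f x))\<^sup>2 + (1 / (2 * t)) * (norm (g x))\<^sup>2"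
        using Cauchy_Schwarz_cinner[of "f x" "g x"] by linarith
    qed (use f g sq_integrable_cinner[OF f g] in \<open>auto simp: sq_integrable_def\<close>)
    also have "\<dots> = (t * L2_norm_sq J f + L2_norm_sq J g / t) / 2"
      using f g that by (simp add: L2_norm_sq_def sq_integrable_def field_simps)
    finally show ?thesis .
  qed
  define c where "c = cmod (fun_inner J f g)"
  let ?A = "L2_norm_sq J f" and ?B = "L2_norm_sq J g"
  have AB: "?A \<ge> 0" "?B \<ge> 0" by auto
  have bd: "2 * c \<le> t * ?A + ?B / t" if "t > 0" for t
    using *[OF that] by (simp add: c_def)
  have "c\<^sup>2 \<le> ?A * ?B"
  proof (cases "c > 0")
    case c: True
    have "?A \<noteq> 0"
    proof
      assume "?A = 0"
      have "2 * c \<le> ?B / ((?B + 1) / c)"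
        using bd[of "(?B + 1) / c"] c AB \<open>?A = 0\<close> by simp
      also have "\<dots> = c * (?B / (?B + 1))" by simp
      also have "\<dots> \<le> c * 1"
        using c AB by (intro mult_left_mono) (auto simp: divide_le_eq_1 add_nonneg_pos)
      finally show False using c by simp
    qed
    then have A: "?A > 0" using AB by linarith
    have "2 * c \<le> c + ?B / (c / ?A)"
      using bd[of "c / ?A"] c A by simp
    then show ?thesis using c A by (simp add: field_simps power2_eq_square)
  next
    case False
    then have "c = 0" by (simp add: c_def)
    then show ?thesis using AB by simp
  qed
  then have "c \<le> sqrt (?A * ?B)" by (rule real_le_rsqrt)
  then show ?thesis by (simp add: c_def real_sqrt_mult)
qed

section \<open>Completeness and orthogonal complements\<close>

lemma L2_norm_sq_minus_commute: "L2_norm_sq J (\<lambda>x. f x - g x) = L2_norm_sq J (\<lambda>x. g x - f x)"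
  by (simp add: L2_norm_sq_def norm_minus_commute)

text \<open>
  Geometric decay of the increments bounds the \<open>L\<^sup>2\<close> norms of the partial sums of
  \<open>\<parallel>h (n + 1) x - h n x\<parallel>\<close> by Minkowski's inequality; by monotone convergence the full series is
  finite almost everywhere, and absolutely convergent series converge.
\<close>

lemma L2_summable_AE:
  fixes h :: "nat \<Rightarrow> real \<Rightarrow> 'h::{complex_hilbert, second_countable_topology}"
  assumes h: "\<And>n. h n \<in> sq_integrable J"
    and le: "\<And>n. sqrt (L2_norm_sq J (\<lambda>x. h (Suc n) x - h n x)) \<le> (1/2) ^ n"
  shows "AE x in lebesgue_on J. convergent (\<lambda>n. h n x)"
proof -
  define s where "s k x = (\<Sum>n<k. norm (h (Suc n) x - h n x))" for k x
  have [measurable]: "h n \<in> borel_measurable (lebesgue_on J)" for n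
    using h by (simp add: sq_integrable_def)
  have [measurable]: "s k \<in> borel_measurable (lebesgue_on J)" for k
    unfolding s_def by measurable
  have s_nonneg: "0 \<le> s k x" for k x by (simp add: s_def sum_nonneg)
  have d: "integrable (lebesgue_on J) (\<lambda>x. (norm (h (Suc n) x - h n x))\<^sup>2)" for n
    by (rule integrable_norm_diff_square[OF h h])
  have s: "integrable (lebesgue_on J) (\<lambda>x. (s k x)\<^sup>2) \<and>
      sqrt (LINT x|lebesgue_on J. (s k x)\<^sup>2) \<le> (\<Sum>n<k. (1/2) ^ n)" for k
  proof (induction k)
    case 0
    show ?case by (simp add: s_def)
  next
    case (Suc k)
    let ?e = "\<lambda>x. norm (h (Suc k) x - h k x)"
    have eq: "s (Suc k) x = s k x + ?e x" for x by (simp add: s_def)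
    have int: "integrable (lebesgue_on J) (\<lambda>x. (s (Suc k) x)\<^sup>2)"
    proof (rule Bochner_Integration.integrable_bound)
      show "integrable (lebesgue_on J) (\<lambda>x. 2 * (s k x)\<^sup>2 + 2 * (?e x)\<^sup>2)"
        using Suc d by simp
      have "(s (Suc k) x)\<^sup>2 \<le> 2 * (s k x)\<^sup>2 + 2 * (?e x)\<^sup>2" for x
        using zero_le_power2[of "s k x - ?e x"] by (simp add: eq power2_eq_square algebra_simps)
      then show "AE x in lebesgue_on J. norm ((s (Suc k) x)\<^sup>2) \<le> norm (2 * (s k x)\<^sup>2 + 2 * (?e x)\<^sup>2)"
        by simp
    qed measurable
    have "sqrt (LINT x|lebesgue_on J. (s (Suc k) x)\<^sup>2)
        \<le> sqrt (LINT x|lebesgue_on J. (s k x)\<^sup>2) + sqrt (LINT x|lebesgue_on J. (?e x)\<^sup>2)"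
      using Suc d int by (intro sqrt_integral_Minkowski) (auto simp: eq s_nonneg)
    also have "\<dots> \<le> (\<Sum>n<k. (1/2) ^ n) + (1/2) ^ k"
      using Suc le[of k] by (simp add: L2_norm_sq_def)
    finally show ?case using int by simp
  qed
  have s4: "(LINT x|lebesgue_on J. (s k x)\<^sup>2) \<le> 4" for k
  proof -
    have "(\<Sum>n<k. (1/2::real) ^ n) \<le> 2"
      using sum_gp_strict[of "1/2::real" k] by simp
    then have "sqrt (LINT x|lebesgue_on J. (s k x)\<^sup>2) \<le> 2" using s[of k] by linarith
    then show ?thesis using sqrt_le_D by fastforce
  qed
  have "(\<integral>\<^sup>+x. (SUP k. ennreal ((s k x)\<^sup>2)) \<partial>lebesgue_on J) =
      (SUP k. \<integral>\<^sup>+x. ennreal ((s k x)\<^sup>2) \<partial>lebesgue_on J)"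
  proof (rule nn_integral_monotone_convergence_SUP)
    show "incseq (\<lambda>k x. ennreal ((s k x)\<^sup>2))"
      unfolding incseq_Suc_iff le_fun_def
      by (intro allI ennreal_leI power_mono s_nonneg) (simp add: s_def)
  qed measurable
  also have "\<dots> \<le> 4"
  proof (rule SUP_least)
    fix k
    have "(\<integral>\<^sup>+x. ennreal ((s k x)\<^sup>2) \<partial>lebesgue_on J) = ennreal (LINT x|lebesgue_on J. (s k x)\<^sup>2)"
      using s by (intro nn_integral_eq_integral) auto
    also have "\<dots> \<le> ennreal 4" by (intro ennreal_leI s4)
    finally show "(\<integral>\<^sup>+x. ennreal ((s k x)\<^sup>2) \<partial>lebesgue_on J) \<le> 4" by simp
  qed
  also have "\<dots> < \<infinity>" by simp
  finally have "AE x in lebesgue_on J. (SUP k. ennreal ((s k x)\<^sup>2)) \<noteq> \<infinity>"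
    by (intro nn_integral_noteq_infinite) auto
  then show ?thesis
  proof eventually_elim
    case (elim x)
    then obtain c where c: "(SUP k. ennreal ((s k x)\<^sup>2)) = ennreal c" "c \<ge> 0"
      by (cases "SUP k. ennreal ((s k x)\<^sup>2)") auto
    have "s k x \<le> sqrt c" for k
    proof -
      have "ennreal ((s k x)\<^sup>2) \<le> ennreal c" unfolding c(1)[symmetric] by (rule SUP_upper) simp
      then show ?thesis using c(2) by (simp add: real_le_rsqrt)
    qed
    then have "summable (\<lambda>n. norm (h (Suc n) x - h n x))"
      by (intro summableI_nonneg_bounded[where x = "sqrt c"]) (auto simp: s_def)
    then have "summable (\<lambda>n. h (Suc n) x - h n x)" by (rule summable_norm_cancel)
    then have "convergent (\<lambda>n. (\<Sum>i<n. h (Suc i) x - h i x) + h 0 x)"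
      by (intro convergent_add convergent_const) (simp add: summable_iff_convergent)
    then show ?case by (simp add: sum_lessThan_telescope[of "\<lambda>i. h i x"])
  qed
qed

text \<open>
  The theorem of Riesz and Fischer.  A rapidly convergent subsequence has a pointwise limit almost
  everywhere, and Fatou's lemma transfers the Cauchy estimate of the whole sequence to that limit.
\<close>

lemma L2_complete:
  fixes f :: "nat \<Rightarrow> real \<Rightarrow> 'h::{complex_hilbert, second_countable_topology}"
  assumes f: "\<And>n. f n \<in> sq_integrable J"
    and Cauchy: "\<And>e. e > 0 \<Longrightarrow> \<exists>N. \<forall>m\<ge>N. \<forall>n\<ge>N. L2_norm_sq J (\<lambda>x. f m x - f n x) \<le> e"
  obtains g where "g \<in> sq_integrable J" "(\<lambda>n. L2_norm_sq J (\<lambda>x. f n x - g x)) \<longlonglongrightarrow> 0"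
proof -
  have [measurable]: "f n \<in> borel_measurable (lebesgue_on J)" for n
    using f by (simp add: sq_integrable_def)
  obtain N where N: "\<And>k m n. m \<ge> N k \<Longrightarrow> n \<ge> N k \<Longrightarrow>
      L2_norm_sq J (\<lambda>x. f m x - f n x) \<le> ((1/2) ^ k)\<^sup>2"
    using Cauchy[of "((1/2) ^ k)\<^sup>2" for k] by (metis zero_less_divide_1_iff zero_less_numeral zero_less_power)
  \<comment> \<open>a monotone choice of indices with \<open>N k \<le> r k\<close> and \<open>k \<le> r k\<close>\<close>
  define r where "r k = (\<Sum>i\<le>k. N i) + k" for k
  have rN: "r k \<ge> N k" for k
    by (simp add: r_def) (metis atMost_iff finite_atMost le_refl member_le_sum zero_le trans_le_add1)
  have rS: "r k \<le> r (Suc k)" for k by (simp add: r_def)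
  have rk: "r k \<ge> k" for k by (simp add: r_def)
  define h where "h k = f (r k)" for k
  have [measurable]: "h n \<in> borel_measurable (lebesgue_on J)" for n by (simp add: h_def)
  have "AE x in lebesgue_on J. convergent (\<lambda>n. h n x)"
  proof (rule L2_summable_AE)
    show "h n \<in> sq_integrable J" for n by (simp add: h_def f)
    show "sqrt (L2_norm_sq J (\<lambda>x. h (Suc n) x - h n x)) \<le> (1/2) ^ n" for n
      using N[of n "r (Suc n)" "r n"] rN[of n] rS[of n] by (simp add: h_def real_le_lsqrt)
  qed
  define g where "g x = lim (\<lambda>n. h n x)" for x
  have [measurable]: "g \<in> borel_measurable (lebesgue_on J)" unfolding g_def by measurable
  have lim: "AE x in lebesgue_on J. (\<lambda>n. h n x) \<longlonglongrightarrow> g x"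
    using \<open>AE x in lebesgue_on J. convergent (\<lambda>n. h n x)\<close>
    by eventually_elim (simp add: g_def convergent_LIMSEQ_iff)
  have Fatou: "(\<integral>\<^sup>+x. ennreal ((norm (f m x - g x))\<^sup>2) \<partial>lebesgue_on J) \<le> ennreal e"
    if e: "\<And>n. n \<ge> M \<Longrightarrow> L2_norm_sq J (\<lambda>x. f m x - f n x) \<le> e" for m M e
  proof -
    have "(\<integral>\<^sup>+x. ennreal ((norm (f m x - g x))\<^sup>2) \<partial>lebesgue_on J) =
        (\<integral>\<^sup>+x. liminf (\<lambda>k. ennreal ((norm (f m x - h k x))\<^sup>2)) \<partial>lebesgue_on J)"
    proof (rule nn_integral_cong_AE)
      show "AE x in lebesgue_on J. ennreal ((norm (f m x - g x))\<^sup>2) =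
          liminf (\<lambda>k. ennreal ((norm (f m x - h k x))\<^sup>2))"
        using lim
      proof eventually_elim
        case (elim x)
        have "(\<lambda>k. ennreal ((norm (f m x - h k x))\<^sup>2)) \<longlonglongrightarrow> ennreal ((norm (f m x - g x))\<^sup>2)"
          by (intro tendsto_intros elim)
        from lim_imp_Liminf[OF sequentially_bot this] show ?case by (rule sym)
      qed
    qed
    also have "\<dots> \<le> liminf (\<lambda>k. \<integral>\<^sup>+x. ennreal ((norm (f m x - h k x))\<^sup>2) \<partial>lebesgue_on J)"
      by (rule nn_integral_liminf) measurable
    also have "\<dots> \<le> ennreal e"
    proof (rule Liminf_le)
      have "(\<integral>\<^sup>+x. ennreal ((norm (f m x - h k x))\<^sup>2) \<partial>lebesgue_on J) \<le> ennreal e" if "k \<ge> M" for k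
      proof -
        have "(\<integral>\<^sup>+x. ennreal ((norm (f m x - h k x))\<^sup>2) \<partial>lebesgue_on J) =
            ennreal (L2_norm_sq J (\<lambda>x. f m x - f (r k) x))"
          unfolding L2_norm_sq_def h_def
          by (intro nn_integral_eq_integral integrable_norm_diff_square f) auto
        also have "\<dots> \<le> ennreal e" using e[of "r k"] rk[of k] that by (intro ennreal_leI) auto
        finally show ?thesis .
      qed
      then show "\<forall>\<^sub>F k in sequentially. (\<integral>\<^sup>+x. ennreal ((norm (f m x - h k x))\<^sup>2) \<partial>lebesgue_on J) \<le> ennreal e"
        by (auto simp: eventually_sequentially)
    qed simp
    finally show ?thesis .
  qed
  have int: "(\<lambda>x. f m x - g x) \<in> sq_integrable J \<and> L2_norm_sq J (\<lambda>x. f m x - g x) \<le> e"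
    if e: "\<And>n. n \<ge> M \<Longrightarrow> L2_norm_sq J (\<lambda>x. f m x - f n x) \<le> e" "e \<ge> 0" for m M e
  proof -
    have "(\<integral>\<^sup>+x. ennreal ((norm (f m x - g x))\<^sup>2) \<partial>lebesgue_on J) < \<infinity>"
      using Fatou[OF e(1)] by (rule order_le_less_trans) auto
    then have "integrable (lebesgue_on J) (\<lambda>x. (norm (f m x - g x))\<^sup>2)"
      by (intro integrableI_bounded) auto
    then have "ennreal (L2_norm_sq J (\<lambda>x. f m x - g x)) \<le> ennreal e"
      using Fatou[OF e(1)] unfolding L2_norm_sq_def by (subst nn_integral_eq_integral[symmetric]) auto
    then show ?thesis
      using \<open>integrable _ _\<close> e(2) by (simp add: sq_integrable_def)
  qed
  have "(\<lambda>x. f (N 0) x - g x) \<in> sq_integrable J"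
    using int[of "N 0" "N 0" "((1/2) ^ 0)\<^sup>2"] N[of 0 "N 0"] by auto
  from sq_integrable_diff[OF f[of "N 0"] this] have g: "g \<in> sq_integrable J" by simp
  have "(\<lambda>n. L2_norm_sq J (\<lambda>x. f n x - g x)) \<longlonglongrightarrow> 0"
  proof (rule LIMSEQ_I)
    fix e :: real assume "e > 0"
    then obtain M where M: "\<And>m n. m \<ge> M \<Longrightarrow> n \<ge> M \<Longrightarrow> L2_norm_sq J (\<lambda>x. f m x - f n x) \<le> e / 2"
      using Cauchy[of "e / 2"] by auto
    have "norm (L2_norm_sq J (\<lambda>x. f n x - g x) - 0) < e" if "n \<ge> M" for n
      using int[of M n "e / 2"] M[OF that] \<open>e > 0\<close> by auto
    then show "\<exists>no. \<forall>n\<ge>no. norm (L2_norm_sq J (\<lambda>x. f n x - g x) - 0) < e" by blast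
  qed
  with g that show thesis by blast
qed

lemma L2_norm_sq_diff_scaleC:
  assumes f: "f \<in> sq_integrable J" and g: "g \<in> sq_integrable J"
  shows "L2_norm_sq J (\<lambda>t. f t - c *\<^sub>C g t) =
    L2_norm_sq J f - 2 * Re (c * fun_inner J f g) + (cmod c)\<^sup>2 * L2_norm_sq J g"
proof -
  have cg: "(\<lambda>t. c *\<^sub>C g t) \<in> sq_integrable J" by (rule sq_integrable_scaleC[OF g])
  have "of_real (L2_norm_sq J (\<lambda>t. f t - c *\<^sub>C g t)) =
      fun_inner J (\<lambda>t. f t - c *\<^sub>C g t) (\<lambda>t. f t - c *\<^sub>C g t)"
    by (simp only: fun_inner_self)
  also have "\<dots> = fun_inner J f f - fun_inner J f (\<lambda>t. c *\<^sub>C g t)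
      - fun_inner J (\<lambda>t. c *\<^sub>C g t) f + fun_inner J (\<lambda>t. c *\<^sub>C g t) (\<lambda>t. c *\<^sub>C g t)"
    using fun_inner_simps(2)[OF f cg sq_integrable_diff[OF f cg]]
      fun_inner_simps(4)[OF f cg f] fun_inner_simps(4)[OF f cg cg] by simp
  also have "\<dots> = of_real (L2_norm_sq J f) - c * fun_inner J f g - cnj (c * fun_inner J f g)
      + of_real ((cmod c)\<^sup>2 * L2_norm_sq J g)"
    using fun_inner_commute[of J "\<lambda>t. c *\<^sub>C g t" f]
    by (simp only: fun_inner_self fun_inner_scaleC_right L2_norm_sq_scale)
  finally have "Re (of_real (L2_norm_sq J (\<lambda>t. f t - c *\<^sub>C g t))) =
      Re (of_real (L2_norm_sq J f) - c * fun_inner J f g - cnj (c * fun_inner J f g)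
        + of_real ((cmod c)\<^sup>2 * L2_norm_sq J g))"
    by (rule arg_cong)
  then show ?thesis by simp
qed

text \<open>
  An element annihilated by everything orthogonal to a subspace is a limit of elements of that
  subspace.  A sequence in \<open>Y\<close> minimizing the distance to \<open>x\<close> is Cauchy by the parallelogram
  identity; let \<open>z\<close> be its limit.  Approximate minimality makes \<open>x - z\<close> orthogonal to \<open>Y\<close>, hence
  to \<open>x\<close> by assumption and to \<open>z\<close> by continuity, so \<open>x - z\<close> is orthogonal to itself.
\<close>

lemma L2_double_orthogonal:
  fixes x :: "real \<Rightarrow> 'h::{complex_hilbert, second_countable_topology}"
  assumes Y: "Y \<subseteq> sq_integrable J" "Y \<noteq> {}"
    and add: "\<And>y z. y \<in> Y \<Longrightarrow> z \<in> Y \<Longrightarrow> (\<lambda>t. y t + z t) \<in> Y"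
    and scale: "\<And>c y. y \<in> Y \<Longrightarrow> (\<lambda>t. c *\<^sub>C y t) \<in> Y"
    and x: "x \<in> sq_integrable J"
    and orth: "\<And>w. w \<in> sq_integrable J \<Longrightarrow> (\<And>y. y \<in> Y \<Longrightarrow> fun_inner J w y = 0) \<Longrightarrow> fun_inner J w x = 0"
  obtains y where "\<And>n. y n \<in> Y" "(\<lambda>n. L2_norm_sq J (\<lambda>t. y n t - x t)) \<longlonglongrightarrow> 0"
proof -
  let ?N = "\<lambda>y. L2_norm_sq J (\<lambda>t. x t - y t)"
  define d where "d = Inf (?N ` Y)"
  have bdd: "bdd_below (?N ` Y)" by (auto intro!: bdd_belowI[of _ 0])
  have d: "d \<le> ?N y" if "y \<in> Y" for y
    unfolding d_def using bdd that by (auto intro: cInf_lower)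
  have "\<exists>y. y \<in> Y \<and> ?N y < d + 1 / real (Suc n)" for n
  proof -
    have "Inf (?N ` Y) < d + 1 / real (Suc n)" by (simp add: d_def)
    then show ?thesis using cInf_lessD[of "?N ` Y"] Y by fastforce
  qed
  then obtain y where y: "\<And>n. y n \<in> Y" and yN: "\<And>n. ?N (y n) < d + 1 / real (Suc n)" by metis
  have ysq: "y n \<in> sq_integrable J" for n using y Y by blast
  have dist: "L2_norm_sq J (\<lambda>t. y m t - y n t) \<le> 2 / real (Suc m) + 2 / real (Suc n)" for m n
  proof -
    let ?u = "\<lambda>t. x t - y m t" and ?v = "\<lambda>t. x t - y n t"
    have "(\<lambda>t. (1/2) *\<^sub>C (y m t + y n t)) \<in> Y" by (intro scale add y)
    then have "d \<le> ?N (\<lambda>t. (1/2) *\<^sub>C (y m t + y n t))" by (rule d)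
    also have "(\<lambda>t. x t - (1/2) *\<^sub>C (y m t + y n t)) = (\<lambda>t. (1/2) *\<^sub>C (?u t + ?v t))"
    proof
      fix t
      have half: "(1/2) *\<^sub>C z = (1/2) *\<^sub>R z" for z :: 'h
        using scaleC_of_real[of "1/2" z] by simp
      show "x t - (1/2) *\<^sub>C (y m t + y n t) = (1/2) *\<^sub>C (?u t + ?v t)"
        unfolding half by (simp add: algebra_simps flip: scaleR_left_distrib)
    qed
    also have "L2_norm_sq J (\<lambda>t. (1/2) *\<^sub>C (?u t + ?v t)) = L2_norm_sq J (\<lambda>t. ?u t + ?v t) / 4"
      by (simp add: L2_norm_sq_scale power2_eq_square)
    finally have "4 * d \<le> L2_norm_sq J (\<lambda>t. ?u t + ?v t)" by simp
    moreover have "L2_norm_sq J (\<lambda>t. ?u t + ?v t) + L2_norm_sq J (\<lambda>t. ?u t - ?v t) =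
        2 * ?N (y m) + 2 * ?N (y n)"
      by (intro L2_norm_sq_parallelogram sq_integrable_diff x ysq)
    moreover have "L2_norm_sq J (\<lambda>t. ?u t - ?v t) = L2_norm_sq J (\<lambda>t. y m t - y n t)"
      by (subst L2_norm_sq_minus_commute) simp
    moreover have "2 / real (Suc k) = 2 * (1 / real (Suc k))" for k by simp
    ultimately show ?thesis using yN[of m] yN[of n] by (smt (verit))
  qed
  have "\<exists>N. \<forall>m\<ge>N. \<forall>n\<ge>N. L2_norm_sq J (\<lambda>t. y m t - y n t) \<le> e" if "e > 0" for e
  proof -
    have "e / 4 > 0" using that by simp
    from reals_Archimedean[OF this] obtain N where N: "inverse (real (Suc N)) < e / 4" by blast
    have half: "2 / real (Suc m) \<le> e / 2" if "m \<ge> N" for m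
    proof -
      have "inverse (real (Suc m)) \<le> inverse (real (Suc N))"
        using that by (intro le_imp_inverse_le) auto
      then show ?thesis using N unfolding divide_inverse[of 2] by linarith
    qed
    have "L2_norm_sq J (\<lambda>t. y m t - y n t) \<le> e" if "m \<ge> N" "n \<ge> N" for m n
      using dist[of m n] half[OF that(1)] half[OF that(2)] by linarith
    then show ?thesis by blast
  qed
  from L2_complete[OF ysq this] obtain z where z: "z \<in> sq_integrable J"
    and yz: "(\<lambda>n. L2_norm_sq J (\<lambda>t. y n t - z t)) \<longlonglongrightarrow> 0" by blast
  have yz': "(\<lambda>n. sqrt (L2_norm_sq J (\<lambda>t. y n t - z t))) \<longlonglongrightarrow> 0"
    using tendsto_real_sqrt[OF yz] by simp
  let ?w = "\<lambda>t. x t - z t"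
  have w: "?w \<in> sq_integrable J" by (rule sq_integrable_diff[OF x z])
  have w_orth: "fun_inner J ?w v = 0" if "v \<in> Y" for v
  proof -
    have v: "v \<in> sq_integrable J" using that Y by blast
    \<comment> \<open>the added \<open>1\<close> covers the case that \<open>v\<close> is zero\<close>
    define t where "t = 1 / (L2_norm_sq J v + 1)"
    have t: "t > 0" "t * L2_norm_sq J v < 1" by (auto simp: t_def add_nonneg_pos divide_less_eq)
    have small: "cmod (fun_inner J (\<lambda>s. x s - y n s) v) \<le> sqrt (1 / t * (1 / real (Suc n)))" for n
    proof (rule real_le_rsqrt)
      define p where "p = fun_inner J (\<lambda>s. x s - y n s) v"
      let ?c = "of_real t * cnj p"
      have "(\<lambda>s. y n s + ?c *\<^sub>C v s) \<in> Y" by (intro add scale y that)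
      then have "d \<le> ?N (\<lambda>s. y n s + ?c *\<^sub>C v s)" by (rule d)
      also have "\<dots> = L2_norm_sq J (\<lambda>s. (x s - y n s) - ?c *\<^sub>C v s)" by (simp add: diff_diff_eq)
      also have "\<dots> = ?N (y n) - 2 * Re (?c * p) + (cmod ?c)\<^sup>2 * L2_norm_sq J v"
        unfolding p_def by (rule L2_norm_sq_diff_scaleC[OF sq_integrable_diff[OF x ysq] v])
      also have "?c * p = of_real (t * (cmod p)\<^sup>2)"
        using complex_norm_square[of p] by (simp add: mult.commute)
      also have "(cmod ?c)\<^sup>2 * L2_norm_sq J v = (t * (cmod p)\<^sup>2) * (t * L2_norm_sq J v)"
        using t by (simp add: norm_mult power2_eq_square)
      finally have "2 * (t * (cmod p)\<^sup>2) \<le> 1 / real (Suc n) + (t * (cmod p)\<^sup>2) * (t * L2_norm_sq J v)"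
        unfolding Re_complex_of_real using yN[of n] by linarith
      also have "(t * (cmod p)\<^sup>2) * (t * L2_norm_sq J v) \<le> (t * (cmod p)\<^sup>2) * 1"
        using t by (intro mult_left_mono) auto
      finally have "t * (cmod p)\<^sup>2 \<le> 1 / real (Suc n)" by simp
      then show "(cmod (fun_inner J (\<lambda>s. x s - y n s) v))\<^sup>2 \<le> 1 / t * (1 / real (Suc n))"
        using mult_left_mono[OF \<open>t * (cmod p)\<^sup>2 \<le> 1 / real (Suc n)\<close>, of "1 / t"] t by (simp add: p_def)
    qed
    have bound: "cmod (fun_inner J ?w v) \<le> sqrt (1 / t * (1 / real (Suc n)))
        + sqrt (L2_norm_sq J (\<lambda>s. y n s - z s)) * sqrt (L2_norm_sq J v)" for n
    proof -
      have "fun_inner J ?w v = fun_inner J (\<lambda>s. x s - y n s) v + fun_inner J (\<lambda>s. y n s - z s) v"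
        using fun_inner_simps(2)[OF x z v] fun_inner_simps(2)[OF x ysq v] fun_inner_simps(2)[OF ysq z v] by simp
      then have "cmod (fun_inner J ?w v) \<le>
          cmod (fun_inner J (\<lambda>s. x s - y n s) v) + cmod (fun_inner J (\<lambda>s. y n s - z s) v)"
        by (simp only: norm_triangle_ineq)
      then show ?thesis
        using small[of n] fun_inner_Cauchy_Schwarz[OF sq_integrable_diff[OF ysq z] v, of n] by linarith
    qed
    have "(\<lambda>n. sqrt (1 / t * (1 / real (Suc n))) + sqrt (L2_norm_sq J (\<lambda>s. y n s - z s)) * sqrt (L2_norm_sq J v))
        \<longlonglongrightarrow> sqrt (1 / t * 0) + 0 * sqrt (L2_norm_sq J v)"
      by (intro tendsto_intros yz' LIMSEQ_Suc[OF lim_1_over_n])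
    from LIMSEQ_le_const[OF this, of "cmod (fun_inner J ?w v)"] bound show ?thesis by simp
  qed
  have wx: "fun_inner J ?w x = 0" by (rule orth[OF w w_orth])
  have wz: "fun_inner J ?w z = 0"
  proof -
    have "cmod (fun_inner J ?w z) \<le> sqrt (L2_norm_sq J ?w) * sqrt (L2_norm_sq J (\<lambda>t. y n t - z t))" for n
    proof -
      have "cmod (fun_inner J ?w z) = cmod (fun_inner J ?w (\<lambda>t. y n t - z t))"
        using fun_inner_simps(4)[OF ysq z w] w_orth[OF y] by simp
      also have "\<dots> \<le> sqrt (L2_norm_sq J ?w) * sqrt (L2_norm_sq J (\<lambda>t. y n t - z t))"
        by (intro fun_inner_Cauchy_Schwarz w sq_integrable_diff ysq z)
      finally show ?thesis .
    qed
    moreover have "(\<lambda>n. sqrt (L2_norm_sq J ?w) * sqrt (L2_norm_sq J (\<lambda>t. y n t - z t)))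
        \<longlonglongrightarrow> sqrt (L2_norm_sq J ?w) * 0"
      by (intro tendsto_intros yz')
    ultimately have "cmod (fun_inner J ?w z) \<le> sqrt (L2_norm_sq J ?w) * 0"
      by (intro LIMSEQ_le_const) auto
    then show ?thesis by simp
  qed
  have "of_real (L2_norm_sq J ?w) = fun_inner J ?w ?w" by (simp only: fun_inner_self)
  also have "\<dots> = 0" using fun_inner_simps(4)[OF x z w] wx wz by simp
  finally have w0: "L2_norm_sq J ?w = 0" by simp
  have "(\<lambda>n. sqrt (L2_norm_sq J (\<lambda>t. y n t - x t))) \<longlonglongrightarrow> 0"
  proof (rule tendsto_sandwich[OF _ _ tendsto_const yz'])
    show "\<forall>\<^sub>F n in sequentially. sqrt (L2_norm_sq J (\<lambda>t. y n t - x t)) \<le> sqrt (L2_norm_sq J (\<lambda>t. y n t - z t))"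
      using L2_norm_triangle_diff[OF ysq z x] w0 L2_norm_sq_minus_commute[of J z x] by simp
  qed simp
  from tendsto_power[OF this, of 2] have "(\<lambda>n. L2_norm_sq J (\<lambda>t. y n t - x t)) \<longlonglongrightarrow> 0" by simp
  with y that show thesis by blast
qed

section \<open>Measurability of operator-valued functions\<close>

lemma borel_measurable_if_balls:
  fixes g :: "'a \<Rightarrow> 'h::{metric_space, second_countable_topology}"
  assumes balls: "\<And>z r. 0 < r \<Longrightarrow> {x \<in> space M. dist z (g x) \<le> r} \<in> sets M"
  shows "g \<in> borel_measurable M"
proof (rule borel_measurableI)
  fix S :: "'h set" assume S: "open S"
  obtain D :: "'h set" where D: "countable D" "\<And>X. open X \<Longrightarrow> X \<noteq> {} \<Longrightarrow> \<exists>d\<in>D. d \<in> X"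
    using countable_dense_exists by blast
  let ?I = "{(d, r). d \<in> D \<and> r \<in> \<rat> \<and> 0 < r \<and> cball d r \<subseteq> S}"
  have "S = (\<Union>(d, r)\<in>?I. cball d r)"
  proof (intro equalityI subsetI)
    fix y assume "y \<in> S"
    then obtain e where e: "e > 0" "ball y e \<subseteq> S" using S openE by blast
    obtain r where r: "r \<in> \<rat>" "0 < r" "r < e / 2" using Rats_dense_in_real[of 0 "e / 2"] e by auto
    obtain d where d: "d \<in> D" "d \<in> ball y r" using D(2)[of "ball y r"] r by auto
    have "cball d r \<subseteq> S"
    proof
      fix z assume "z \<in> cball d r"
      then have "dist y z < e"
        using d(2) r dist_triangle[of y z d] by simp
      then show "z \<in> S" using e by auto
    qed
    moreover have "y \<in> cball d r" using d by (simp add: dist_commute)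
    ultimately show "y \<in> (\<Union>(d, r)\<in>?I. cball d r)" using d r by blast
  qed blast
  then have "g -` S \<inter> space M = (\<Union>(d, r)\<in>?I. {x \<in> space M. dist d (g x) \<le> r})"
    by fastforce
  moreover have "countable ?I"
    by (rule countable_subset[of _ "D \<times> \<rat>"]) (auto simp: D(1) countable_rat)
  then have "(\<Union>(d, r)\<in>?I. {x \<in> space M. dist d (g x) \<le> r}) \<in> sets M"
    by (intro sets.countable_UN'') (auto simp: balls)
  ultimately show "g -` S \<inter> space M \<in> sets M" by simp
qed

text \<open>
  Pettis' theorem in a separable Hilbert space: the norm of \<open>y\<close> is determined by the numbers
  \<open>\<langle>d, y\<rangle>\<close> with \<open>d\<close> in a countable dense set, so the distance of the function to a fixed point is
  measurable, and countably many balls generate every open set.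
\<close>

lemma borel_measurable_if_weakly:
  fixes g :: "'a \<Rightarrow> 'h::{complex_hilbert, second_countable_topology}"
  assumes [measurable]: "\<And>f. (\<lambda>x. cinner f (g x)) \<in> borel_measurable M"
  shows "g \<in> borel_measurable M"
proof (rule borel_measurable_if_balls)
  fix z :: 'h and r :: real
  assume r: "0 < r"
  obtain D :: "'h set" where D: "countable D" "\<And>X. open X \<Longrightarrow> X \<noteq> {} \<Longrightarrow> \<exists>d\<in>D. d \<in> X"
    using countable_dense_exists by blast
  have key: "norm y \<le> r \<longleftrightarrow> (\<forall>d\<in>D. cmod (cinner d y) \<le> norm d * r)" for y :: 'h
  proof
    assume "norm y \<le> r"
    then show "\<forall>d\<in>D. cmod (cinner d y) \<le> norm d * r"
      by (meson Cauchy_Schwarz_cinner mult_left_mono norm_ge_zero order_trans)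
  next
    assume *: "\<forall>d\<in>D. cmod (cinner d y) \<le> norm d * r"
    \<comment> \<open>an open set that would contain a point of the dense set if it were not empty\<close>
    let ?U = "{u. norm u * r < cmod (cinner u y)}"
    have "continuous_on UNIV (\<lambda>u. cinner u y)"
      by (intro bounded_bilinear.continuous_on[OF bounded_bilinear_cinner] continuous_intros)
    then have "open ?U" by (intro open_Collect_less continuous_intros)
    then have "?U = {}" using D(2)[of ?U] * by force
    then have "cmod (cinner y y) \<le> norm y * r" by (auto simp: not_less)
    then have le: "norm y * norm y \<le> norm y * r"
      by (simp add: cinner_self power2_eq_square norm_mult)
    show "norm y \<le> r"
      using le r by (cases "y = 0") auto
  qed
  have "{x \<in> space M. dist z (g x) \<le> r} =
      {x \<in> space M. \<forall>d\<in>D. cmod (cinner d z - cinner d (g x)) \<le> norm d * r}"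
    by (simp add: dist_norm key cinner_diff_right)
  also have "\<dots> \<in> sets M"
    using D(1) by measurable
  finally show "{x \<in> space M. dist z (g x) \<le> r} \<in> sets M" .
qed

text \<open>
  The space of bounded operators is not separable in general, so the operator-valued function
  itself need not be Borel measurable.  Pointwise measurability is nevertheless enough to
  apply it to a measurable function, because the latter is a limit of simple functions.
\<close>

lemma borel_measurable_blinfun_apply_pointwise:
  fixes T :: "'a \<Rightarrow> ('b::{real_normed_vector, second_countable_topology} \<Rightarrow>\<^sub>L 'c::{real_normed_vector})"
  assumes T: "\<And>h. (\<lambda>x. blinfun_apply (T x) h) \<in> borel_measurable M"
    and g: "g \<in> borel_measurable M"
  shows "(\<lambda>x. blinfun_apply (T x) (g x)) \<in> borel_measurable M"
proof -
  obtain s where s: "\<And>i. simple_function M (s i)"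
    and lim: "\<And>x. x \<in> space M \<Longrightarrow> (\<lambda>i. s i x) \<longlonglongrightarrow> g x"
    using borel_measurable_implies_sequence_metric[OF g] by blast
  have fin: "finite (s i ` space M)" for i using s by (simp add: simple_function_def)
  have "(\<lambda>x. blinfun_apply (T x) (s i x)) \<in> borel_measurable M" for i
  proof (rule measurable_compose_countable'[OF T _ countable_finite[OF fin]])
    show "s i \<in> measurable M (count_space (s i ` space M))"
      using s[of i] by (subst measurable_count_space_eq2[OF fin]) (auto simp: simple_function_def)
  qed
  then show ?thesis
    by (rule borel_measurable_LIMSEQ_metric)
      (rule bounded_bilinear.tendsto[OF bounded_bilinear_blinfun_apply tendsto_const lim])
qed

section \<open>Integral kernels\<close>

lemma finite_measure_lebesgue_on_Icc: "finite_measure (lebesgue_on {c..d::real})"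
  by (rule finite_measureI) (simp add: space_restrict_space emeasure_restrict_space emeasure_lborel_Icc_eq)

lemma sigma_finite_measure_lebesgue_on_Icc: "sigma_finite_measure (lebesgue_on {c..d::real})"
  using finite_measure_lebesgue_on_Icc finite_measure.axioms(1) by blast

lemma borel_measurable_bilinear:
  fixes u :: "'a \<Rightarrow> 'b::{real_normed_vector, second_countable_topology}"
    and v :: "'a \<Rightarrow> 'c::{real_normed_vector, second_countable_topology}"
    and B :: "'b \<Rightarrow> 'c \<Rightarrow> 'd::real_normed_vector"
  assumes B: "bounded_bilinear B" and "u \<in> borel_measurable M" "v \<in> borel_measurable M"
  shows "(\<lambda>x. B (u x) (v x)) \<in> borel_measurable M"
  using assms(2,3)
  by (rule borel_measurable_continuous_Pair)
    (intro bounded_bilinear.continuous_on[OF B] continuous_intros)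

lemma integrable_bilinear_bounded:
  fixes u :: "'a \<Rightarrow> 'b::{real_normed_vector, second_countable_topology}"
    and v :: "'a \<Rightarrow> 'c::{banach, second_countable_topology}"
    and B :: "'b \<Rightarrow> 'c \<Rightarrow> 'd::{banach, second_countable_topology}"
  assumes B: "bounded_bilinear B" and u: "u \<in> borel_measurable M"
    and C: "\<And>x. x \<in> space M \<Longrightarrow> norm (u x) \<le> C" and v: "integrable M v"
  shows "integrable M (\<lambda>x. B (u x) (v x))"
proof -
  obtain K where K: "K > 0" "\<And>a b. norm (B a b) \<le> norm a * norm b * K"
    using bounded_bilinear.pos_bounded[OF B] by blast
  show ?thesis
  proof (rule Bochner_Integration.integrable_bound)
    show "integrable M (\<lambda>x. C * K * norm (v x))" using v by simp
    show "(\<lambda>x. B (u x) (v x)) \<in> borel_measurable M"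
      using v by (intro borel_measurable_bilinear[OF B u]) auto
    show "AE x in M. norm (B (u x) (v x)) \<le> norm (C * K * norm (v x))"
    proof (rule AE_I2)
      fix x assume "x \<in> space M"
      then have "norm (u x) * norm (v x) * K \<le> C * norm (v x) * K"
        using C K by (intro mult_right_mono) auto
      then show "norm (B (u x) (v x)) \<le> norm (C * K * norm (v x))"
        using K(2)[of "u x" "v x"] by (simp add: mult_ac)
    qed
  qed
qed

lemma continuous_on_kernel_integral:
  fixes q :: "'a \<Rightarrow> 'b::{banach, second_countable_topology}" and \<kappa> :: "real \<Rightarrow> 'a \<Rightarrow> real"
  assumes q: "integrable M q"
    and meas: "\<And>x. x \<in> S \<Longrightarrow> \<kappa> x \<in> borel_measurable M"
    and bound: "\<And>x t. x \<in> S \<Longrightarrow> t \<in> space M \<Longrightarrow> \<bar>\<kappa> x t\<bar> \<le> C"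
    and cont: "\<And>x X. x \<in> S \<Longrightarrow> (\<And>n. X n \<in> S) \<Longrightarrow> X \<longlonglongrightarrow> x \<Longrightarrow>
      AE t in M. (\<lambda>n. \<kappa> (X n) t) \<longlonglongrightarrow> \<kappa> x t"
  shows "continuous_on S (\<lambda>x. LINT t|M. \<kappa> x t *\<^sub>R q t)"
  unfolding continuous_on_sequentially comp_def
proof (intro ballI allI impI)
  fix X x assume x: "x \<in> S" and X: "(\<forall>n. X n \<in> S) \<and> X \<longlonglongrightarrow> x"
  have [measurable]: "q \<in> borel_measurable M" using q by simp
  have [measurable]: "\<kappa> y \<in> borel_measurable M" if "y \<in> S" for y using meas that .
  show "(\<lambda>n. LINT t|M. \<kappa> (X n) t *\<^sub>R q t) \<longlonglongrightarrow> (LINT t|M. \<kappa> x t *\<^sub>R q t)"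
  proof (rule integral_dominated_convergence)
    show "integrable M (\<lambda>t. C * norm (q t))" using q by simp
    show "AE t in M. (\<lambda>n. \<kappa> (X n) t *\<^sub>R q t) \<longlonglongrightarrow> \<kappa> x t *\<^sub>R q t"
    proof -
      have "AE t in M. (\<lambda>n. \<kappa> (X n) t) \<longlonglongrightarrow> \<kappa> x t" using cont[OF x, of X] X by blast
      then show ?thesis by eventually_elim (rule tendsto_scaleR[OF _ tendsto_const])
    qed
    show "AE t in M. norm (\<kappa> (X n) t *\<^sub>R q t) \<le> C * norm (q t)" for n
      using bound X by (intro AE_I2) (auto intro!: mult_right_mono)
  qed (use x X meas in \<open>auto intro!: borel_measurable_scaleR\<close>)
qed

text \<open>
  Transposition of an integral operator with a bounded scalar kernel.  It serves two purposes:
  with the kernel \<open>1\<^bsub>s \<le> t\<^esub>\<close> it is integration by parts, and with the kernel of the test functions it is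
  the duality between the two fixed point equations.
\<close>

lemma kernel_Fubini:
  fixes p :: "'a \<Rightarrow> 'b::{banach, second_countable_topology}"
    and q :: "'a \<Rightarrow> 'c::{banach, second_countable_topology}"
    and B :: "'b \<Rightarrow> 'c \<Rightarrow> 'd::{banach, second_countable_topology}"
    and \<kappa> :: "'a \<Rightarrow> 'a \<Rightarrow> real"
  assumes M: "sigma_finite_measure M" and B: "bounded_bilinear B"
    and p: "integrable M p" and q: "integrable M q"
    and \<kappa>[measurable]: "case_prod \<kappa> \<in> borel_measurable (M \<Otimes>\<^sub>M M)"
    and bound: "\<And>s t. s \<in> space M \<Longrightarrow> t \<in> space M \<Longrightarrow> \<bar>\<kappa> s t\<bar> \<le> C"
  shows "(LINT t|M. B (LINT s|M. \<kappa> s t *\<^sub>R p s) (q t)) = (LINT s|M. B (p s) (LINT t|M. \<kappa> s t *\<^sub>R q t))"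
proof -
  interpret sigma_finite_measure M by fact
  interpret P: pair_sigma_finite M M ..
  interpret B: bounded_bilinear B by fact
  obtain K where K: "K > 0" "\<And>a b. norm (B a b) \<le> norm a * norm b * K"
    using B.pos_bounded by blast
  have [measurable]: "p \<in> borel_measurable M" "q \<in> borel_measurable M" using p q by auto
  have \<kappa>p: "integrable M (\<lambda>s. \<kappa> s t *\<^sub>R p s)" if "t \<in> space M" for t
    using that by (intro integrable_bilinear_bounded[OF bounded_bilinear_scaleR, where C = C])
      (auto simp: bound p)
  have \<kappa>q: "integrable M (\<lambda>t. \<kappa> s t *\<^sub>R q t)" if "s \<in> space M" for s
    using that by (intro integrable_bilinear_bounded[OF bounded_bilinear_scaleR, where C = C])
      (auto simp: bound q)
  let ?h = "\<lambda>s t. \<kappa> s t *\<^sub>R B (p s) (q t)"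
  have [measurable]: "(\<lambda>x. B (p (fst x)) (q (snd x))) \<in> borel_measurable (M \<Otimes>\<^sub>M M)"
    by (intro borel_measurable_bilinear[OF B]) measurable
  have meas: "case_prod ?h \<in> borel_measurable (M \<Otimes>\<^sub>M M)"
    unfolding case_prod_beta by measurable
  have Bs: "integrable M (\<lambda>t. B (p s) (q t))" for s
    using q by (rule integrable_bounded_linear[OF B.bounded_linear_right])
  have h2: "integrable M (?h s)" if "s \<in> space M" for s
    using that by (intro integrable_bilinear_bounded[OF bounded_bilinear_scaleR, where C = C])
      (auto simp: bound Bs)
  have int: "integrable (M \<Otimes>\<^sub>M M) (case_prod ?h)"
  proof (rule P.Fubini_integrable[OF meas])
    show "integrable M (\<lambda>s. LINT t|M. norm (case (s, t) of (s, t) \<Rightarrow> ?h s t))"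
    proof (rule Bochner_Integration.integrable_bound)
      show "integrable M (\<lambda>s. norm (p s) * (C * K * (LINT t|M. norm (q t))))" using p by simp
      show "(\<lambda>s. LINT t|M. norm (case (s, t) of (s, t) \<Rightarrow> ?h s t)) \<in> borel_measurable M"
        using meas by (intro borel_measurable_lebesgue_integral) (simp add: case_prod_beta)
      show "AE s in M. norm (LINT t|M. norm (case (s, t) of (s, t) \<Rightarrow> ?h s t))
          \<le> norm (norm (p s) * (C * K * (LINT t|M. norm (q t))))"
      proof (rule AE_I2)
        fix s assume s: "s \<in> space M"
        have "(LINT t|M. norm (?h s t)) \<le> (LINT t|M. (norm (p s) * (C * K)) * norm (q t))"
        proof (rule integral_mono)
          fix t assume t: "t \<in> space M"
          have "norm (?h s t) \<le> C * (norm (p s) * norm (q t) * K)"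
            using bound[OF s t] K by (auto intro!: mult_mono)
          then show "norm (?h s t) \<le> (norm (p s) * (C * K)) * norm (q t)" by (simp add: mult_ac)
        qed (use q integrable_norm[OF h2[OF s]] in auto)
        then show "norm (LINT t|M. norm (case (s, t) of (s, t) \<Rightarrow> ?h s t))
            \<le> norm (norm (p s) * (C * K * (LINT t|M. norm (q t))))"
          by (simp add: mult_ac)
      qed
    qed
    show "AE s in M. integrable M (\<lambda>t. case (s, t) of (s, t) \<Rightarrow> ?h s t)"
      using h2 by (intro AE_I2) simp
  qed
  have "(LINT t|M. B (LINT s|M. \<kappa> s t *\<^sub>R p s) (q t)) = (LINT t|M. LINT s|M. ?h s t)"
  proof (rule Bochner_Integration.integral_cong[OF refl])
    fix t assume "t \<in> space M"
    then have "B (LINT s|M. \<kappa> s t *\<^sub>R p s) (q t) = (LINT s|M. B (\<kappa> s t *\<^sub>R p s) (q t))"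
      by (intro integral_bounded_linear[OF B.bounded_linear_left, symmetric] \<kappa>p)
    then show "B (LINT s|M. \<kappa> s t *\<^sub>R p s) (q t) = (LINT s|M. ?h s t)"
      by (simp add: B.scaleR_left)
  qed
  also have "\<dots> = (LINT s|M. LINT t|M. ?h s t)" by (rule P.Fubini_integral[OF int])
  also have "\<dots> = (LINT s|M. B (p s) (LINT t|M. \<kappa> s t *\<^sub>R q t))"
  proof (rule Bochner_Integration.integral_cong[OF refl])
    fix s assume "s \<in> space M"
    then have "B (p s) (LINT t|M. \<kappa> s t *\<^sub>R q t) = (LINT t|M. B (p s) (\<kappa> s t *\<^sub>R q t))"
      by (intro integral_bounded_linear[OF B.bounded_linear_right, symmetric] \<kappa>q)
    then show "(LINT t|M. ?h s t) = B (p s) (LINT t|M. \<kappa> s t *\<^sub>R q t)"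
      by (simp add: B.scaleR_right)
  qed
  finally show ?thesis .
qed

section \<open>Antiderivatives and integration by parts\<close>

text \<open>
  The antiderivative of \<open>p\<close> starting at \<open>c\<close>.  Cutting off inside an integral over the
  fixed interval \<open>{c..d}\<close> avoids the case distinctions of oriented integrals, and makes
  antiderivatives a case of integral operators with a bounded kernel.
\<close>

definition antideriv :: "real \<Rightarrow> real \<Rightarrow> (real \<Rightarrow> 'b::{banach, second_countable_topology}) \<Rightarrow> real \<Rightarrow> 'b"
  where "antideriv c d p x = (LINT t|lebesgue_on {c..d}. indicator {..x} t *\<^sub>R p t)"

lemma integral_lebesgue_on_Icc_cong:
  fixes f :: "real \<Rightarrow> 'b::{banach, second_countable_topology}"
  assumes "\<And>t. t \<in> {c..d} \<Longrightarrow> t \<noteq> x \<Longrightarrow> f t = g t"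
  shows "integral\<^sup>L (lebesgue_on {c..d}) f = integral\<^sup>L (lebesgue_on {c..d}) g"
proof -
  have "integral\<^sup>L lebesgue (\<lambda>t. indicator {c..d} t *\<^sub>R f t) = integral\<^sup>L lebesgue (\<lambda>t. indicator {c..d} t *\<^sub>R g t)"
    by (rule integral_discrete_difference[where X = "{x}"])
      (use assms in \<open>auto simp: indicator_def\<close>)
  then show ?thesis by (simp add: integral_restrict_space)
qed

lemma integrable_indicator_scaleR_Icc:
  fixes p :: "real \<Rightarrow> 'b::{banach, second_countable_topology}"
  assumes p: "integrable (lebesgue_on {c..d}) p" and A: "A \<in> sets borel"
  shows "integrable (lebesgue_on {c..d}) (\<lambda>t. indicator A t *\<^sub>R p t)"
proof (rule integrable_bilinear_bounded[OF bounded_bilinear_scaleR _ _ p, where C = 1])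
  have "(\<lambda>t::real. indicator A t :: real) \<in> borel_measurable lebesgue"
    using A by (intro borel_measurable_indicator sets_completionI_sets) simp
  then show "(\<lambda>t. indicator A t :: real) \<in> borel_measurable (lebesgue_on {c..d})"
    by (rule measurable_restrict_space1)
qed (simp add: indicator_def)

lemma interval_integral_eq_antideriv:
  fixes p :: "real \<Rightarrow> 'b::{banach, second_countable_topology}"
  assumes p: "integrable (lebesgue_on {c..d}) p" and x: "x1 \<in> {c..d}" "x2 \<in> {c..d}"
  shows "(LINT t=ereal x1..ereal x2|lebesgue. p t) = antideriv c d p x2 - antideriv c d p x1"
proof -
  have *: "(LINT t=ereal x1..ereal x2|lebesgue. p t) = antideriv c d p x2 - antideriv c d p x1"
    if le: "x1 \<le> x2" and x: "x1 \<in> {c..d}" "x2 \<in> {c..d}" for x1 x2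
  proof -
    have "antideriv c d p x2 - antideriv c d p x1 =
        (LINT t|lebesgue_on {c..d}. indicator {..x2} t *\<^sub>R p t - indicator {..x1} t *\<^sub>R p t)"
      unfolding antideriv_def
      by (intro Bochner_Integration.integral_diff[symmetric] integrable_indicator_scaleR_Icc p) auto
    also have "\<dots> = (LINT t|lebesgue. indicator {c..d} t *\<^sub>R (indicator {..x2} t *\<^sub>R p t - indicator {..x1} t *\<^sub>R p t))"
      by (simp add: integral_restrict_space)
    also have "\<dots> = (LINT t|lebesgue. indicator {x1<..<x2} t *\<^sub>R p t)"
      by (rule integral_discrete_difference[where X = "{x2}"])
        (use le x in \<open>auto simp: indicator_def\<close>)
    finally show ?thesis
      using le by (simp add: interval_lebesgue_integral_def set_lebesgue_integral_def)
  qed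
  show ?thesis
  proof (cases "x1 \<le> x2")
    case True then show ?thesis using * x by blast
  next
    case False
    then have "(LINT t=ereal x1..ereal x2|lebesgue. p t) = - (LINT t=ereal x2..ereal x1|lebesgue. p t)"
      by (simp add: interval_lebesgue_integral_def)
    then show ?thesis using *[of x2 x1] x False by simp
  qed
qed

lemma antideriv_left [simp]: "antideriv c d p c = 0"
proof -
  have "antideriv c d p c = (LINT t|lebesgue_on {c..d}. 0)"
    unfolding antideriv_def by (rule integral_lebesgue_on_Icc_cong[where x = c]) (auto simp: indicator_def)
  then show ?thesis by simp
qed

lemma antideriv_right: "antideriv c d p d = integral\<^sup>L (lebesgue_on {c..d}) p"
  unfolding antideriv_def by (rule integral_lebesgue_on_Icc_cong[where x = c]) (auto simp: indicator_def)

lemma AE_lebesgue_onI: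
  assumes "AE t in lebesgue. P t" and S: "S \<in> sets lebesgue"
  shows "AE t in lebesgue_on S. P t"
proof -
  have "AE t in lebesgue. t \<in> S \<longrightarrow> P t" using assms(1) by eventually_elim simp
  then show ?thesis using S by (simp add: AE_restrict_space_iff)
qed

lemma AE_lebesgue_on_Icc_neq: "AE t in lebesgue_on {c..d}. t \<noteq> (x::real)"
proof -
  have "AE t in lebesgue. t \<noteq> x" by (rule AE_I'[of "{x}"]) (auto simp: null_sets_def)
  then show ?thesis by (rule AE_lebesgue_onI) simp
qed

lemma continuous_on_antideriv:
  fixes p :: "real \<Rightarrow> 'b::{banach, second_countable_topology}"
  assumes p: "integrable (lebesgue_on {c..d}) p"
  shows "continuous_on UNIV (antideriv c d p)"
  unfolding antideriv_def
proof (rule continuous_on_kernel_integral[OF p, where C = 1])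
  show "(\<lambda>t. indicator {..x} t :: real) \<in> borel_measurable (lebesgue_on {c..d})" for x
    by (intro measurable_restrict_space1 borel_measurable_indicator sets_completionI_sets) simp
  show "AE t in lebesgue_on {c..d}. (\<lambda>n. indicator {..X n} t :: real) \<longlonglongrightarrow> indicator {..x} t"
    if "X \<longlonglongrightarrow> x" for x X
    using AE_lebesgue_on_Icc_neq[where c = c and d = d and x = x]
  proof eventually_elim
    case (elim t)
    have "\<forall>\<^sub>F n in sequentially. (indicator {..X n} t :: real) = indicator {..x} t"
    proof (cases "t < x")
      case True
      from order_tendstoD(1)[OF that this] show ?thesis
        by eventually_elim (use True in \<open>simp add: indicator_def\<close>)
    next
      case False
      then have "x < t" using elim by simp
      from order_tendstoD(2)[OF that this] show ?thesis
        by eventually_elim (use \<open>x < t\<close> in \<open>simp add: indicator_def\<close>)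
    qed
    then show ?case by (rule tendsto_eventually)
  qed
qed (auto simp: indicator_def)

lemma antideriv_AE_cong:
  assumes "AE t in lebesgue_on {c..d}. p t = q t" "integrable (lebesgue_on {c..d}) p" "integrable (lebesgue_on {c..d}) q"
  shows "antideriv c d p x = antideriv c d q x"
  unfolding antideriv_def
proof (rule integral_cong_AE)
  show "AE t in lebesgue_on {c..d}. indicator {..x} t *\<^sub>R p t = indicator {..x} t *\<^sub>R q t"
    using assms(1) by eventually_elim simp
qed (use integrable_indicator_scaleR_Icc[OF assms(2)] integrable_indicator_scaleR_Icc[OF assms(3)]
  in \<open>auto intro: borel_measurable_integrable\<close>)

lemma measurable_id_lebesgue_on: "(\<lambda>x. x) \<in> borel_measurable (lebesgue_on S)"
  using id_borel_measurable_lebesgue_on[of S] by (simp add: id_def)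

lemma measurable_le_kernel:
  "(\<lambda>(s, t). indicator {..t} s :: real) \<in> borel_measurable (lebesgue_on A \<Otimes>\<^sub>M lebesgue_on (A :: real set))"
proof -
  let ?N = "lebesgue_on A \<Otimes>\<^sub>M lebesgue_on A"
  have "fst \<in> borel_measurable ?N" "snd \<in> borel_measurable ?N"
    using measurable_compose[OF measurable_fst measurable_id_lebesgue_on]
      measurable_compose[OF measurable_snd measurable_id_lebesgue_on] by auto
  then have "{x \<in> space ?N. fst x \<le> snd x} \<in> sets ?N" by (rule borel_measurable_le)
  then have "{x. fst x \<le> snd x} \<inter> space ?N \<in> sets ?N" by (simp add: Int_def conj_commute)
  then have "(indicator {x. fst x \<le> snd x} :: _ \<Rightarrow> real) \<in> borel_measurable ?N"
    by (simp add: borel_measurable_indicator_iff)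
  moreover have "(\<lambda>(s, t::real). indicator {..t} s :: real) = indicator {x. fst x \<le> snd x}"
    by (auto simp: indicator_def)
  ultimately show ?thesis by (simp only:)
qed

text \<open>
  The integrands of the two antiderivatives run over the two halves of the square
  \<open>{c..d} \<times> {c..d}\<close>, so the sum is a product of integrals after the order of
  integration is exchanged in one of them.
\<close>

lemma integration_by_parts_antideriv:
  fixes p P :: "real \<Rightarrow> 'b::{banach, second_countable_topology}"
    and q Q :: "real \<Rightarrow> 'c::{banach, second_countable_topology}"
    and B :: "'b \<Rightarrow> 'c \<Rightarrow> 'd::{banach, second_countable_topology}"
  assumes B: "bounded_bilinear B"
    and p: "integrable (lebesgue_on {c..d}) p" and q: "integrable (lebesgue_on {c..d}) q"
    and P: "\<And>x. x \<in> {c..d} \<Longrightarrow> P x = P c + antideriv c d p x"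
    and Q: "\<And>x. x \<in> {c..d} \<Longrightarrow> Q x = Q c + antideriv c d q x"
    and cd: "c \<le> d"
  shows "integrable (lebesgue_on {c..d}) (\<lambda>t. B (P t) (q t))"
    and "integrable (lebesgue_on {c..d}) (\<lambda>t. B (p t) (Q t))"
    and "(LINT t|lebesgue_on {c..d}. B (P t) (q t)) + (LINT t|lebesgue_on {c..d}. B (p t) (Q t)) =
      B (P d) (Q d) - B (P c) (Q c)"
proof -
  let ?M = "lebesgue_on {c..d}"
  interpret B: bounded_bilinear B by fact
  have sp: "space ?M = {c..d}" by simp
  have contP: "continuous_on {c..d} P" if "integrable ?M p" "\<And>x. x \<in> {c..d} \<Longrightarrow> P x = P c + antideriv c d p x"
    for p P :: "real \<Rightarrow> 'e::{banach, second_countable_topology}"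
    using continuous_on_antideriv[OF that(1)]
    by (subst continuous_on_cong[OF refl that(2)]) (auto intro!: continuous_intros intro: continuous_on_subset)
  have bm: "f \<in> borel_measurable ?M \<and> (\<exists>C. \<forall>x\<in>{c..d}. norm (f x) \<le> C)"
    if "continuous_on {c..d} f" for f :: "real \<Rightarrow> 'e::{banach, second_countable_topology}"
  proof
    show "f \<in> borel_measurable ?M"
      using that by (rule continuous_imp_measurable_on_sets_lebesgue) simp
    show "\<exists>C. \<forall>x\<in>{c..d}. norm (f x) \<le> C"
      using compact_imp_bounded[OF compact_continuous_image[OF that compact_Icc]]
      by (auto simp: bounded_iff)
  qed
  have bmP: "integrable ?M (\<lambda>t. B (P t) (q t))" if "continuous_on {c..d} P" for P
  proof -
    from bm[OF that] obtain C where "P \<in> borel_measurable ?M" "\<forall>x\<in>{c..d}. norm (P x) \<le> C" by blast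
    then show ?thesis by (intro integrable_bilinear_bounded[OF B _ _ q, where C = C]) auto
  qed
  have bmQ: "integrable ?M (\<lambda>t. B (p t) (Q t))" if "continuous_on {c..d} Q" for Q
  proof -
    from bm[OF that] obtain C where "Q \<in> borel_measurable ?M" "\<forall>x\<in>{c..d}. norm (Q x) \<le> C" by blast
    then show ?thesis by (intro integrable_bilinear_bounded[OF B.flip _ _ p, where C = C]) auto
  qed
  show intP: "integrable ?M (\<lambda>t. B (P t) (q t))" by (rule bmP[OF contP[OF p P]])
  show intQ: "integrable ?M (\<lambda>t. B (p t) (Q t))" by (rule bmQ[OF contP[OF q Q]])
  define \<kappa> :: "real \<Rightarrow> real \<Rightarrow> real" where "\<kappa> s t = indicator {..t} s" for s t
  have \<kappa>: "case_prod \<kappa> \<in> borel_measurable (?M \<Otimes>\<^sub>M ?M)"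
    unfolding \<kappa>_def by (rule measurable_le_kernel)
  have pP: "(LINT s|?M. \<kappa> s t *\<^sub>R p s) = P t - P c" if "t \<in> {c..d}" for t
    using P[OF that] by (simp add: antideriv_def \<kappa>_def)
  have qQ: "(LINT t|?M. \<kappa> s t *\<^sub>R q t) = Q d - Q s" if s: "s \<in> {c..d}" for s
  proof -
    have "Q d - Q s = (LINT t|?M. q t) - (LINT t|?M. indicator {..s} t *\<^sub>R q t)"
      using Q[OF s] Q[of d] cd antideriv_right[of c d q] by (simp add: antideriv_def)
    also have "\<dots> = (LINT t|?M. q t - indicator {..s} t *\<^sub>R q t)"
      by (intro Bochner_Integration.integral_diff[symmetric] q integrable_indicator_scaleR_Icc) auto
    also have "\<dots> = (LINT t|?M. \<kappa> s t *\<^sub>R q t)"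
      by (rule integral_lebesgue_on_Icc_cong[where x = s]) (auto simp: \<kappa>_def indicator_def)
    finally show ?thesis by simp
  qed
  have "(LINT t|?M. B (LINT s|?M. \<kappa> s t *\<^sub>R p s) (q t)) = (LINT s|?M. B (p s) (LINT t|?M. \<kappa> s t *\<^sub>R q t))"
    by (rule kernel_Fubini[OF sigma_finite_measure_lebesgue_on_Icc B p q \<kappa>, where C = 1])
      (simp add: \<kappa>_def indicator_def)
  moreover have "(LINT t|?M. B (LINT s|?M. \<kappa> s t *\<^sub>R p s) (q t)) = (LINT t|?M. B (P t) (q t) - B (P c) (q t))"
    by (rule Bochner_Integration.integral_cong[OF refl]) (simp add: pP B.diff_left)
  moreover have "(LINT s|?M. B (p s) (LINT t|?M. \<kappa> s t *\<^sub>R q t)) = (LINT s|?M. B (p s) (Q d) - B (p s) (Q s))"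
    by (rule Bochner_Integration.integral_cong[OF refl]) (simp add: qQ B.diff_right)
  moreover have "(LINT t|?M. B (P t) (q t) - B (P c) (q t)) = (LINT t|?M. B (P t) (q t)) - B (P c) (Q d - Q c)"
    using Q[of d] cd antideriv_right[of c d q]
    by (subst Bochner_Integration.integral_diff[OF intP bmP])
      (auto simp: integral_bounded_linear[OF B.bounded_linear_right q])
  moreover have "(LINT s|?M. B (p s) (Q d) - B (p s) (Q s)) = B (P d - P c) (Q d) - (LINT s|?M. B (p s) (Q s))"
    using P[of d] cd antideriv_right[of c d p]
    by (subst Bochner_Integration.integral_diff[OF bmQ intQ])
      (auto simp: integral_bounded_linear[OF B.bounded_linear_left p])
  ultimately have "(LINT t|?M. B (P t) (q t)) - B (P c) (Q d - Q c) = B (P d - P c) (Q d) - (LINT s|?M. B (p s) (Q s))"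
    by simp
  then show "(LINT t|?M. B (P t) (q t)) + (LINT t|?M. B (p t) (Q t)) = B (P d) (Q d) - B (P c) (Q c)"
    by (simp add: B.diff_left B.diff_right algebra_simps)
qed

text \<open>
  The sets over which the integral of \<open>p\<close> vanishes contain all half-lines and form a Dynkin
  system, hence contain all Borel sets; Lebesgue measurable sets differ from these by null sets only.
\<close>

lemma antideriv_zero_imp_AE_zero:
  fixes p :: "real \<Rightarrow> 'b::{banach, second_countable_topology}"
  assumes p: "integrable (lebesgue_on {c..d}) p"
    and zero: "\<And>x. x \<in> {c..d} \<Longrightarrow> antideriv c d p x = 0" and cd: "c \<le> d"
  shows "AE t in lebesgue_on {c..d}. p t = 0"
proof (rule sigma_finite_measure.density_zero[OF sigma_finite_measure_lebesgue_on_Icc p])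
  let ?M = "lebesgue_on {c..d}"
  have tot: "integral\<^sup>L ?M p = 0" using zero[of d] cd by (simp add: antideriv_right)
  have atMost: "(LINT t|?M. indicator {..x} t *\<^sub>R p t) = 0" for x
  proof -
    consider "x < c" | "x \<in> {c..d}" | "x > d" by fastforce
    then show ?thesis
    proof cases
      case 1
      then have "(LINT t|?M. indicator {..x} t *\<^sub>R p t) = (LINT t|?M. 0)"
        by (intro Bochner_Integration.integral_cong) auto
      then show ?thesis by simp
    next
      case 2 then show ?thesis using zero by (simp add: antideriv_def)
    next
      case 3
      then have "(LINT t|?M. indicator {..x} t *\<^sub>R p t) = integral\<^sup>L ?M p"
        by (intro Bochner_Integration.integral_cong) auto
      then show ?thesis using tot by simp
    qed
  qed
  have borel: "(LINT t|?M. indicator A t *\<^sub>R p t) = 0" if "A \<in> sets borel" for A :: "real set"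
  proof -
    let ?G = "range (\<lambda>a::real. {..a})"
    have "A \<in> sigma_sets UNIV ?G" using that by (simp add: borel_eq_atMost)
    have "Int_stable ?G" by (auto simp: Int_stable_def)
    moreover have "?G \<subseteq> Pow UNIV" by simp
    ultimately show ?thesis using \<open>A \<in> sigma_sets UNIV ?G\<close>
    proof (induction rule: sigma_sets_induct_disjoint)
      case (union A)
      have [measurable]: "A i \<in> sets borel" for i
        using union(2) by (auto simp: borel_eq_atMost)
      have sums: "(\<lambda>n. \<Sum>i<n. (indicator (A i) t :: real)) \<longlonglongrightarrow> indicator (\<Union>i. A i) t" for t
        using indicator_sums[of A t] union(1) by (auto simp: sums_def disjoint_family_on_def)
      have "(\<lambda>n. LINT t|?M. (\<Sum>i<n. indicator (A i) t) *\<^sub>R p t) \<longlonglongrightarrow> (LINT t|?M. indicator (\<Union>i. A i) t *\<^sub>R p t)"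
      proof (rule integral_dominated_convergence)
        show "integrable ?M (\<lambda>t. norm (p t))" using p by simp
        show "(\<lambda>t. indicator (\<Union>i. A i) t *\<^sub>R p t) \<in> borel_measurable ?M"
          by (intro borel_measurable_integrable integrable_indicator_scaleR_Icc p) measurable
        show "(\<lambda>t. (\<Sum>i<n. indicator (A i) t) *\<^sub>R p t) \<in> borel_measurable ?M" for n
          unfolding scaleR_sum_left
          by (intro borel_measurable_sum borel_measurable_integrable integrable_indicator_scaleR_Icc p) measurable
        show "AE t in ?M. (\<lambda>n. (\<Sum>i<n. indicator (A i) t) *\<^sub>R p t) \<longlonglongrightarrow> indicator (\<Union>i. A i) t *\<^sub>R p t"
          by (intro AE_I2 tendsto_intros sums)
        show "AE t in ?M. norm ((\<Sum>i<n. indicator (A i) t) *\<^sub>R p t) \<le> norm (p t)" for n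
        proof (rule AE_I2)
          fix t
          have "(\<Sum>i<n. (indicator (A i) t :: real)) = indicator (\<Union>i<n. A i) t"
            by (rule indicator_UN_disjoint[symmetric])
              (use union(1) in \<open>auto simp: disjoint_family_on_def\<close>)
          then show "norm ((\<Sum>i<n. indicator (A i) t) *\<^sub>R p t) \<le> norm (p t)"
            by (simp add: indicator_def)
        qed
      qed
      moreover have "(LINT t|?M. (\<Sum>i<n. indicator (A i) t) *\<^sub>R p t) = 0" for n
        unfolding scaleR_sum_left
        using union(3) by (subst Bochner_Integration.integral_sum) (auto intro!: integrable_indicator_scaleR_Icc p)
      ultimately show ?case by (simp add: LIMSEQ_const_iff)
    next
      case (compl A)
      have [measurable]: "A \<in> sets borel" using compl(1) by (simp add: borel_eq_atMost)
      have "(LINT t|?M. indicator (UNIV - A) t *\<^sub>R p t) = (LINT t|?M. p t - indicator A t *\<^sub>R p t)"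
        by (intro Bochner_Integration.integral_cong) (auto simp: indicator_def)
      also have "\<dots> = 0"
        using compl tot by (subst Bochner_Integration.integral_diff) (auto intro!: integrable_indicator_scaleR_Icc p)
      finally show ?case .
    next
      case (basic A)
      then show ?case using atMost by auto
    next
      case empty show ?case by simp
    qed
  qed
  fix A assume "A \<in> sets ?M"
  then have A: "A \<in> sets lebesgue" "A \<subseteq> {c..d}" by (auto simp: sets_restrict_space)
  from A(1) obtain S N N' where S: "A = S \<union> N" "N \<subseteq> N'" "N' \<in> null_sets lborel" "S \<in> sets lborel"
    by (rule sets_completionE)
  have N': "N' \<in> null_sets lebesgue" using S(3) by (rule null_sets_completionI)
  have "AE t in lebesgue. t \<notin> N'" using N' by (rule AE_not_in)
  then have "AE t in ?M. t \<notin> N'" by (rule AE_lebesgue_onI) simp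
  then have ae: "AE t in ?M. indicator A t *\<^sub>R p t = indicator S t *\<^sub>R p t"
    by eventually_elim (use S in \<open>auto simp: indicator_def\<close>)
  have "(LINT t|?M. indicator A t *\<^sub>R p t) = (LINT t|?M. indicator S t *\<^sub>R p t)"
  proof (rule integral_cong_AE[OF _ _ ae])
    show "(\<lambda>t. indicator S t *\<^sub>R p t) \<in> borel_measurable ?M"
      using S(4) by (intro borel_measurable_integrable integrable_indicator_scaleR_Icc p) simp
    show "(\<lambda>t. indicator A t *\<^sub>R p t) \<in> borel_measurable ?M"
      using \<open>A \<in> sets ?M\<close> p by (intro borel_measurable_scaleR) auto
  qed
  then show "set_lebesgue_integral ?M A p = 0"
    using borel[of S] S(4) by (simp add: set_lebesgue_integral_def)
qed

section \<open>Sobolev functions on compact intervals\<close>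

text \<open>
  The counterpart of \<open>W21_loc_derivs\<close> on a compact interval, including the end points.
\<close>

definition W21_on ::
    "real \<Rightarrow> real \<Rightarrow> (real \<Rightarrow> 'b::{banach, second_countable_topology}) \<Rightarrow> (real \<Rightarrow> 'b) \<Rightarrow> (real \<Rightarrow> 'b) \<Rightarrow> bool"
  where "W21_on c d y y1 y2 \<longleftrightarrow> integrable (lebesgue_on {c..d}) y2 \<and>
    (\<forall>x\<in>{c..d}. y x = y c + antideriv c d y1 x \<and> y1 x = y1 c + antideriv c d y2 x)"

lemma continuous_on_if_antideriv:
  fixes p P :: "real \<Rightarrow> 'b::{banach, second_countable_topology}"
  assumes p: "integrable (lebesgue_on {c..d}) p" and P: "\<And>x. x \<in> {c..d} \<Longrightarrow> P x = P c + antideriv c d p x"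
  shows "continuous_on {c..d} P"
  using continuous_on_antideriv[OF p]
  by (subst continuous_on_cong[OF refl P]) (auto intro!: continuous_intros intro: continuous_on_subset)

lemma continuous_on_Icc_measurable_bounded:
  fixes f :: "real \<Rightarrow> 'b::{banach, second_countable_topology}"
  assumes f: "continuous_on {c..d} f"
  shows "f \<in> borel_measurable (lebesgue_on {c..d})"
    and "\<exists>C\<ge>0. \<forall>x\<in>{c..d}. norm (f x) \<le> C"
proof -
  show "f \<in> borel_measurable (lebesgue_on {c..d})"
    using f by (rule continuous_imp_measurable_on_sets_lebesgue) simp
  obtain C where "\<forall>x\<in>{c..d}. norm (f x) \<le> C"
    using compact_imp_bounded[OF compact_continuous_image[OF f compact_Icc]]
    by (auto simp: bounded_iff)
  then have "\<forall>x\<in>{c..d}. norm (f x) \<le> max C 0" by (auto simp: le_max_iff_disj)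
  then show "\<exists>C\<ge>0. \<forall>x\<in>{c..d}. norm (f x) \<le> C" by (intro exI[of _ "max C 0"]) simp
qed

lemma integrable_lebesgue_on_Icc_bounded:
  fixes f :: "real \<Rightarrow> 'b::{banach, second_countable_topology}"
  assumes f: "f \<in> borel_measurable (lebesgue_on {c..d})" and C: "\<And>x. x \<in> {c..d} \<Longrightarrow> norm (f x) \<le> C"
  shows "integrable (lebesgue_on {c..d}) f"
proof -
  interpret finite_measure "lebesgue_on {c..d}" by (rule finite_measure_lebesgue_on_Icc)
  show ?thesis using f by (rule integrable_const_bound[where B = C, rotated]) (use C in \<open>auto intro!: AE_I2\<close>)
qed

lemma integrable_lebesgue_on_Icc_continuous:
  fixes f :: "real \<Rightarrow> 'b::{banach, second_countable_topology}"
  assumes f: "continuous_on {c..d} f"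
  shows "integrable (lebesgue_on {c..d}) f"
  using continuous_on_Icc_measurable_bounded[OF f] integrable_lebesgue_on_Icc_bounded by blast

lemma W21_onD:
  assumes "W21_on c d y y1 y2"
  shows "integrable (lebesgue_on {c..d}) y2" "\<And>x. x \<in> {c..d} \<Longrightarrow> y x = y c + antideriv c d y1 x"
    "\<And>x. x \<in> {c..d} \<Longrightarrow> y1 x = y1 c + antideriv c d y2 x"
  using assms unfolding W21_on_def by blast+

lemma W21_on_continuous:
  assumes "W21_on c d y y1 y2"
  shows "continuous_on {c..d} y1" "continuous_on {c..d} y" "integrable (lebesgue_on {c..d}) y1"
    "integrable (lebesgue_on {c..d}) y"
proof -
  show c1: "continuous_on {c..d} y1"
    by (rule continuous_on_if_antideriv[OF W21_onD(1,3)[OF assms]])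
  show i1: "integrable (lebesgue_on {c..d}) y1" by (rule integrable_lebesgue_on_Icc_continuous[OF c1])
  show c: "continuous_on {c..d} y"
    by (rule continuous_on_if_antideriv[OF i1 W21_onD(2)[OF assms]])
  show "integrable (lebesgue_on {c..d}) y" by (rule integrable_lebesgue_on_Icc_continuous[OF c])
qed

lemma antideriv_add:
  assumes "integrable (lebesgue_on {c..d}) p" "integrable (lebesgue_on {c..d}) q"
  shows "antideriv c d (\<lambda>t. p t + q t) x = antideriv c d p x + antideriv c d q x"
  using assms[THEN integrable_indicator_scaleR_Icc[where A = "{..x}"]]
  by (simp add: antideriv_def scaleR_add_right)

lemma antideriv_bounded_linear:
  assumes "bounded_linear T" "integrable (lebesgue_on {c..d}) p"
  shows "antideriv c d (\<lambda>t. T (p t)) x = T (antideriv c d p x)"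
  using integral_bounded_linear[OF assms(1) integrable_indicator_scaleR_Icc[OF assms(2), of "{..x}"]]
    bounded_linear.linear[OF assms(1)]
  by (simp add: antideriv_def linear_cmul)

lemma antideriv_diff:
  assumes "integrable (lebesgue_on {c..d}) p" "integrable (lebesgue_on {c..d}) q"
  shows "antideriv c d (\<lambda>t. p t - q t) x = antideriv c d p x - antideriv c d q x"
  using assms[THEN integrable_indicator_scaleR_Icc[where A = "{..x}"]]
  by (simp add: antideriv_def scaleR_diff_right)

lemma integral_Icc_indicator:
  assumes "s \<in> {c..d}" "x \<in> {c..d::real}"
  shows "(LINT t|lebesgue_on {c..d}. indicator {s..} t * indicator {..x} t) = max 0 (x - s)"
proof -
  have "(LINT t|lebesgue_on {c..d}. indicator {s..} t * indicator {..x} t) =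
      (LINT t|lebesgue. indicator {c..d} t *\<^sub>R (indicator {s..} t * indicator {..x} t :: real))"
    by (simp add: integral_restrict_space)
  also have "\<dots> = (LINT t|lebesgue. indicator {s..x} t)"
    using assms by (intro Bochner_Integration.integral_cong) (auto simp: indicator_def)
  also have "\<dots> = measure lebesgue {s..x}" by simp
  also have "\<dots> = max 0 (x - s)" by (simp add: max_def)
  finally show ?thesis .
qed

text \<open>
  Cauchy's formula for repeated integration.
\<close>

lemma antideriv_antideriv:
  fixes p :: "real \<Rightarrow> 'b::{banach, second_countable_topology}"
  assumes p: "integrable (lebesgue_on {c..d}) p" and x: "x \<in> {c..d}"
  shows "antideriv c d (antideriv c d p) x = (LINT s|lebesgue_on {c..d}. max 0 (x - s) *\<^sub>R p s)"
proof -
  let ?M = "lebesgue_on {c..d}"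
  have B: "bounded_bilinear (\<lambda>(a::'b) (r::real). r *\<^sub>R a)"
    by (rule bounded_bilinear.flip[OF bounded_bilinear_scaleR])
  have q: "integrable ?M (\<lambda>t. indicator {..x} t :: real)"
  proof (rule integrable_lebesgue_on_Icc_bounded[where C = 1])
    show "(\<lambda>t. indicator {..x} t :: real) \<in> borel_measurable ?M"
      by (intro measurable_restrict_space1 borel_measurable_indicator sets_completionI_sets) simp
  qed (simp add: indicator_def)
  have "antideriv c d (antideriv c d p) x =
      (LINT t|?M. indicator {..x} t *\<^sub>R (LINT s|?M. indicator {..t} s *\<^sub>R p s))"
    by (simp add: antideriv_def)
  also have "\<dots> = (LINT s|?M. (LINT t|?M. indicator {..t} s *\<^sub>R indicator {..x} t) *\<^sub>R p s)"
    by (rule kernel_Fubini[OF sigma_finite_measure_lebesgue_on_Icc B p q measurable_le_kernel, where C = 1])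
      (simp add: indicator_def)
  also have "\<dots> = (LINT s|?M. max 0 (x - s) *\<^sub>R p s)"
  proof (rule Bochner_Integration.integral_cong[OF refl])
    fix s assume "s \<in> space ?M"
    then have s: "s \<in> {c..d}" by simp
    have "(LINT t|?M. indicator {..t} s *\<^sub>R indicator {..x} t) = max 0 (x - s)"
      unfolding integral_Icc_indicator[OF s x, symmetric]
      by (intro Bochner_Integration.integral_cong) (auto simp: indicator_def)
    then show "(LINT t|?M. indicator {..t} s *\<^sub>R indicator {..x} t) *\<^sub>R p s = max 0 (x - s) *\<^sub>R p s"
      by simp
  qed
  finally show ?thesis .
qed

lemma antideriv_const:
  assumes "x \<in> {c..d}"
  shows "antideriv c d (\<lambda>t. v) x = (x - c) *\<^sub>R v"
proof -
  have "integrable (lebesgue_on {c..d}) (\<lambda>t. indicator {..x} t * (1::real))"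
    using integrable_indicator_scaleR_Icc[OF integrable_lebesgue_on_Icc_continuous[OF continuous_on_const[of _ "1::real"]], of "{..x}" c d]
    by simp
  then have "antideriv c d (\<lambda>t. v) x = (LINT t|lebesgue_on {c..d}. indicator {..x} t) *\<^sub>R v"
    by (simp add: antideriv_def)
  also have "(LINT t|lebesgue_on {c..d}. indicator {..x} t) =
      (LINT t|lebesgue_on {c..d}. indicator {c..} t * indicator {..x} t :: real)"
    by (intro Bochner_Integration.integral_cong) auto
  also have "\<dots> = x - c" using integral_Icc_indicator[of c c d x] assms by simp
  finally show ?thesis .
qed

lemma antideriv_ext_zero:
  fixes p :: "real \<Rightarrow> 'b::{banach, second_countable_topology}"
  assumes "integral\<^sup>L (lebesgue_on {c..d}) p = 0" "x \<notin> {c..d}"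
  shows "antideriv c d p x = 0"
proof (cases "x < c")
  case True
  then have "antideriv c d p x = (LINT t|lebesgue_on {c..d}. 0)"
    unfolding antideriv_def by (intro Bochner_Integration.integral_cong) auto
  then show ?thesis by simp
next
  case False
  then have "antideriv c d p x = integral\<^sup>L (lebesgue_on {c..d}) p"
    using assms(2) unfolding antideriv_def by (intro Bochner_Integration.integral_cong) auto
  then show ?thesis using assms(1) by simp
qed

lemma integrable_lebesgue_ext_zero:
  fixes p :: "real \<Rightarrow> 'b::{banach, second_countable_topology}"
  assumes p: "integrable (lebesgue_on {c..d}) p" and zero: "\<And>t. t \<notin> {c..d} \<Longrightarrow> p t = 0"
  shows "integrable lebesgue p" "integral\<^sup>L (lebesgue_on {c..d}) p = integral\<^sup>L lebesgue p"
proof -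
  have eq: "indicator {c..d} t *\<^sub>R p t = p t" for t using zero by (cases "t \<in> {c..d}") auto
  show "integrable lebesgue p" using p by (simp add: integrable_restrict_space eq)
  show "integral\<^sup>L (lebesgue_on {c..d}) p = integral\<^sup>L lebesgue p" by (simp add: integral_restrict_space eq)
qed

lemma interval_integral_eq_antideriv_ext_zero:
  fixes p :: "real \<Rightarrow> 'b::{banach, second_countable_topology}"
  assumes p: "integrable (lebesgue_on {c..d}) p" and zero: "\<And>t. t \<notin> {c..d} \<Longrightarrow> p t = 0"
  shows "(LINT t=ereal x1..ereal x2|lebesgue. p t) = antideriv c d p x2 - antideriv c d p x1"
proof -
  define c' where "c' = min c (min x1 x2)"
  define d' where "d' = max d (max x1 x2)"
  have sub: "{c..d} \<subseteq> {c'..d'}" by (auto simp: c'_def d'_def)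
  have "integrable lebesgue (\<lambda>t. indicator {c'..d'} t *\<^sub>R p t)"
    by (intro integrable_mult_indicator integrable_lebesgue_ext_zero(1)[OF p zero]) simp
  then have p': "integrable (lebesgue_on {c'..d'}) p" by (simp add: integrable_restrict_space)
  have "antideriv c' d' p x = antideriv c d p x" for x
  proof -
    have "(LINT t|lebesgue. indicator {c'..d'} t *\<^sub>R indicator {..x} t *\<^sub>R p t) =
        (LINT t|lebesgue. indicator {c..d} t *\<^sub>R indicator {..x} t *\<^sub>R p t)"
    proof (rule Bochner_Integration.integral_cong[OF refl])
      fix t
      show "indicator {c'..d'} t *\<^sub>R indicator {..x} t *\<^sub>R p t = indicator {c..d} t *\<^sub>R indicator {..x} t *\<^sub>R p t"
        using zero[of t] sub by (cases "t \<in> {c..d}") auto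
    qed
    then show ?thesis by (simp add: antideriv_def integral_restrict_space)
  qed
  moreover have "x1 \<in> {c'..d'}" "x2 \<in> {c'..d'}" unfolding c'_def d'_def by auto
  ultimately show ?thesis
    using interval_integral_eq_antideriv[OF p', of x1 x2] by simp
qed

section \<open>Integral equations with a small potential\<close>

lemma integrable_kernel_scaleR:
  fixes q :: "real \<Rightarrow> 'b::{banach, second_countable_topology}" and \<kappa> :: "real \<Rightarrow> real"
  assumes "integrable M q" "\<kappa> \<in> borel_measurable M" "\<And>t. t \<in> space M \<Longrightarrow> \<bar>\<kappa> t\<bar> \<le> C"
  shows "integrable M (\<lambda>t. \<kappa> t *\<^sub>R q t)"
  using assms by (intro integrable_bilinear_bounded[OF bounded_bilinear_scaleR, where C = C]) auto

lemma norm_kernel_integral_le: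
  fixes q :: "real \<Rightarrow> 'b::{banach, second_countable_topology}" and \<kappa> :: "real \<Rightarrow> real"
  assumes q: "integrable M q" and \<kappa>: "\<kappa> \<in> borel_measurable M" and C: "\<And>t. t \<in> space M \<Longrightarrow> \<bar>\<kappa> t\<bar> \<le> C"
  shows "norm (LINT t|M. \<kappa> t *\<^sub>R q t) \<le> C * (LINT t|M. norm (q t))"
proof -
  have "norm (LINT t|M. \<kappa> t *\<^sub>R q t) \<le> (LINT t|M. norm (\<kappa> t *\<^sub>R q t))"
    by (rule integral_norm_bound)
  also have "\<dots> \<le> (LINT t|M. C * norm (q t))"
  proof (rule integral_mono)
    show "integrable M (\<lambda>t. norm (\<kappa> t *\<^sub>R q t))"
      by (rule integrable_norm[OF integrable_kernel_scaleR[OF q \<kappa> C]])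
    show "integrable M (\<lambda>t. C * norm (q t))" using q by simp
    show "norm (\<kappa> t *\<^sub>R q t) \<le> C * norm (q t)" if "t \<in> space M" for t
      using C[OF that] by (auto intro: mult_right_mono)
  qed
  also have "\<dots> = C * (LINT t|M. norm (q t))" by simp
  finally show ?thesis .
qed

text \<open>
  The regularity of \<open>V\<close> on a compact interval that the integral equations need, in a form that is
  inherited by the truncations of \<open>V\<close>.
\<close>

definition admissible_potential ::
    "real \<Rightarrow> real \<Rightarrow> (real \<Rightarrow> ('h::{complex_hilbert, second_countable_topology} \<Rightarrow>\<^sub>L 'h)) \<Rightarrow> bool"
  where "admissible_potential c d W \<longleftrightarrow>
    (\<forall>h. (\<lambda>t. blinfun_apply (W t) h) \<in> borel_measurable (lebesgue_on {c..d})) \<and>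
    integrable (lebesgue_on {c..d}) (\<lambda>t. norm (W t))"

lemma admissible_potential_apply:
  fixes u :: "real \<Rightarrow> 'h::{complex_hilbert, second_countable_topology}"
  assumes W: "admissible_potential c d W" and u: "u \<in> borel_measurable (lebesgue_on {c..d})"
    and C: "\<And>t. t \<in> {c..d} \<Longrightarrow> norm (u t) \<le> C"
  shows "integrable (lebesgue_on {c..d}) (\<lambda>t. W t (u t))"
    and "(LINT t|lebesgue_on {c..d}. norm (W t (u t))) \<le> C * (LINT t|lebesgue_on {c..d}. norm (W t))"
proof -
  let ?M = "lebesgue_on {c..d}"
  have nW: "integrable ?M (\<lambda>t. norm (W t))" using W by (simp add: admissible_potential_def)
  have le: "norm (W t (u t)) \<le> C * norm (W t)" if "t \<in> {c..d}" for t
    using norm_blinfun[of "W t" "u t"] mult_left_mono[OF C[OF that], of "norm (W t)"] by (simp add: mult.commute)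
  show int: "integrable ?M (\<lambda>t. W t (u t))"
  proof (rule Bochner_Integration.integrable_bound)
    show "integrable ?M (\<lambda>t. C * norm (W t))" using nW by simp
    show "(\<lambda>t. W t (u t)) \<in> borel_measurable ?M"
      using W u unfolding admissible_potential_def by (blast intro: borel_measurable_blinfun_apply_pointwise)
    show "AE t in ?M. norm (W t (u t)) \<le> norm (C * norm (W t))"
    proof (rule AE_I2)
      fix t assume "t \<in> space ?M"
      then have "norm (W t (u t)) \<le> C * norm (W t)" by (intro le) simp
      then show "norm (W t (u t)) \<le> norm (C * norm (W t))" by (simp only: real_norm_def)
    qed
  qed
  have "(LINT t|?M. norm (W t (u t))) \<le> (LINT t|?M. C * norm (W t))"
    using int nW le by (intro integral_mono) auto
  then show "(LINT t|?M. norm (W t (u t))) \<le> C * (LINT t|?M. norm (W t))" by simp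
qed

lemma admissible_potential_continuous:
  fixes u :: "real \<Rightarrow> 'h::{complex_hilbert, second_countable_topology}"
  assumes W: "admissible_potential c d W" and u: "continuous_on {c..d} u"
  shows "integrable (lebesgue_on {c..d}) (\<lambda>t. W t (u t))"
  using continuous_on_Icc_measurable_bounded[OF u] admissible_potential_apply(1)[OF W] by blast

text \<open>
  The right-hand side defines a contraction of the bounded continuous functions in \<open>F\<close>, since the
  operator \<open>F \<mapsto> \<integral> \<kappa> x t W t (F t) dt\<close> has norm at most one half.  Functions on \<open>{c..d}\<close> are
  represented by functions on the line that are constant to the left and to the right of the interval.
\<close>

lemma kernel_equation_solution:
  fixes W :: "real \<Rightarrow> ('h::{complex_hilbert, second_countable_topology} \<Rightarrow>\<^sub>L 'h)" and \<kappa> :: "real \<Rightarrow> real \<Rightarrow> real"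
  assumes cd: "c \<le> d" and W: "admissible_potential c d W" and f: "integrable (lebesgue_on {c..d}) f"
    and meas: "\<And>x. x \<in> {c..d} \<Longrightarrow> \<kappa> x \<in> borel_measurable (lebesgue_on {c..d})"
    and bound: "\<And>x t. x \<in> {c..d} \<Longrightarrow> t \<in> {c..d} \<Longrightarrow> \<bar>\<kappa> x t\<bar> \<le> C"
    and cont: "\<And>x X t. x \<in> {c..d} \<Longrightarrow> (\<And>n. X n \<in> {c..d}) \<Longrightarrow> X \<longlonglongrightarrow> x \<Longrightarrow> t \<in> {c..d} \<Longrightarrow>
      (\<lambda>n. \<kappa> (X n) t) \<longlonglongrightarrow> \<kappa> x t"
    and small: "C * (LINT t|lebesgue_on {c..d}. norm (W t)) \<le> 1 / 2"
  obtains F where "continuous_on {c..d} F"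
    "\<And>x. x \<in> {c..d} \<Longrightarrow> F x = (LINT t|lebesgue_on {c..d}. \<kappa> x t *\<^sub>R (f t - W t (F t)))"
proof -
  let ?M = "lebesgue_on {c..d}"
  \<comment> \<open>the nearest point of the interval, which turns functions on \<open>{c..d}\<close> into functions on the line\<close>
  let ?cl = "\<lambda>x. max c (min d x)"
  have cl: "?cl x \<in> {c..d}" for x using cd by auto
  have C0: "C \<ge> 0" using bound[of c c] cd by (auto intro: order_trans[OF abs_ge_zero])
  let ?I = "\<lambda>g x. LINT t|?M. \<kappa> (?cl x) t *\<^sub>R g t"
  have kint: "integrable ?M (\<lambda>t. \<kappa> (?cl x) t *\<^sub>R g t)" if "integrable ?M g" for g :: "real \<Rightarrow> 'h" and x
    by (rule integrable_kernel_scaleR[OF that meas[OF cl], where C = C]) (use bound[OF cl] in auto)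
  have contI: "continuous_on {c..d} (\<lambda>x. LINT t|?M. \<kappa> x t *\<^sub>R g t)" if "integrable ?M g" for g :: "real \<Rightarrow> 'h"
    by (rule continuous_on_kernel_integral[OF that meas, where C = C])
      (use bound cont in \<open>auto intro!: AE_I2\<close>)
  have bc: "?I g \<in> bcontfun" if g: "integrable ?M g" for g :: "real \<Rightarrow> 'h"
  proof (rule bcontfun_normI)
    show "continuous_on UNIV (?I g)"
      by (rule continuous_on_compose2[OF contI[OF g], of UNIV ?cl]) (use cl in \<open>auto intro!: continuous_intros\<close>)
    show "norm (?I g x) \<le> C * (LINT t|?M. norm (g t))" for x
      by (rule norm_kernel_integral_le[OF g meas[OF cl]]) (use bound[OF cl] in auto)
  qed
  have Wu: "integrable ?M (\<lambda>t. f t - W t (apply_bcontfun u t))" for u :: "real \<Rightarrow>\<^sub>C 'h"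
    by (intro Bochner_Integration.integrable_diff f admissible_potential_continuous[OF W]) simp
  define T where "T u = Bcontfun (?I (\<lambda>t. f t - W t (apply_bcontfun u t)))" for u
  have T: "apply_bcontfun (T u) x = ?I (\<lambda>t. f t - W t (apply_bcontfun u t)) x" for u x
    unfolding T_def by (subst Bcontfun_inverse[OF bc[OF Wu]]) simp
  have "dist (T u) (T v) \<le> 1 / 2 * dist u v" for u v
  proof (rule dist_bound)
    fix x
    let ?D = "\<lambda>t. apply_bcontfun v t - apply_bcontfun u t"
    have D: "continuous_on {c..d} ?D" by (intro continuous_intros) auto
    have Dn: "norm (?D t) \<le> dist u v" for t
      using dist_bounded[of u t v] by (simp add: dist_norm norm_minus_commute)
    have "apply_bcontfun (T u) x - apply_bcontfun (T v) x = (LINT t|?M. \<kappa> (?cl x) t *\<^sub>R W t (?D t))"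
      unfolding T
      by (subst Bochner_Integration.integral_diff[OF kint[OF Wu] kint[OF Wu], symmetric])
        (simp add: blinfun.diff_right flip: scaleR_diff_right)
    then have "dist (apply_bcontfun (T u) x) (apply_bcontfun (T v) x) \<le> C * (LINT t|?M. norm (W t (?D t)))"
      unfolding dist_norm
      by (simp, intro norm_kernel_integral_le admissible_potential_continuous[OF W D] meas cl)
        (use bound[OF cl] in auto)
    also have "\<dots> \<le> C * (dist u v * (LINT t|?M. norm (W t)))"
      using Dn C0 by (intro mult_left_mono admissible_potential_apply(2)[OF W]
          continuous_on_Icc_measurable_bounded(1)[OF D])
    also have "\<dots> = dist u v * (C * (LINT t|?M. norm (W t)))" by simp
    also have "\<dots> \<le> dist u v * (1 / 2)" using small by (intro mult_left_mono) auto
    finally show "dist (apply_bcontfun (T u) x) (apply_bcontfun (T v) x) \<le> 1 / 2 * dist u v" by simp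
  qed
  then obtain u where u: "T u = u"
    using banach_fix_type[of "1 / 2" T] by auto
  show thesis
  proof (rule that)
    show "continuous_on {c..d} (apply_bcontfun u)" by simp
    fix x assume "x \<in> {c..d}"
    then have "?cl x = x" by auto
    then show "apply_bcontfun u x = (LINT t|?M. \<kappa> x t *\<^sub>R (f t - W t (apply_bcontfun u t)))"
      using T[of u x] u by simp
  qed
qed

section \<open>Compactly supported test functions\<close>

locale bounded_interval =
  fixes c d :: real
  assumes cd: "c < d"
begin

abbreviation M where "M \<equiv> lebesgue_on {c..d}"

text \<open>
  The affine functions dual to \<open>1\<close> and \<open>t - c\<close>: the integral and the first moment of \<open>\<phi>1\<close>
  are \<open>1\<close> and \<open>0\<close>, those of \<open>\<phi>2\<close> are \<open>0\<close> and \<open>1\<close>.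
\<close>

definition \<phi>1 :: "real \<Rightarrow> real" where "\<phi>1 t = 4 / (d - c) - 6 * (t - c) / (d - c)\<^sup>2"
definition \<phi>2 :: "real \<Rightarrow> real" where "\<phi>2 t = 12 * (t - c) / (d - c) ^ 3 - 6 / (d - c)\<^sup>2"

lemma integral_power_M: "(LINT t|M. (t - c) ^ n) = (d - c) ^ Suc n / Suc n"
proof -
  have "(LINT t|M. (t - c) ^ n) = (LINT t|lebesgue. indicator {c..d} t *\<^sub>R (t - c) ^ n)"
    by (simp add: integral_restrict_space)
  also have "\<dots> = (LINT t|lborel. indicator {c..d} t *\<^sub>R (t - c) ^ n)"
    by (rule integral_completion) measurable
  also have "\<dots> = (d - c) ^ Suc n / Suc n - (c - c) ^ Suc n / Suc n"
    by (rule has_bochner_integral_integral_eq, rule has_bochner_integral_FTC_Icc)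
      (use cd in \<open>auto intro!: derivative_eq_intros continuous_intros simp del: power_Suc
        simp flip: has_real_derivative_iff_has_vector_derivative\<close>)
  finally show ?thesis by simp
qed

lemma integrable_poly_M: "integrable M (\<lambda>t. (t - c) ^ n)"
  by (intro integrable_lebesgue_on_Icc_continuous continuous_intros)

lemma phi_moments:
  "(LINT t|M. \<phi>1 t) = 1" "(LINT t|M. (t - c) * \<phi>1 t) = 0"
  "(LINT t|M. \<phi>2 t) = 0" "(LINT t|M. (t - c) * \<phi>2 t) = 1"
proof -
  let ?L = "d - c"
  have L: "?L \<noteq> 0" using cd by simp
  have alg: "4 / l * (l ^ Suc 0 / Suc 0) + - 6 / l\<^sup>2 * (l ^ Suc 1 / Suc 1) = 1"
    "4 / l * (l ^ Suc 1 / Suc 1) + - 6 / l\<^sup>2 * (l ^ Suc 2 / Suc 2) = 0"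
    "12 / l ^ 3 * (l ^ Suc 1 / Suc 1) + - 6 / l\<^sup>2 * (l ^ Suc 0 / Suc 0) = 0"
    "12 / l ^ 3 * (l ^ Suc 2 / Suc 2) + - 6 / l\<^sup>2 * (l ^ Suc 1 / Suc 1) = 1"
    if "l \<noteq> 0" for l :: real
    using that by (simp_all add: field_simps power2_eq_square power3_eq_cube)
  have shift: "u * (4 / k - 6 * u / l) = 4 / k * u ^ 1 + - 6 / l * u ^ 2"
    "u * (12 * u / k - 6 / l) = 12 / k * u ^ 2 + - 6 / l * u ^ 1" for u k l :: real
    by (simp_all add: algebra_simps power2_eq_square)
  have lin: "(LINT t|M. a * (t - c) ^ m + b * (t - c) ^ n) = a * (?L ^ Suc m / Suc m) + b * (?L ^ Suc n / Suc n)"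
    for a b m n
    using integrable_poly_M by (simp add: integral_power_M)
  have "(LINT t|M. \<phi>1 t) = (LINT t|M. (4 / ?L) * (t - c) ^ 0 + (- 6 / ?L\<^sup>2) * (t - c) ^ 1)"
    by (intro Bochner_Integration.integral_cong) (auto simp: \<phi>1_def)
  then show "(LINT t|M. \<phi>1 t) = 1" unfolding lin alg(1)[OF L] by simp
  have "(LINT t|M. (t - c) * \<phi>1 t) = (LINT t|M. (4 / ?L) * (t - c) ^ 1 + (- 6 / ?L\<^sup>2) * (t - c) ^ 2)"
    by (intro Bochner_Integration.integral_cong) (simp_all only: \<phi>1_def shift)
  then show "(LINT t|M. (t - c) * \<phi>1 t) = 0" unfolding lin alg(2)[OF L] by simp
  have "(LINT t|M. \<phi>2 t) = (LINT t|M. (12 / ?L ^ 3) * (t - c) ^ 1 + (- 6 / ?L\<^sup>2) * (t - c) ^ 0)"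
    by (intro Bochner_Integration.integral_cong) (auto simp: \<phi>2_def)
  then show "(LINT t|M. \<phi>2 t) = 0" unfolding lin alg(3)[OF L] by simp
  have "(LINT t|M. (t - c) * \<phi>2 t) = (LINT t|M. (12 / ?L ^ 3) * (t - c) ^ 2 + (- 6 / ?L\<^sup>2) * (t - c) ^ 1)"
    by (intro Bochner_Integration.integral_cong) (simp_all only: \<phi>2_def shift)
  then show "(LINT t|M. (t - c) * \<phi>2 t) = 1" unfolding lin alg(4)[OF L] by simp
qed


lemma integrable_continuous_scaleR:
  fixes q :: "real \<Rightarrow> 'b::{banach, second_countable_topology}" and \<kappa> :: "real \<Rightarrow> real"
  assumes q: "integrable M q" and \<kappa>: "continuous_on {c..d} \<kappa>"
  shows "integrable M (\<lambda>t. \<kappa> t *\<^sub>R q t)"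
proof -
  obtain C where "\<forall>x\<in>{c..d}. norm (\<kappa> x) \<le> C" using continuous_on_Icc_measurable_bounded(2)[OF \<kappa>] by blast
  then show ?thesis
    by (intro integrable_kernel_scaleR[OF q continuous_on_Icc_measurable_bounded(1)[OF \<kappa>], where C = C]) auto
qed

lemma continuous_phi [continuous_intros]: "continuous_on S \<phi>1" "continuous_on S \<phi>2"
  unfolding \<phi>1_def \<phi>2_def using cd by (auto intro!: continuous_intros)

definition moment0 :: "(real \<Rightarrow> 'b::{banach, second_countable_topology}) \<Rightarrow> 'b"
  where "moment0 q = (LINT t|M. q t)"

definition moment1 :: "(real \<Rightarrow> 'b::{banach, second_countable_topology}) \<Rightarrow> 'b"
  where "moment1 q = (LINT t|M. (t - c) *\<^sub>R q t)"

text \<open>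
  The orthogonal projection to the affine functions.  A function with zero Cauchy data at \<open>c\<close>
  and second derivative \<open>r\<close> also has zero Cauchy data at \<open>d\<close> if and only if \<open>r\<close> has
  vanishing integral and vanishing first moment; subtracting the projection achieves this.
\<close>

definition affine_part :: "(real \<Rightarrow> 'b::{banach, second_countable_topology}) \<Rightarrow> real \<Rightarrow> 'b"
  where "affine_part q t = \<phi>1 t *\<^sub>R moment0 q + \<phi>2 t *\<^sub>R moment1 q"

lemma continuous_affine_part: "continuous_on S (affine_part q)"
  unfolding affine_part_def by (intro continuous_intros)

lemma integrable_affine_part: "integrable M (affine_part q)"
  by (intro integrable_lebesgue_on_Icc_continuous continuous_affine_part)

lemma integral_scaleR_affine_part:
  assumes \<kappa>: "continuous_on {c..d} \<kappa>"
  shows "(LINT t|M. \<kappa> t *\<^sub>R affine_part q t) = (LINT t|M. \<kappa> t * \<phi>1 t) *\<^sub>R moment0 q + (LINT t|M. \<kappa> t * \<phi>2 t) *\<^sub>R moment1 q"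
proof -
  have "integrable M (\<lambda>t. \<kappa> t * \<phi>1 t)" "integrable M (\<lambda>t. \<kappa> t * \<phi>2 t)"
    by (intro integrable_lebesgue_on_Icc_continuous continuous_intros \<kappa>)+
  then show ?thesis by (simp add: affine_part_def scaleR_add_right)
qed

lemma moment0_affine_part: "moment0 (affine_part q) = moment0 q"
  using integral_scaleR_affine_part[of "\<lambda>t. 1" q] phi_moments by (simp add: moment0_def[of "affine_part q"])

lemma moment1_affine_part: "moment1 (affine_part q) = moment1 q"
  using integral_scaleR_affine_part[of "\<lambda>t. t - c" q] phi_moments by (simp add: moment1_def[of "affine_part q"] continuous_intros)

definition \<alpha> :: "real \<Rightarrow> real" where "\<alpha> x = (LINT t|M. max 0 (x - t) * \<phi>1 t)"
definition \<beta> :: "real \<Rightarrow> real" where "\<beta> x = (LINT t|M. max 0 (x - t) * \<phi>2 t)"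

text \<open>
  The kernel of the operator that integrates \<open>affine_part q - q\<close> twice.  The terms \<open>\<alpha> x\<close> and
  \<open>\<beta> x * (t - c)\<close> come from \<open>affine_part q\<close>, and the subtracted term is Cauchy's kernel
  of repeated integration.
\<close>

definition test_kernel :: "real \<Rightarrow> real \<Rightarrow> real"
  where "test_kernel x t = \<alpha> x + \<beta> x * (t - c) - max 0 (x - t)"

lemma continuous_max_integral:
  fixes q :: "real \<Rightarrow> 'b::{banach, second_countable_topology}"
  assumes q: "integrable M q"
  shows "continuous_on {c..d} (\<lambda>x. LINT t|M. max 0 (x - t) *\<^sub>R q t)"
proof (rule continuous_on_kernel_integral[OF q, where C = "d - c"])
  show "(\<lambda>t. max 0 (x - t)) \<in> borel_measurable M" for x
    by (intro continuous_on_Icc_measurable_bounded continuous_intros)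
  show "AE t in M. (\<lambda>n. max 0 (X n - t)) \<longlonglongrightarrow> max 0 (x - t)" if "X \<longlonglongrightarrow> x" for X x
    by (intro AE_I2 tendsto_intros that)
qed auto

lemma continuous_alpha: "continuous_on {c..d} \<alpha>"
  using continuous_max_integral[OF integrable_lebesgue_on_Icc_continuous[OF continuous_phi(1)]]
  by (simp add: \<alpha>_def[abs_def])

lemma continuous_beta: "continuous_on {c..d} \<beta>"
  using continuous_max_integral[OF integrable_lebesgue_on_Icc_continuous[OF continuous_phi(2)]]
  by (simp add: \<beta>_def[abs_def])

lemma test_kernel_continuous:
  "t \<in> {c..d} \<Longrightarrow> continuous_on {c..d} (\<lambda>x. test_kernel x t)"
  "x \<in> {c..d} \<Longrightarrow> continuous_on {c..d} (test_kernel x)"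
  unfolding test_kernel_def[abs_def]
  by (intro continuous_intros continuous_alpha continuous_beta)+

lemma test_kernel_measurable: "case_prod test_kernel \<in> borel_measurable (M \<Otimes>\<^sub>M M)"
proof -
  have [measurable]: "\<alpha> \<in> borel_measurable M" "\<beta> \<in> borel_measurable M" "(\<lambda>x. x) \<in> borel_measurable M"
    by (intro continuous_on_Icc_measurable_bounded continuous_alpha continuous_beta continuous_intros)+
  have [measurable]: "fst \<in> borel_measurable (M \<Otimes>\<^sub>M M)" "snd \<in> borel_measurable (M \<Otimes>\<^sub>M M)"
    using measurable_compose[OF measurable_fst measurable_id_lebesgue_on]
      measurable_compose[OF measurable_snd measurable_id_lebesgue_on] by auto
  show ?thesis unfolding test_kernel_def case_prod_beta by measurable
qed

lemma test_kernel_bounded: obtains C where "C > 0" "\<And>x t. x \<in> {c..d} \<Longrightarrow> t \<in> {c..d} \<Longrightarrow> \<bar>test_kernel x t\<bar> \<le> C"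
proof -
  obtain A where A: "A \<ge> 0" "\<forall>x\<in>{c..d}. norm (\<alpha> x) \<le> A"
    using continuous_on_Icc_measurable_bounded(2)[OF continuous_alpha] by blast
  obtain B where B: "B \<ge> 0" "\<forall>x\<in>{c..d}. norm (\<beta> x) \<le> B"
    using continuous_on_Icc_measurable_bounded(2)[OF continuous_beta] by blast
  have "\<bar>test_kernel x t\<bar> \<le> A + B * (d - c) + (d - c)" if "x \<in> {c..d}" "t \<in> {c..d}" for x t
  proof -
    have "\<bar>\<beta> x * (t - c)\<bar> \<le> B * (d - c)"
      unfolding abs_mult using that B by (intro mult_mono) auto
    moreover have "\<bar>\<alpha> x\<bar> \<le> A" using A that by auto
    moreover have "\<bar>max 0 (x - t)\<bar> \<le> d - c" using that by auto
    ultimately show ?thesis unfolding test_kernel_def by linarith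
  qed
  moreover have "A + B * (d - c) + (d - c) > 0"
    using A B cd by (simp add: add_nonneg_pos)
  ultimately show thesis using that by blast
qed

lemma antideriv_antideriv_affine_part:
  fixes q :: "real \<Rightarrow> 'b::{banach, second_countable_topology}"
  assumes q: "integrable M q" and x: "x \<in> {c..d}"
  shows "antideriv c d (antideriv c d (\<lambda>t. affine_part q t - q t)) x = (LINT t|M. test_kernel x t *\<^sub>R q t)"
proof -
  have mx: "continuous_on {c..d} (\<lambda>t. max 0 (x - t))" by (intro continuous_intros)
  have "antideriv c d (antideriv c d (\<lambda>t. affine_part q t - q t)) x = (LINT t|M. max 0 (x - t) *\<^sub>R (affine_part q t - q t))"
    by (intro antideriv_antideriv Bochner_Integration.integrable_diff integrable_affine_part q x)
  also have "\<dots> = (LINT t|M. max 0 (x - t) *\<^sub>R affine_part q t) - (LINT t|M. max 0 (x - t) *\<^sub>R q t)"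
    unfolding scaleR_diff_right
    by (intro Bochner_Integration.integral_diff integrable_continuous_scaleR integrable_affine_part q mx)
  also have "(LINT t|M. max 0 (x - t) *\<^sub>R affine_part q t) = \<alpha> x *\<^sub>R moment0 q + \<beta> x *\<^sub>R moment1 q"
    unfolding integral_scaleR_affine_part[OF mx] by (simp add: \<alpha>_def \<beta>_def)
  also have "\<alpha> x *\<^sub>R moment0 q + \<beta> x *\<^sub>R moment1 q =
      (LINT t|M. \<alpha> x *\<^sub>R q t) + (LINT t|M. \<beta> x *\<^sub>R ((t - c) *\<^sub>R q t))"
    using q integrable_continuous_scaleR[OF q, of "\<lambda>t. t - c"]
    by (simp add: moment0_def moment1_def continuous_intros del: scaleR_scaleR)
  also have "\<dots> - (LINT t|M. max 0 (x - t) *\<^sub>R q t) =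
      (LINT t|M. \<alpha> x *\<^sub>R q t + \<beta> x *\<^sub>R ((t - c) *\<^sub>R q t) - max 0 (x - t) *\<^sub>R q t)"
    using q integrable_continuous_scaleR[OF q, of "\<lambda>t. t - c"] integrable_continuous_scaleR[OF q mx]
    by (simp add: continuous_intros del: scaleR_scaleR)
  also have "\<dots> = (LINT t|M. test_kernel x t *\<^sub>R q t)"
    by (simp add: test_kernel_def algebra_simps)
  finally show ?thesis .
qed

text \<open>
  In the second variable the kernel is an affine function minus \<open>max 0 (t - x)\<close>, because
  \<open>max 0 (x - t) = (x - t) + max 0 (t - x)\<close>.  So the transposed operator inverts the negative second
  derivative without any correction, but also without boundary conditions.
\<close>

lemma transposed_kernel_W21_on:
  fixes q z :: "real \<Rightarrow> 'b::{banach, second_countable_topology}"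
  assumes q: "integrable M q" and z: "\<And>t. t \<in> {c..d} \<Longrightarrow> z t = (LINT x|M. test_kernel x t *\<^sub>R q x)"
  obtains z1 where "W21_on c d z z1 (\<lambda>t. - q t)"
proof -
  define v0 where "v0 = (LINT x|M. \<alpha> x *\<^sub>R q x) - moment1 q"
  define v1 where "v1 = (LINT x|M. \<beta> x *\<^sub>R q x) + moment0 q"
  note ints = integrable_continuous_scaleR[OF q continuous_alpha] integrable_continuous_scaleR[OF q continuous_beta]
  have zt: "z t = v0 + (t - c) *\<^sub>R v1 - antideriv c d (antideriv c d q) t" if t: "t \<in> {c..d}" for t
  proof -
    have i2: "integrable M (\<lambda>x. max 0 (t - x) *\<^sub>R q x)" "integrable M (\<lambda>x. (x - c) *\<^sub>R q x)"
      by (intro integrable_continuous_scaleR q continuous_intros)+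
    \<comment> \<open>rewriting \<open>max 0 (x - t)\<close> separates an affine function of \<open>t\<close> from the kernel of repeated integration\<close>
    have "test_kernel x t = \<alpha> x + (t - c) * \<beta> x - (x - c) + (t - c) - max 0 (t - x)" for x
      unfolding test_kernel_def by (auto simp: max_def)
    then have "z t = (LINT x|M. \<alpha> x *\<^sub>R q x + (t - c) *\<^sub>R (\<beta> x *\<^sub>R q x) - (x - c) *\<^sub>R q x
        + (t - c) *\<^sub>R q x - max 0 (t - x) *\<^sub>R q x)"
      unfolding z[OF t] by (intro Bochner_Integration.integral_cong) (simp_all add: scaleR_left_distrib scaleR_left_diff_distrib)
    also have "\<dots> = (LINT x|M. \<alpha> x *\<^sub>R q x) + (t - c) *\<^sub>R (LINT x|M. \<beta> x *\<^sub>R q x) - moment1 q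
        + (t - c) *\<^sub>R moment0 q - (LINT x|M. max 0 (t - x) *\<^sub>R q x)"
      using q ints i2 by (simp add: moment0_def moment1_def del: scaleR_scaleR)
    also have "\<dots> = v0 + (t - c) *\<^sub>R v1 - antideriv c d (antideriv c d q) t"
      by (simp add: v0_def v1_def antideriv_antideriv[OF q t] scaleR_add_right)
    finally show ?thesis .
  qed
  have "c \<in> {c..d}" using cd by simp
  have zc: "z c = v0" using zt[OF \<open>c \<in> {c..d}\<close>] by simp
  have ip: "integrable M (antideriv c d q)"
    using continuous_on_antideriv[OF q] by (intro integrable_lebesgue_on_Icc_continuous) (auto intro: continuous_on_subset)
  have iv: "integrable M (\<lambda>t. v1)" by (intro integrable_lebesgue_on_Icc_continuous continuous_intros)
  have "W21_on c d z (\<lambda>t. v1 - antideriv c d q t) (\<lambda>t. - q t)"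
    unfolding W21_on_def
  proof (intro conjI ballI)
    show "integrable M (\<lambda>t. - q t)" using q by simp
    fix x assume x: "x \<in> {c..d}"
    show "z x = z c + antideriv c d (\<lambda>t. v1 - antideriv c d q t) x"
      by (simp add: zc zt[OF x] antideriv_diff[OF iv ip] antideriv_const[OF x])
    show "v1 - antideriv c d q x = v1 - antideriv c d q c + antideriv c d (\<lambda>t. - q t) x"
      using antideriv_bounded_linear[OF bounded_linear_minus[OF bounded_linear_ident] q, of x] by simp
  qed
  then show thesis by (rule that)
qed

lemma test_kernel_duality:
  fixes p q :: "real \<Rightarrow> 'h::{complex_hilbert, second_countable_topology}"
  assumes p: "integrable M p" and q: "integrable M q"
  shows "(LINT t|M. cinner (LINT s|M. test_kernel s t *\<^sub>R p s) (q t)) = (LINT s|M. cinner (p s) (LINT t|M. test_kernel s t *\<^sub>R q t))"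
proof -
  obtain C where "\<And>x t. x \<in> {c..d} \<Longrightarrow> t \<in> {c..d} \<Longrightarrow> \<bar>test_kernel x t\<bar> \<le> C" by (rule test_kernel_bounded) blast
  then show ?thesis
    by (intro kernel_Fubini[OF sigma_finite_measure_lebesgue_on_Icc bounded_bilinear_cinner p q test_kernel_measurable, where C = C]) auto
qed

text \<open>
  The transpose of \<open>affine_part\<close>, in the form in which it is visibly an affine function of \<open>t\<close>.
\<close>

definition affine_part_adj :: "(real \<Rightarrow> 'b::{banach, second_countable_topology}) \<Rightarrow> real \<Rightarrow> 'b"
  where "affine_part_adj p t = (LINT s|M. \<phi>1 s *\<^sub>R p s) + (t - c) *\<^sub>R (LINT s|M. \<phi>2 s *\<^sub>R p s)"

lemma affine_part_adj_W21_on: obtains a1 where "W21_on c d (affine_part_adj p) a1 (\<lambda>t. 0)"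
proof -
  let ?v = "LINT s|M. \<phi>2 s *\<^sub>R p s"
  have "W21_on c d (affine_part_adj p) (\<lambda>t. ?v) (\<lambda>t. 0)"
    unfolding W21_on_def
  proof (intro conjI ballI)
    fix x assume x: "x \<in> {c..d}"
    show "affine_part_adj p x = affine_part_adj p c + antideriv c d (\<lambda>t. ?v) x"
      by (simp add: affine_part_adj_def antideriv_const[OF x])
    show "?v = ?v + antideriv c d (\<lambda>t. 0) x" by (simp add: antideriv_const[OF x])
  qed simp
  then show thesis by (rule that)
qed

lemma affine_part_duality:
  fixes p q :: "real \<Rightarrow> 'h::{complex_hilbert, second_countable_topology}"
  assumes p: "integrable M p" and q: "integrable M q"
  shows "(LINT t|M. cinner (p t) (affine_part q t)) = (LINT t|M. cinner (affine_part_adj p t) (q t))"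
proof -
  have c1: "(LINT t|M. cinner (p t) (affine_part q t)) =
      cinner (LINT t|M. \<phi>1 t *\<^sub>R p t) (moment0 q) + cinner (LINT t|M. \<phi>2 t *\<^sub>R p t) (moment1 q)"
  proof -
    have i: "integrable M (\<lambda>t. \<phi>1 t *\<^sub>R p t)" "integrable M (\<lambda>t. \<phi>2 t *\<^sub>R p t)"
      by (intro integrable_continuous_scaleR p continuous_intros)+
    note bl = bounded_bilinear.bounded_linear_left[OF bounded_bilinear_cinner]
    have "(LINT t|M. cinner (p t) (affine_part q t)) =
        (LINT t|M. cinner (\<phi>1 t *\<^sub>R p t) (moment0 q) + cinner (\<phi>2 t *\<^sub>R p t) (moment1 q))"
      by (simp add: affine_part_def cinner_simps)
    also have "\<dots> = (LINT t|M. cinner (\<phi>1 t *\<^sub>R p t) (moment0 q)) + (LINT t|M. cinner (\<phi>2 t *\<^sub>R p t) (moment1 q))"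
      by (intro Bochner_Integration.integral_add integrable_bounded_linear[OF bl] i)
    finally show ?thesis by (simp add: integral_bounded_linear[OF bl i(1)] integral_bounded_linear[OF bl i(2)])
  qed
  let ?u = "LINT t|M. \<phi>1 t *\<^sub>R p t" and ?v = "LINT t|M. \<phi>2 t *\<^sub>R p t"
  note bl = bounded_bilinear.bounded_linear_right[OF bounded_bilinear_cinner]
  have i: "integrable M (\<lambda>t. (t - c) *\<^sub>R q t)" by (intro integrable_continuous_scaleR q continuous_intros)
  have "(LINT t|M. cinner (affine_part_adj p t) (q t)) = (LINT t|M. cinner ?u (q t) + cinner ?v ((t - c) *\<^sub>R q t))"
    by (simp add: affine_part_adj_def cinner_simps)
  also have "\<dots> = (LINT t|M. cinner ?u (q t)) + (LINT t|M. cinner ?v ((t - c) *\<^sub>R q t))"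
    by (intro Bochner_Integration.integral_add integrable_bounded_linear[OF bl] i q)
  also have "\<dots> = cinner ?u (moment0 q) + cinner ?v (moment1 q)"
    by (simp add: integral_bounded_linear[OF bl i] integral_bounded_linear[OF bl q] moment0_def moment1_def)
  finally show ?thesis using c1 by simp
qed

text \<open>
  Vanishing of the integral and of the first moment of \<open>y2\<close> makes both antiderivatives vanish at the
  right end point, so that the extension by zero does not destroy differentiability.
\<close>

lemma corrected_test_function:
  fixes q :: "real \<Rightarrow> 'b::{banach, second_countable_topology}"
  assumes q: "integrable M q"
  defines "y2 \<equiv> (\<lambda>t. if t \<in> {c..d} then affine_part q t - q t else 0)"
  defines "y1 \<equiv> antideriv c d y2"
  defines "y \<equiv> antideriv c d y1"
  shows "W21_loc_derivs J y y1 y2"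
    and "\<And>x. x \<notin> {c..d} \<Longrightarrow> y x = 0"
    and "\<And>x. x \<in> {c..d} \<Longrightarrow> y x = (LINT t|M. test_kernel x t *\<^sub>R q t)"
proof -
  let ?r = "\<lambda>t. affine_part q t - q t"
  have ir: "integrable M ?r" by (intro Bochner_Integration.integrable_diff integrable_affine_part q)
  have y2r: "indicator {..x} t *\<^sub>R y2 t = indicator {..x} t *\<^sub>R ?r t" if "t \<in> space M" for t x
    using that by (simp add: y2_def)
  have antideriv_y2: "antideriv c d y2 x = antideriv c d ?r x" for x
    unfolding antideriv_def by (intro Bochner_Integration.integral_cong y2r refl)
  have "integrable M y2 \<longleftrightarrow> integrable M ?r"
  proof (rule Bochner_Integration.integrable_cong[OF refl])
    fix t assume "t \<in> space M"
    then show "y2 t = ?r t" by (simp add: y2_def)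
  qed
  then have i2: "integrable M y2" using ir by blast
  have i3: "integrable M (\<lambda>t. (t - c) *\<^sub>R affine_part q t)" "integrable M (\<lambda>t. (t - c) *\<^sub>R q t)"
    by (intro integrable_continuous_scaleR integrable_affine_part q continuous_intros)+
  have "(LINT t|M. y2 t) = (LINT t|M. ?r t)"
    by (intro Bochner_Integration.integral_cong) (auto simp: y2_def)
  also have "\<dots> = moment0 (affine_part q) - moment0 q"
    unfolding moment0_def by (intro Bochner_Integration.integral_diff integrable_affine_part q)
  finally have int0: "(LINT t|M. y2 t) = 0" by (simp add: moment0_affine_part)
  have y1_0: "y1 x = 0" if "x \<notin> {c..d}" for x
    unfolding y1_def by (rule antideriv_ext_zero[OF int0 that])
  have c1: "continuous_on UNIV y1" unfolding y1_def by (rule continuous_on_antideriv[OF i2])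
  have i1: "integrable M y1"
    using c1 by (intro integrable_lebesgue_on_Icc_continuous) (auto intro: continuous_on_subset)
  have yeq: "y x = (LINT t|M. test_kernel x t *\<^sub>R q t)" if "x \<in> {c..d}" for x
  proof -
    have "y x = antideriv c d (antideriv c d ?r) x" by (simp add: y_def y1_def antideriv_y2[abs_def])
    also have "\<dots> = (LINT t|M. test_kernel x t *\<^sub>R q t)" by (rule antideriv_antideriv_affine_part[OF q that])
    finally show ?thesis .
  qed
  then show "\<And>x. x \<in> {c..d} \<Longrightarrow> y x = (LINT t|M. test_kernel x t *\<^sub>R q t)" .
  have "(LINT t|M. y1 t) = antideriv c d (antideriv c d ?r) d"
    by (simp add: antideriv_right y1_def antideriv_y2[abs_def])
  also have "\<dots> = (LINT t|M. max 0 (d - t) *\<^sub>R ?r t)" by (rule antideriv_antideriv[OF ir]) (use cd in simp)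
  also have "\<dots> = (LINT t|M. (d - c) *\<^sub>R ?r t - ((t - c) *\<^sub>R affine_part q t - (t - c) *\<^sub>R q t))"
  proof (rule Bochner_Integration.integral_cong[OF refl])
    fix t assume "t \<in> space M"
    then have "max 0 (d - t) = (d - c) - (t - c)" by simp
    then show "max 0 (d - t) *\<^sub>R ?r t = (d - c) *\<^sub>R ?r t - ((t - c) *\<^sub>R affine_part q t - (t - c) *\<^sub>R q t)"
      by (simp only: scaleR_left_diff_distrib[of "d - c"] scaleR_diff_right[of "t - c"])
  qed
  also have "\<dots> = (LINT t|M. (d - c) *\<^sub>R ?r t) - ((LINT t|M. (t - c) *\<^sub>R affine_part q t) - (LINT t|M. (t - c) *\<^sub>R q t))"
    using i3 ir by (simp del: scaleR_diff_right)
  also have "(LINT t|M. (d - c) *\<^sub>R ?r t) = (d - c) *\<^sub>R (moment0 (affine_part q) - moment0 q)"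
    unfolding moment0_def using integrable_affine_part[of q] q by simp
  also have "(LINT t|M. (t - c) *\<^sub>R affine_part q t) - (LINT t|M. (t - c) *\<^sub>R q t) = moment1 (affine_part q) - moment1 q"
    by (simp add: moment1_def)
  finally have int1: "(LINT t|M. y1 t) = 0" by (simp add: moment0_affine_part moment1_affine_part)
  show "\<And>x. x \<notin> {c..d} \<Longrightarrow> y x = 0"
    unfolding y_def by (rule antideriv_ext_zero[OF int1])
  have loc: "p \<in> L1_loc J" if "integrable M p" "\<And>t. t \<notin> {c..d} \<Longrightarrow> p t = 0"
    for p :: "real \<Rightarrow> 'b"
    unfolding L1_loc_def set_integrable_def
    using integrable_lebesgue_ext_zero(1)[OF that]
    by (auto intro!: integrable_mult_indicator simp: lmeasurable_compact fmeasurableD)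
  have y2_0: "y2 t = 0" if "t \<notin> {c..d}" for t using that by (auto simp: y2_def)
  show "W21_loc_derivs J y y1 y2"
    unfolding W21_loc_derivs_def
    using loc[OF i1 y1_0] loc[OF i2 y2_0] interval_integral_eq_antideriv_ext_zero[OF i1 y1_0]
      interval_integral_eq_antideriv_ext_zero[OF i2 y2_0]
    by (simp add: y_def[symmetric] y1_def[symmetric])
qed

end

section \<open>Interior regularity of weak solutions\<close>

lemma sq_integrable_subset:
  assumes f: "f \<in> sq_integrable J" and I: "I \<subseteq> J" "I \<in> sets lebesgue" "J \<in> sets lebesgue"
  shows "f \<in> sq_integrable I"
proof -
  have "f \<in> borel_measurable (lebesgue_on I)"
    using f I(1) by (auto simp: sq_integrable_def intro: measurable_restrict_mono)
  moreover have "integrable lebesgue (\<lambda>x. indicator I x *\<^sub>R (indicator J x *\<^sub>R (norm (f x))\<^sup>2))"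
    using f I by (intro integrable_mult_indicator[OF I(2)]) (simp add: sq_integrable_def integrable_restrict_space)
  moreover have "indicator I x *\<^sub>R (indicator J x *\<^sub>R (norm (f x))\<^sup>2) = indicator I x *\<^sub>R (norm (f x))\<^sup>2" for x
    using I(1) by (auto simp: indicator_def)
  ultimately have "f \<in> borel_measurable (lebesgue_on I)"
    "integrable lebesgue (\<lambda>x. indicator I x *\<^sub>R (norm (f x))\<^sup>2)" by (simp_all only:)
  then show ?thesis using I by (simp add: sq_integrable_def integrable_restrict_space)
qed

lemma sq_integrable_ext_zero:
  assumes f: "f \<in> sq_integrable I" and zero: "\<And>x. x \<in> J \<Longrightarrow> x \<notin> I \<Longrightarrow> f x = 0"
    and I: "I \<subseteq> J" "I \<in> sets lebesgue" "J \<in> sets lebesgue"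
  shows "f \<in> sq_integrable J"
proof -
  have "(\<lambda>x. indicator J x *\<^sub>R f x) = (\<lambda>x. indicator I x *\<^sub>R f x)"
    "(\<lambda>x. indicator J x * (norm (f x))\<^sup>2) = (\<lambda>x. indicator I x * (norm (f x))\<^sup>2)"
    using zero I(1) by (auto simp: indicator_def fun_eq_iff)
  then show ?thesis
    using f I by (simp add: sq_integrable_def integrable_restrict_space borel_measurable_restrict_space_iff)
qed

lemma fun_inner_ext_zero:
  assumes zero: "\<And>x. x \<in> J \<Longrightarrow> x \<notin> I \<Longrightarrow> f x = 0 \<or> g x = 0"
    and I: "I \<subseteq> J" "I \<in> sets lebesgue" "J \<in> sets lebesgue"
  shows "fun_inner J f g = fun_inner I f g"
proof -
  have "(\<lambda>x. indicator J x *\<^sub>R cinner (f x) (g x)) = (\<lambda>x. indicator I x *\<^sub>R cinner (f x) (g x))"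
    using zero I(1) by (fastforce simp: indicator_def fun_eq_iff)
  then show ?thesis using I by (simp add: fun_inner_def integral_restrict_space)
qed

lemma sq_integrable_cong:
  assumes "f \<in> sq_integrable J" "\<And>t. t \<in> J \<Longrightarrow> g t = f t"
  shows "g \<in> sq_integrable J"
proof -
  have "g \<in> borel_measurable (lebesgue_on J) \<longleftrightarrow> f \<in> borel_measurable (lebesgue_on J)"
    by (rule measurable_cong) (simp add: assms(2))
  moreover have "integrable (lebesgue_on J) (\<lambda>t. (norm (g t))\<^sup>2) \<longleftrightarrow> integrable (lebesgue_on J) (\<lambda>t. (norm (f t))\<^sup>2)"
    by (rule Bochner_Integration.integrable_cong[OF refl]) (simp add: assms(2))
  ultimately show ?thesis using assms(1) by (simp add: sq_integrable_def)
qed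

lemma sq_integrable_Icc_integrable:
  assumes f: "f \<in> sq_integrable {c..d}"
  shows "integrable (lebesgue_on {c..d}) f"
proof (rule Bochner_Integration.integrable_bound)
  interpret finite_measure "lebesgue_on {c..d}" by (rule finite_measure_lebesgue_on_Icc)
  show "integrable (lebesgue_on {c..d}) (\<lambda>x. 1 + (norm (f x))\<^sup>2)"
    using f by (simp add: sq_integrable_def)
  show "f \<in> borel_measurable (lebesgue_on {c..d})" using f by (simp add: sq_integrable_def)
  have "norm (f x) \<le> norm (1 + (norm (f x))\<^sup>2)" for x
  proof -
    have "2 * norm (f x) \<le> (norm (f x))\<^sup>2 + 1" using sum_squares_bound[of "norm (f x)" 1] by simp
    then have "norm (f x) \<le> 1 + (norm (f x))\<^sup>2" using norm_ge_zero[of "f x"] by linarith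
    then show ?thesis by simp
  qed
  then show "AE x in lebesgue_on {c..d}. norm (f x) \<le> norm (1 + (norm (f x))\<^sup>2)" by simp
qed

lemma sq_integrable_continuous:
  fixes f :: "real \<Rightarrow> 'h::{complex_hilbert, second_countable_topology}"
  assumes f: "continuous_on {c..d} f"
  shows "f \<in> sq_integrable {c..d}"
  unfolding sq_integrable_def
  using continuous_on_Icc_measurable_bounded(1)[OF f]
  by (auto intro!: integrable_lebesgue_on_Icc_continuous continuous_intros f)

lemma bounded_operator_sq_integrable:
  fixes T :: "real \<Rightarrow> ('h::{complex_hilbert, second_countable_topology} \<Rightarrow>\<^sub>L 'h)"
  assumes T: "\<And>h. (\<lambda>t. T t h) \<in> borel_measurable (lebesgue_on J)"
    and n: "\<And>t. norm (T t) \<le> n" and f: "f \<in> sq_integrable J"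
  shows "(\<lambda>t. T t (f t)) \<in> sq_integrable J"
proof -
  have meas: "(\<lambda>t. T t (f t)) \<in> borel_measurable (lebesgue_on J)"
    by (rule borel_measurable_blinfun_apply_pointwise[OF T sq_integrable_measurable[OF f]])
  have "integrable (lebesgue_on J) (\<lambda>t. (norm (T t (f t)))\<^sup>2)"
  proof (rule Bochner_Integration.integrable_bound)
    show "integrable (lebesgue_on J) (\<lambda>t. n\<^sup>2 * (norm (f t))\<^sup>2)"
      using f by (simp add: sq_integrable_def)
    show "(\<lambda>t. (norm (T t (f t)))\<^sup>2) \<in> borel_measurable (lebesgue_on J)" using meas by measurable
    have "(norm (T t (f t)))\<^sup>2 \<le> n\<^sup>2 * (norm (f t))\<^sup>2" for t
    proof -
      have "norm (T t (f t)) \<le> norm (T t) * norm (f t)" by (rule norm_blinfun)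
      also have "\<dots> \<le> n * norm (f t)" by (intro mult_right_mono n) simp
      finally have "norm (T t (f t)) \<le> n * norm (f t)" .
      from power_mono[OF this norm_ge_zero, of 2] show ?thesis unfolding power_mult_distrib .
    qed
    then show "AE t in lebesgue_on J. norm ((norm (T t (f t)))\<^sup>2) \<le> norm (n\<^sup>2 * (norm (f t))\<^sup>2)" by simp
  qed
  with meas show ?thesis by (simp add: sq_integrable_def)
qed

lemma W21_on_add:
  assumes y: "W21_on c d y y1 y2" and z: "W21_on c d z z1 z2"
  shows "W21_on c d (\<lambda>t. y t + z t) (\<lambda>t. y1 t + z1 t) (\<lambda>t. y2 t + z2 t)"
  unfolding W21_on_def
proof (intro conjI ballI)
  note ints = W21_onD(1)[OF y] W21_onD(1)[OF z] W21_on_continuous(3)[OF y] W21_on_continuous(3)[OF z]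
  show "integrable (lebesgue_on {c..d}) (\<lambda>t. y2 t + z2 t)" using ints by simp
  fix x assume x: "x \<in> {c..d}"
  show "y x + z x = y c + z c + antideriv c d (\<lambda>t. y1 t + z1 t) x"
    using W21_onD(2)[OF y x] W21_onD(2)[OF z x] by (simp add: antideriv_add[OF ints(3,4)])
  show "y1 x + z1 x = y1 c + z1 c + antideriv c d (\<lambda>t. y2 t + z2 t) x"
    using W21_onD(3)[OF y x] W21_onD(3)[OF z x] by (simp add: antideriv_add[OF ints(1,2)])
qed

lemma W21_on_cong_AE:
  assumes y: "W21_on c d y y1 y2" and ae: "AE t in lebesgue_on {c..d}. y2 t = y2' t"
    and i: "integrable (lebesgue_on {c..d}) y2'"
  shows "W21_on c d y y1 y2'"
  unfolding W21_on_def
proof (intro conjI ballI)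
  fix x assume x: "x \<in> {c..d}"
  show "y x = y c + antideriv c d y1 x" by (rule W21_onD(2)[OF y x])
  show "y1 x = y1 c + antideriv c d y2' x"
    using W21_onD(3)[OF y x] antideriv_AE_cong[OF ae W21_onD(1)[OF y] i] by simp
qed (rule i)

text \<open>
  Dominated convergence: the truncations tend to zero pointwise and are dominated by the norm of \<open>V\<close>.
\<close>

lemma potential_splitting:
  fixes V :: "real \<Rightarrow> 'b::real_normed_vector"
  assumes V: "integrable M (\<lambda>t. norm (V t))" and e: "e > 0"
  obtains n :: nat where "(LINT t|M. norm (if norm (V t) > real n then V t else 0)) \<le> e"
proof -
  have [measurable]: "(\<lambda>t. norm (V t)) \<in> borel_measurable M" using V by simp
  have eq: "norm (if norm (V t) > real n then V t else 0) = (if norm (V t) > real n then norm (V t) else 0)" for n t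
    by simp
  have "(\<lambda>n. LINT t|M. norm (if norm (V t) > real n then V t else 0)) \<longlonglongrightarrow> (LINT t|M. 0)"
    unfolding eq
  proof (rule integral_dominated_convergence[OF _ _ V])
    show "AE t in M. (\<lambda>n. if norm (V t) > real n then norm (V t) else 0) \<longlonglongrightarrow> 0"
    proof (rule AE_I2)
      fix t
      obtain N where "norm (V t) \<le> real N" using real_arch_simple by blast
      then have "\<forall>\<^sub>F n in sequentially. (if norm (V t) > real n then norm (V t) else 0) = 0"
        by (auto simp: eventually_sequentially intro!: exI[of _ N])
      then show "(\<lambda>n. if norm (V t) > real n then norm (V t) else 0) \<longlonglongrightarrow> 0"
        by (rule tendsto_eventually)
    qed
  qed auto
  then have "\<forall>\<^sub>F n in sequentially. (LINT t|M. norm (if norm (V t) > real n then V t else 0)) < e"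
    using e order_tendstoD(2) by fastforce
  then show thesis using that by (auto simp: eventually_sequentially intro: less_imp_le)
qed

context bounded_interval
begin

abbreviation sq where "sq \<equiv> sq_integrable {c..d}"
abbreviation ip where "ip \<equiv> fun_inner {c..d}"

lemma cinner_integrable:
  fixes p q :: "real \<Rightarrow> 'h::{complex_hilbert, second_countable_topology}"
  shows "integrable M p \<Longrightarrow> continuous_on {c..d} q \<Longrightarrow> integrable M (\<lambda>t. cinner (p t) (q t))"
    "continuous_on {c..d} p \<Longrightarrow> integrable M q \<Longrightarrow> integrable M (\<lambda>t. cinner (p t) (q t))"
proof -
  assume p: "integrable M p" and q: "continuous_on {c..d} q"
  obtain C where "\<forall>x\<in>{c..d}. norm (q x) \<le> C" using continuous_on_Icc_measurable_bounded(2)[OF q] by blast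
  then show "integrable M (\<lambda>t. cinner (p t) (q t))"
    by (intro integrable_bilinear_bounded[OF bounded_bilinear.flip[OF bounded_bilinear_cinner]
          continuous_on_Icc_measurable_bounded(1)[OF q] _ p, where C = C]) auto
next
  assume q: "integrable M q" and p: "continuous_on {c..d} p"
  obtain C where "\<forall>x\<in>{c..d}. norm (p x) \<le> C" using continuous_on_Icc_measurable_bounded(2)[OF p] by blast
  then show "integrable M (\<lambda>t. cinner (p t) (q t))"
    by (intro integrable_bilinear_bounded[OF bounded_bilinear_cinner
          continuous_on_Icc_measurable_bounded(1)[OF p] _ q, where C = C]) auto
qed

lemma ip_symmetric_operator:
  fixes T :: "real \<Rightarrow> ('h::{complex_hilbert, second_countable_topology} \<Rightarrow>\<^sub>L 'h)"
  assumes sym: "AE t in M. is_adjoint_of (T t) (T t)"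
    and T: "\<And>h. (\<lambda>t. T t h) \<in> borel_measurable M"
    and f: "f \<in> borel_measurable M" and g: "g \<in> borel_measurable M"
  shows "ip f (\<lambda>t. T t (g t)) = ip (\<lambda>t. T t (f t)) g"
  unfolding fun_inner_def
proof (rule integral_cong_AE)
  show "AE t in M. cinner (f t) (T t (g t)) = cinner (T t (f t)) (g t)"
    using sym by eventually_elim (simp add: is_adjoint_of_def)
  note apply_meas = borel_measurable_blinfun_apply_pointwise[OF T]
  show "(\<lambda>t. cinner (f t) (T t (g t))) \<in> borel_measurable M"
    by (rule borel_measurable_cinner[OF f apply_meas[OF g]])
  show "(\<lambda>t. cinner (T t (f t)) (g t)) \<in> borel_measurable M"
    by (rule borel_measurable_cinner[OF apply_meas[OF f] g])
qed

text \<open>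
  The local regularity result.  The potential is split into a part \<open>W\<close> with small integral and a
  bounded part \<open>Vb\<close>; each square integrable \<open>f\<close> gives rise to a test function \<open>F\<close> by solving
  \<open>F = K (f - W F)\<close>, and solving the transposed equation for \<open>z\<close> identifies \<open>G\<close> with the Sobolev
  function \<open>A + z\<close>, where \<open>A\<close> is affine.
\<close>

lemma weak_solution_regular:
  fixes V :: "real \<Rightarrow> ('h::{complex_hilbert, second_countable_topology} \<Rightarrow>\<^sub>L 'h)"
  assumes J: "{c..d} \<subseteq> J" "J \<in> sets lebesgue"
    and V: "admissible_potential c d V"
    and sym: "AE t in M. is_adjoint_of (V t) (V t)"
    and G: "G \<in> sq_integrable J" "G' \<in> sq_integrable J"
    and weak: "\<And>f f1 f2. W21_loc_derivs J f f1 f2 \<Longrightarrow> (\<And>x. x \<notin> {c..d} \<Longrightarrow> f x = 0) \<Longrightarrow>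
      f \<in> sq_integrable J \<Longrightarrow> schroedinger V f f2 \<in> sq_integrable J \<Longrightarrow>
      fun_inner J G (schroedinger V f f2) = fun_inner J G' f"
  obtains u u1 where "W21_on c d u u1 (\<lambda>t. V t (u t) - G' t)" "AE t in M. G t = u t"
proof -
  have VM: "\<And>h. (\<lambda>t. V t h) \<in> borel_measurable M" and nV: "integrable M (\<lambda>t. norm (V t))"
    using V by (auto simp: admissible_potential_def)
  have [measurable]: "(\<lambda>t. norm (V t)) \<in> borel_measurable M" using nV by simp
  have Gsq: "G \<in> sq" "G' \<in> sq"
    using G J by (auto intro: sq_integrable_subset)
  have Gint: "integrable M G" "integrable M G'" using Gsq by (auto intro: sq_integrable_Icc_integrable)
  obtain C where C: "C > 0" "\<And>x t. x \<in> {c..d} \<Longrightarrow> t \<in> {c..d} \<Longrightarrow> \<bar>test_kernel x t\<bar> \<le> C"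
    by (rule test_kernel_bounded) blast
  obtain n :: nat where n: "(LINT t|M. norm (if norm (V t) > real n then V t else 0)) \<le> 1 / (2 * C)"
    using potential_splitting[OF nV, of "1 / (2 * C)"] C by auto
  define W where "W t = (if norm (V t) > real n then V t else 0)" for t
  define Vb where "Vb t = (if norm (V t) > real n then 0 else V t)" for t
  have Vsplit: "V t h = W t h + Vb t h" for t h by (simp add: W_def Vb_def)
  have WM: "(\<lambda>t. W t h) \<in> borel_measurable M" for h
  proof -
    have "(\<lambda>t. W t h) = (\<lambda>t. if norm (V t) > real n then V t h else 0)" by (auto simp: W_def)
    then show ?thesis using VM by simp
  qed
  have VbM: "(\<lambda>t. Vb t h) \<in> borel_measurable M" for h
  proof -
    have "(\<lambda>t. Vb t h) = (\<lambda>t. if norm (V t) > real n then 0 else V t h)" by (auto simp: Vb_def)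
    then show ?thesis using VM by simp
  qed
  have nVb: "norm (Vb t) \<le> real n" for t by (simp add: Vb_def)
  have W: "admissible_potential c d W"
  proof -
    have "integrable M (\<lambda>t. norm (W t))"
    proof (rule Bochner_Integration.integrable_bound[OF nV])
      have "(\<lambda>t. norm (W t)) = (\<lambda>t. if norm (V t) > real n then norm (V t) else 0)" by (auto simp: W_def)
      then show "(\<lambda>t. norm (W t)) \<in> borel_measurable M" by simp
    qed (simp add: W_def)
    then show ?thesis using WM by (simp add: admissible_potential_def)
  qed
  have small: "C * (LINT t|M. norm (W t)) \<le> 1 / 2"
    using mult_left_mono[OF n, of C] C(1) by (simp add: W_def)
  have symW: "AE t in M. is_adjoint_of (W t) (W t)" and symVb: "AE t in M. is_adjoint_of (Vb t) (Vb t)"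
    using sym by (auto elim!: eventually_mono simp: W_def Vb_def is_adjoint_of_def)
  \<comment> \<open>the correction of the test functions acts on \<open>G\<close> through this affine function\<close>
  define A where "A = affine_part_adj G"
  obtain a1 where A: "W21_on c d A a1 (\<lambda>t. 0)" unfolding A_def by (rule affine_part_adj_W21_on)
  have cA: "continuous_on {c..d} A" by (rule W21_on_continuous(2)[OF A])
  have VbG: "(\<lambda>t. Vb t (G t)) \<in> sq" by (rule bounded_operator_sq_integrable[OF VbM nVb Gsq(1)])
  have iVbG: "integrable M (\<lambda>t. Vb t (G t))" by (rule sq_integrable_Icc_integrable[OF VbG])
  have iWA: "integrable M (\<lambda>t. W t (A t))" by (rule admissible_potential_continuous[OF W cA])
  define g where "g t = G' t - Vb t (G t) - W t (A t)" for t
  have ig: "integrable M g" unfolding g_def using Gint iVbG iWA by simp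
  have seqcont: "(\<lambda>n. h (X n)) \<longlonglongrightarrow> h x"
    if "continuous_on {c..d} h" "x \<in> {c..d}" "\<And>n. X n \<in> {c..d}" "X \<longlonglongrightarrow> x" for h :: "real \<Rightarrow> real" and X x
    using that by (auto simp: continuous_on_sequentially comp_def)
  obtain z where cz: "continuous_on {c..d} z"
    and z: "\<And>x. x \<in> {c..d} \<Longrightarrow> z x = (LINT t|M. test_kernel t x *\<^sub>R (g t - W t (z t)))"
  proof (rule kernel_equation_solution[OF _ W ig, of "\<lambda>x t. test_kernel t x" C])
    show "(\<lambda>t. test_kernel t x) \<in> borel_measurable M" if "x \<in> {c..d}" for x
      by (rule continuous_on_Icc_measurable_bounded(1)[OF test_kernel_continuous(1)[OF that]])
    show "(\<lambda>n. test_kernel t (X n)) \<longlonglongrightarrow> test_kernel t x" if "x \<in> {c..d}" "\<And>n. X n \<in> {c..d}" "X \<longlonglongrightarrow> x" "t \<in> {c..d}" for x X t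
      using seqcont[OF test_kernel_continuous(2)] that by blast
  qed (use cd small C(2) in auto)
  \<comment> \<open>the source of which \<open>z\<close> is the transposed potential\<close>
  define p where "p t = g t - W t (z t)" for t
  have iWz: "integrable M (\<lambda>t. W t (z t))" by (rule admissible_potential_continuous[OF W cz])
  have ip: "integrable M p" unfolding p_def using ig iWz by simp
  obtain z1 where z1: "W21_on c d z z1 (\<lambda>t. - p t)"
    using transposed_kernel_W21_on[OF ip, of z] z unfolding p_def by blast
  have key: "ip G f - ip A f = ip z f" if f: "f \<in> sq" for f
  proof -
    have if': "integrable M f" by (rule sq_integrable_Icc_integrable[OF f])
    obtain F where cF: "continuous_on {c..d} F"
      and F: "\<And>x. x \<in> {c..d} \<Longrightarrow> F x = (LINT t|M. test_kernel x t *\<^sub>R (f t - W t (F t)))"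
    proof (rule kernel_equation_solution[OF _ W if', of "test_kernel" C])
      show "test_kernel x \<in> borel_measurable M" if "x \<in> {c..d}" for x
        by (rule continuous_on_Icc_measurable_bounded(1)[OF test_kernel_continuous(2)[OF that]])
      show "(\<lambda>n. test_kernel (X n) t) \<longlonglongrightarrow> test_kernel x t" if "x \<in> {c..d}" "\<And>n. X n \<in> {c..d}" "X \<longlonglongrightarrow> x" "t \<in> {c..d}" for x X t
        using seqcont[OF test_kernel_continuous(1)] that by blast
    qed (use cd small C(2) in auto)
    have iWF: "integrable M (\<lambda>t. W t (F t))" by (rule admissible_potential_continuous[OF W cF])
    define q where "q t = f t - W t (F t)" for t
    have iq: "integrable M q" unfolding q_def using if' iWF by simp
    define y2 where "y2 = (\<lambda>t. if t \<in> {c..d} then affine_part q t - q t else 0)"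
    define y1 where "y1 = antideriv c d y2"
    define y where "y = antideriv c d y1"
    have yW: "W21_loc_derivs J y y1 y2" and y0: "\<And>x. x \<notin> {c..d} \<Longrightarrow> y x = 0"
      and y: "\<And>x. x \<in> {c..d} \<Longrightarrow> y x = F x"
      using corrected_test_function(1)[OF iq, of J] corrected_test_function(2,3)[OF iq] F
      unfolding y2_def[symmetric] y1_def[symmetric] y_def[symmetric] by (auto simp: q_def)
    define s where "s t = f t - affine_part q t + Vb t (F t)" for t
    have Fsq: "F \<in> sq" by (rule sq_integrable_continuous[OF cF])
    have csq: "affine_part q \<in> sq" by (rule sq_integrable_continuous[OF continuous_affine_part])
    have VbF: "(\<lambda>t. Vb t (F t)) \<in> sq" by (rule bounded_operator_sq_integrable[OF VbM nVb Fsq])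
    have fc: "(\<lambda>t. f t - affine_part q t) \<in> sq" by (rule sq_integrable_diff[OF f csq])
    have ssq: "s \<in> sq" unfolding s_def by (rule sq_integrable_add[OF fc VbF])
    have tau: "schroedinger V y y2 t = (if t \<in> {c..d} then s t else 0)" for t
      using y[of t] y0[of t] by (auto simp: schroedinger_def y2_def s_def q_def Vsplit)
    have ip_cong: "ip h k' = ip h k" if "\<And>t. t \<in> {c..d} \<Longrightarrow> k' t = k t" for h k k' :: "real \<Rightarrow> 'h"
      unfolding fun_inner_def by (rule Bochner_Integration.integral_cong[OF refl]) (simp add: that)
    have "fun_inner J G (schroedinger V y y2) = fun_inner J G' y"
    proof (rule weak[OF yW y0])
      show "y \<in> sq_integrable J"
        by (rule sq_integrable_ext_zero[OF sq_integrable_cong[OF Fsq y] y0 J(1) _ J(2)]) auto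
      show "schroedinger V y y2 \<in> sq_integrable J"
        by (rule sq_integrable_ext_zero[OF sq_integrable_cong[OF ssq] _ J(1) _ J(2)]) (auto simp: tau)
    qed
    moreover have "fun_inner J G (schroedinger V y y2) = ip G (schroedinger V y y2)"
      by (rule fun_inner_ext_zero[OF _ J(1) _ J(2)]) (auto simp: tau)
    moreover have "ip G (schroedinger V y y2) = ip G s" by (rule ip_cong) (simp add: tau)
    moreover have "fun_inner J G' y = ip G' y"
      by (rule fun_inner_ext_zero[OF _ J(1) _ J(2)]) (auto simp: y0)
    moreover have "ip G' y = ip G' F" by (rule ip_cong) (simp add: y)
    ultimately have main: "ip G s = ip G' F" by simp
    have "ip G s = ip G f - ip G (affine_part q) + ip G (\<lambda>t. Vb t (F t))"
      unfolding s_def using fun_inner_simps(3)[OF fc VbF Gsq(1)] fun_inner_simps(4)[OF f csq Gsq(1)] by simp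
    moreover have "ip G (\<lambda>t. Vb t (F t)) = ip (\<lambda>t. Vb t (G t)) F"
      by (rule ip_symmetric_operator[OF symVb VbM]) (use Gint(1) Fsq in \<open>auto simp: sq_integrable_def\<close>)
    moreover have "ip G (affine_part q) = ip A q"
      unfolding fun_inner_def A_def by (rule affine_part_duality[OF Gint(1) iq])
    moreover have "ip A q = ip A f - ip A (\<lambda>t. W t (F t))"
      unfolding fun_inner_def q_def cinner_diff_right
      by (intro Bochner_Integration.integral_diff cinner_integrable(2)[OF cA] if' iWF)
    moreover have "ip A (\<lambda>t. W t (F t)) = ip (\<lambda>t. W t (A t)) F"
      by (rule ip_symmetric_operator[OF symW WM])
        (intro continuous_on_Icc_measurable_bounded(1) cA cF)+
    moreover have "ip g F = ip G' F - ip (\<lambda>t. Vb t (G t)) F - ip (\<lambda>t. W t (A t)) F"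
    proof -
      have "ip g F = (LINT t|M. cinner (G' t) (F t) - cinner (Vb t (G t)) (F t) - cinner (W t (A t)) (F t))"
        unfolding fun_inner_def g_def cinner_diff_left ..
      also have "\<dots> = ip G' F - ip (\<lambda>t. Vb t (G t)) F - ip (\<lambda>t. W t (A t)) F"
        unfolding fun_inner_def
        using cinner_integrable(1)[OF Gint(2) cF] cinner_integrable(1)[OF iVbG cF] cinner_integrable(1)[OF iWA cF]
        by simp
      finally show ?thesis .
    qed
    moreover have "ip g F = ip p F + ip (\<lambda>t. W t (z t)) F"
    proof -
      have "ip g F = (LINT t|M. cinner (p t) (F t) + cinner (W t (z t)) (F t))"
        unfolding fun_inner_def p_def cinner_diff_left by simp
      also have "\<dots> = ip p F + ip (\<lambda>t. W t (z t)) F"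
        unfolding fun_inner_def
        by (intro Bochner_Integration.integral_add cinner_integrable(1)[OF ip cF] cinner_integrable(1)[OF iWz cF])
      finally show ?thesis .
    qed
    moreover have "ip p F = ip z q"
    proof -
      have "ip p F = (LINT s|M. cinner (p s) (LINT t|M. test_kernel s t *\<^sub>R q t))"
        unfolding fun_inner_def
        by (rule Bochner_Integration.integral_cong[OF refl]) (simp add: F[folded q_def])
      also have "\<dots> = (LINT t|M. cinner (LINT s|M. test_kernel s t *\<^sub>R p s) (q t))"
        by (rule test_kernel_duality[OF ip iq, symmetric])
      also have "\<dots> = ip z q"
        unfolding fun_inner_def
        by (rule Bochner_Integration.integral_cong[OF refl]) (simp add: z[folded p_def])
      finally show ?thesis .
    qed
    moreover have "ip z q = ip z f - ip z (\<lambda>t. W t (F t))"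
      unfolding fun_inner_def q_def cinner_diff_right
      by (intro Bochner_Integration.integral_diff cinner_integrable(2)[OF cz] if' iWF)
    moreover have "ip z (\<lambda>t. W t (F t)) = ip (\<lambda>t. W t (z t)) F"
      by (rule ip_symmetric_operator[OF symW WM])
        (intro continuous_on_Icc_measurable_bounded(1) cz cF)+
    ultimately show ?thesis using main by simp
  qed
  define u where "u t = A t + z t" for t
  have Asq: "A \<in> sq" "z \<in> sq" by (intro sq_integrable_continuous cA cz)+
  have GA: "(\<lambda>t. G t - A t) \<in> sq" by (rule sq_integrable_diff[OF Gsq(1) Asq(1)])
  \<comment> \<open>the identity for all \<open>f\<close> is applied to the difference itself\<close>
  let ?r = "\<lambda>t. G t - A t - z t"
  have r: "?r \<in> sq" by (rule sq_integrable_diff[OF GA Asq(2)])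
  have "ip ?r ?r = ip G ?r - ip A ?r - ip z ?r"
    using fun_inner_simps(2)[OF GA Asq(2) r] fun_inner_simps(2)[OF Gsq(1) Asq(1) r] by simp
  then have "ip ?r ?r = 0" using key[OF r] by simp
  then have "L2_norm_sq {c..d} ?r = 0" by (simp add: fun_inner_self)
  from L2_norm_sq_eq_0[OF r this] have ae: "AE t in M. G t = u t"
    by eventually_elim (simp add: u_def algebra_simps)
  have cu: "continuous_on {c..d} u" unfolding u_def by (intro continuous_intros cA cz)
  have "W21_on c d u (\<lambda>t. a1 t + z1 t) (\<lambda>t. 0 + - p t)"
    unfolding u_def by (rule W21_on_add[OF A z1])
  then have "W21_on c d u (\<lambda>t. a1 t + z1 t) (\<lambda>t. V t (u t) - G' t)"
  proof (rule W21_on_cong_AE)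
    show "AE t in M. 0 + - p t = V t (u t) - G' t"
      using ae by eventually_elim
        (simp add: p_def g_def Vsplit u_def blinfun.add_right)
    show "integrable M (\<lambda>t. V t (u t) - G' t)"
      using admissible_potential_continuous[OF V cu] Gint by simp
  qed
  from that[OF this ae] show thesis .
qed

end

section \<open>Uniqueness of Sobolev derivatives\<close>

lemma AE_lebesgue_on_subset:
  assumes "AE t in lebesgue_on J. P t" "I \<subseteq> J" "I \<in> sets lebesgue" "J \<in> sets lebesgue"
  shows "AE t in lebesgue_on I. P t"
proof -
  have "AE t in lebesgue. t \<in> J \<longrightarrow> P t" using assms by (simp add: AE_restrict_space_iff)
  then have "AE t in lebesgue. t \<in> I \<longrightarrow> P t" by eventually_elim (use assms(2) in auto)
  then show ?thesis using assms by (simp add: AE_restrict_space_iff)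
qed

lemma AE_zero_imp_zero_Icc:
  fixes f :: "real \<Rightarrow> 'b::{banach, second_countable_topology}"
  assumes f: "continuous_on {c..d} f" and ae: "AE t in lebesgue_on {c..d}. f t = 0" and cd: "c < d"
    and x: "x \<in> {c..d}"
  shows "f x = 0"
proof -
  let ?C = "{t \<in> {c..d}. f t = 0}"
  have C: "closed ?C" using f by (intro continuous_closed_preimage_constant) auto
  have "AE t in lebesgue. t \<in> {c..d} \<longrightarrow> f t = 0" using ae by (simp add: AE_restrict_space_iff)
  then have "AE t in lebesgue. t \<in> {c<..<d} \<longrightarrow> t \<in> ?C" by eventually_elim auto
  then have "{c<..<d} \<subseteq> ?C"
    using mem_closed_if_AE_lebesgue_open[OF open_greaterThanLessThan C] by blast
  then have "closure {c<..<d} \<subseteq> ?C" using C by (rule closure_minimal)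
  then show ?thesis using x cd by auto
qed

lemma antideriv_restrict:
  fixes p :: "real \<Rightarrow> 'b::{banach, second_countable_topology}"
  assumes p: "integrable (lebesgue_on {c..d}) p" and sub: "c \<le> c'" "d' \<le> d" and x: "x \<in> {c'..d'}"
  shows "integrable (lebesgue_on {c'..d'}) p" "antideriv c' d' p x = antideriv c d p x - antideriv c d p c'"
proof -
  have "integrable lebesgue (\<lambda>t. indicator {c'..d'} t *\<^sub>R (indicator {c..d} t *\<^sub>R p t))"
    using p by (intro integrable_mult_indicator[of "{c'..d'}"]) (simp_all add: integrable_restrict_space)
  moreover have "indicator {c'..d'} t *\<^sub>R (indicator {c..d} t *\<^sub>R p t) = indicator {c'..d'} t *\<^sub>R p t" for t
    using sub by (auto simp: indicator_def)
  ultimately have "integrable lebesgue (\<lambda>t. indicator {c'..d'} t *\<^sub>R p t)" by (simp only:)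
  then show p': "integrable (lebesgue_on {c'..d'}) p" by (simp add: integrable_restrict_space)
  have "antideriv c' d' p x = (LINT t=ereal c'..ereal x|lebesgue. p t)"
    using interval_integral_eq_antideriv[OF p', of c' x] x by simp
  also have "\<dots> = antideriv c d p x - antideriv c d p c'"
    using sub x by (intro interval_integral_eq_antideriv[OF p]) auto
  finally show "antideriv c' d' p x = antideriv c d p x - antideriv c d p c'" .
qed

lemma W21_on_restrict:
  assumes y: "W21_on c d y y1 y2" and sub: "c \<le> c'" "c' \<le> d'" "d' \<le> d"
  shows "W21_on c' d' y y1 y2"
  unfolding W21_on_def
proof (intro conjI ballI)
  have "c' \<in> {c'..d'}" using sub by simp
  then show "integrable (lebesgue_on {c'..d'}) y2" using antideriv_restrict(1)[OF W21_onD(1)[OF y] sub(1,3)] by blast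
  fix x assume x: "x \<in> {c'..d'}"
  have m: "x \<in> {c..d}" "c' \<in> {c..d}" using x sub by auto
  show "y x = y c' + antideriv c' d' y1 x"
    using W21_onD(2)[OF y m(1)] W21_onD(2)[OF y m(2)]
    by (simp add: antideriv_restrict(2)[OF W21_on_continuous(3)[OF y] sub(1,3) x])
  show "y1 x = y1 c' + antideriv c' d' y2 x"
    using W21_onD(3)[OF y m(1)] W21_onD(3)[OF y m(2)]
    by (simp add: antideriv_restrict(2)[OF W21_onD(1)[OF y] sub(1,3) x])
qed

text \<open>
  Continuous functions that agree almost everywhere agree everywhere, and a function is determined
  by its antiderivative almost everywhere; this is applied once for each derivative.
\<close>

lemma W21_on_unique:
  assumes u: "W21_on c d u u1 u2" and v: "W21_on c d v v1 v2" and cd: "c < d"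
    and ae: "AE t in lebesgue_on {c..d}. u t = v t"
  shows "\<And>x. x \<in> {c..d} \<Longrightarrow> u x = v x" "\<And>x. x \<in> {c..d} \<Longrightarrow> u1 x = v1 x"
    "AE t in lebesgue_on {c..d}. u2 t = v2 t"
proof -
  note cu = W21_on_continuous[OF u] and cv = W21_on_continuous[OF v]
  have "c \<in> {c..d}" using cd by simp
  have diff: "AE t in lebesgue_on {c..d}. p t = q t"
    if "integrable (lebesgue_on {c..d}) p" "integrable (lebesgue_on {c..d}) q"
      "\<And>x. x \<in> {c..d} \<Longrightarrow> antideriv c d p x = antideriv c d q x" for p q :: "real \<Rightarrow> 'a"
  proof -
    have "AE t in lebesgue_on {c..d}. p t - q t = 0"
      by (rule antideriv_zero_imp_AE_zero) (use that cd in \<open>auto simp: antideriv_diff\<close>)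
    then show ?thesis by eventually_elim simp
  qed
  show eq: "u x = v x" if "x \<in> {c..d}" for x
  proof -
    have "AE t in lebesgue_on {c..d}. u t - v t = 0" using ae by eventually_elim simp
    from AE_zero_imp_zero_Icc[OF _ this cd that] show ?thesis
      using continuous_on_diff[OF cu(2) cv(2)] by simp
  qed
  have "AE t in lebesgue_on {c..d}. u1 t = v1 t"
  proof (rule diff[OF cu(3) cv(3)])
    fix x assume x: "x \<in> {c..d}"
    show "antideriv c d u1 x = antideriv c d v1 x"
      using W21_onD(2)[OF u x] W21_onD(2)[OF v x] eq[OF x] eq[OF \<open>c \<in> {c..d}\<close>] by simp
  qed
  then have ae1: "AE t in lebesgue_on {c..d}. u1 t - v1 t = 0" by eventually_elim simp
  show eq1: "u1 x = v1 x" if "x \<in> {c..d}" for x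
    using AE_zero_imp_zero_Icc[OF _ ae1 cd that] continuous_on_diff[OF cu(1) cv(1)] by simp
  show "AE t in lebesgue_on {c..d}. u2 t = v2 t"
  proof (rule diff[OF W21_onD(1)[OF u] W21_onD(1)[OF v]])
    fix x assume x: "x \<in> {c..d}"
    show "antideriv c d u2 x = antideriv c d v2 x"
      using W21_onD(3)[OF u x] W21_onD(3)[OF v x] eq1[OF x] eq1[OF \<open>c \<in> {c..d}\<close>] by simp
  qed
qed

lemma W21_on_cong:
  assumes y: "W21_on c d y y1 y2" and cd: "c \<le> d"
    and eq: "\<And>x. x \<in> {c..d} \<Longrightarrow> z x = y x" "\<And>x. x \<in> {c..d} \<Longrightarrow> z1 x = y1 x" "\<And>x. x \<in> {c..d} \<Longrightarrow> z2 x = y2 x"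
  shows "W21_on c d z z1 z2"
proof -
  have pr: "antideriv c d z1 x = antideriv c d y1 x" "antideriv c d z2 x = antideriv c d y2 x" for x
    unfolding antideriv_def by (rule Bochner_Integration.integral_cong[OF refl], simp add: eq)+
  have "integrable (lebesgue_on {c..d}) z2 \<longleftrightarrow> integrable (lebesgue_on {c..d}) y2"
    by (rule Bochner_Integration.integrable_cong[OF refl]) (simp add: eq)
  moreover have "z c = y c" "z1 c = y1 c" using eq cd by auto
  ultimately show ?thesis
    using W21_onD[OF y] unfolding W21_on_def pr by (auto simp only: eq)
qed

lemma W21_on_zero: "W21_on c d (\<lambda>x. 0) (\<lambda>x. 0) (\<lambda>x. 0)"
  by (simp add: W21_on_def antideriv_def)

section \<open>Sobolev functions on open intervals\<close>

locale open_interval =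
  fixes J :: "real set"
  assumes open_J: "open J" and interval_J: "is_interval J" and J_nonempty: "J \<noteq> {}"
begin

lemma Icc_subset: "c \<in> J \<Longrightarrow> d \<in> J \<Longrightarrow> {c..d} \<subseteq> J"
  using interval_J unfolding is_interval_1 atLeastAtMost_iff subset_iff by blast

lemma J_sets: "J \<in> sets lebesgue"
  using open_J by (simp add: borel_open sets_completionI_sets)

lemma ex_less: "x \<in> J \<Longrightarrow> \<exists>y\<in>J. y < x" and ex_greater: "x \<in> J \<Longrightarrow> \<exists>y\<in>J. x < y"
proof -
  assume "x \<in> J"
  then obtain e where e: "e > 0" "ball x e \<subseteq> J" using open_J openE by blast
  then have "x - e / 2 \<in> J" "x + e / 2 \<in> J" by (auto simp: dist_norm subset_eq)
  then show "\<exists>y\<in>J. y < x" "\<exists>y\<in>J. x < y" using e by force+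
qed

lemma compact_subset_Icc:
  assumes "compact K" "K \<subseteq> J"
  obtains c d where "c \<in> J" "d \<in> J" "c < d" "K \<subseteq> {c..d}"
proof (cases "K = {}")
  case True
  obtain x where "x \<in> J" using J_nonempty by blast
  then show thesis using ex_less[of x] that True by blast
next
  case False
  obtain s where s: "s \<in> K" "\<And>t. t \<in> K \<Longrightarrow> s \<le> t" using compact_attains_inf[OF assms(1) False] by blast
  obtain r where r: "r \<in> K" "\<And>t. t \<in> K \<Longrightarrow> t \<le> r" using compact_attains_sup[OF assms(1) False] by blast
  obtain d where "d \<in> J" "r < d" using ex_greater[of r] r assms(2) by blast
  moreover have "s \<in> J" using s assms(2) by blast
  moreover have "s \<le> r" using s r by blast
  ultimately show thesis using that[of s d] s r by force
qed

text \<open>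
  The open interval is covered by its countably many compact subintervals with rational end points.
\<close>

lemma AE_on_J:
  assumes "\<And>c d. c \<in> J \<Longrightarrow> d \<in> J \<Longrightarrow> c < d \<Longrightarrow> AE t in lebesgue_on {c..d}. P t"
  shows "AE t in lebesgue_on J. P t"
proof -
  let ?X = "{(c, d). c \<in> J \<inter> \<rat> \<and> d \<in> J \<inter> \<rat> \<and> c < d}"
  have X: "countable ?X"
    by (rule countable_subset[of _ "\<rat> \<times> \<rat>"]) (auto simp: countable_rat)
  have "\<forall>(c, d)\<in>?X. AE t in lebesgue. t \<in> {c..d} \<longrightarrow> P t"
    using assms by (auto simp: AE_restrict_space_iff)
  then have "AE t in lebesgue. \<forall>(c, d)\<in>?X. t \<in> {c..d} \<longrightarrow> P t"
    using AE_ball_countable[OF X, where M = lebesgue and P = "\<lambda>t (c, d). t \<in> {c..d} \<longrightarrow> P t"]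
    by (simp add: case_prod_beta)
  then have "AE t in lebesgue. t \<in> J \<longrightarrow> P t"
  proof eventually_elim
    case (elim t)
    show ?case
    proof
      assume t: "t \<in> J"
      obtain y z where yz: "y \<in> J" "y < t" "z \<in> J" "t < z" using ex_less[OF t] ex_greater[OF t] by blast
      obtain c where c: "c \<in> \<rat>" "y < c" "c < t" using Rats_dense_in_real[OF yz(2)] by blast
      obtain d where d: "d \<in> \<rat>" "t < d" "d < z" using Rats_dense_in_real[OF yz(4)] by blast
      have "c \<in> J" "d \<in> J" using Icc_subset[OF yz(1) t] Icc_subset[OF t yz(3)] c d by force+
      then have "(c, d) \<in> ?X" using c d by auto
      then show "P t" using elim c d by fastforce
    qed
  qed
  then show ?thesis using J_sets by (simp add: AE_restrict_space_iff)
qed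

lemma L1_loc_integrable:
  assumes "f \<in> L1_loc J" "c \<in> J" "d \<in> J"
  shows "integrable (lebesgue_on {c..d}) f"
  using assms Icc_subset[OF assms(2,3)]
  by (auto simp: L1_loc_def set_integrable_def integrable_restrict_space)

lemma L1_locI:
  assumes "\<And>c d. c \<in> J \<Longrightarrow> d \<in> J \<Longrightarrow> c < d \<Longrightarrow> integrable (lebesgue_on {c..d}) f"
  shows "f \<in> L1_loc J"
  unfolding L1_loc_def set_integrable_def
proof (intro CollectI allI impI)
  fix K assume K: "compact K \<and> K \<subseteq> J"
  then obtain c d where cd: "c \<in> J" "d \<in> J" "c < d" "K \<subseteq> {c..d}" using compact_subset_Icc by blast
  have "integrable lebesgue (\<lambda>t. indicator K t *\<^sub>R (indicator {c..d} t *\<^sub>R f t))"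
    using assms[OF cd(1-3)] K
    by (intro integrable_mult_indicator[of K])
      (auto simp: integrable_restrict_space lmeasurable_compact fmeasurableD)
  moreover have "indicator K t *\<^sub>R (indicator {c..d} t *\<^sub>R f t) = indicator K t *\<^sub>R f t" for t
    using cd(4) by (auto simp: indicator_def)
  ultimately show "integrable lebesgue (\<lambda>t. indicator K t *\<^sub>R f t)" by (simp only:)
qed

lemma W21_loc_derivs_imp_on:
  assumes y: "W21_loc_derivs J y y1 y2" and c: "c \<in> J" and d: "d \<in> J"
  shows "W21_on c d y y1 y2"
  unfolding W21_on_def
proof (intro conjI ballI)
  have i: "integrable (lebesgue_on {c..d}) y1" "integrable (lebesgue_on {c..d}) y2"
    using y c d by (auto simp: W21_loc_derivs_def intro: L1_loc_integrable)
  then show "integrable (lebesgue_on {c..d}) y2" by simp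
  fix x assume x: "x \<in> {c..d}"
  then have "x \<in> J" "c \<in> {c..d}" using Icc_subset[OF c d] by auto
  then have "y x = y c + (LINT t=ereal c..ereal x|lebesgue. y1 t) \<and> y1 x = y1 c + (LINT t=ereal c..ereal x|lebesgue. y2 t)"
    using y c unfolding W21_loc_derivs_def by blast
  then show "y x = y c + antideriv c d y1 x" "y1 x = y1 c + antideriv c d y2 x"
    using interval_integral_eq_antideriv[OF i(1) \<open>c \<in> {c..d}\<close> x] interval_integral_eq_antideriv[OF i(2) \<open>c \<in> {c..d}\<close> x]
    by simp_all
qed

lemma W21_loc_derivsI:
  assumes y: "\<And>c d. c \<in> J \<Longrightarrow> d \<in> J \<Longrightarrow> c < d \<Longrightarrow> W21_on c d y y1 y2"
  shows "W21_loc_derivs J y y1 y2"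
  unfolding W21_loc_derivs_def
proof (intro conjI ballI)
  show "y1 \<in> L1_loc J" by (rule L1_locI) (rule W21_on_continuous(3)[OF y])
  show "y2 \<in> L1_loc J" by (rule L1_locI) (rule W21_onD(1)[OF y])
  fix x' x assume x: "x' \<in> J" "x \<in> J"
  have "compact {x', x}" "{x', x} \<subseteq> J" using x by auto
  then obtain c d where cd: "c \<in> J" "d \<in> J" "c < d" "{x', x} \<subseteq> {c..d}" by (rule compact_subset_Icc)
  note Y = y[OF cd(1-3)]
  have m: "x' \<in> {c..d}" "x \<in> {c..d}" using cd(4) by auto
  show "y x = y x' + (LINT t=ereal x'..ereal x|lebesgue. y1 t)"
    using interval_integral_eq_antideriv[OF W21_on_continuous(3)[OF Y] m] W21_onD(2)[OF Y m(1)] W21_onD(2)[OF Y m(2)]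
    by simp
  show "y1 x = y1 x' + (LINT t=ereal x'..ereal x|lebesgue. y2 t)"
    using interval_integral_eq_antideriv[OF W21_onD(1)[OF Y] m] W21_onD(3)[OF Y m(1)] W21_onD(3)[OF Y m(2)]
    by simp
qed

lemma W21_loc_unique:
  assumes u: "W21_loc_derivs J u u1 u2" and v: "W21_loc_derivs J v v1 v2"
    and ae: "AE t in lebesgue_on J. u t = v t"
  shows "\<And>x. x \<in> J \<Longrightarrow> u x = v x" "\<And>x. x \<in> J \<Longrightarrow> u1 x = v1 x" "AE t in lebesgue_on J. u2 t = v2 t"
proof -
  have ae': "AE t in lebesgue_on {c..d}. u t = v t" if "c \<in> J" "d \<in> J" for c d
    by (rule AE_lebesgue_on_subset[OF ae Icc_subset[OF that] _ J_sets]) simp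
  note uniq = W21_on_unique[OF W21_loc_derivs_imp_on[OF u] W21_loc_derivs_imp_on[OF v] _ ae']
  show "u x = v x" "u1 x = v1 x" if x: "x \<in> J" for x
  proof -
    obtain d where "d \<in> J" "x < d" using ex_greater[OF x] by blast
    then show "u x = v x" "u1 x = v1 x" using uniq(1,2)[of x d x] x by auto
  qed
  show "AE t in lebesgue_on J. u2 t = v2 t" by (rule AE_on_J) (rule uniq(3))
qed

text \<open>
  Solutions on compact subintervals are compatible: by uniqueness two of them are restrictions of the
  solution on a common larger interval.  The equation must be allowed to depend on the
  solution through \<open>Q\<close>, as the second derivative is \<open>V u - G'\<close> for the local representative \<open>u\<close>.
\<close>

lemma W21_loc_glue:
  fixes Q :: "real \<Rightarrow> 'b::{banach, second_countable_topology} \<Rightarrow> 'b"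
  assumes loc: "\<And>c d. c \<in> J \<Longrightarrow> d \<in> J \<Longrightarrow> c < d \<Longrightarrow>
      \<exists>u u1. W21_on c d u u1 (\<lambda>t. Q t (u t)) \<and> (AE t in lebesgue_on {c..d}. G t = u t)"
  obtains g g1 where "W21_loc_derivs J g g1 (\<lambda>t. Q t (g t))" "AE t in lebesgue_on J. G t = g t"
proof -
  obtain U U1 where U: "\<And>c d. c \<in> J \<Longrightarrow> d \<in> J \<Longrightarrow> c < d \<Longrightarrow> W21_on c d (U c d) (U1 c d) (\<lambda>t. Q t (U c d t))"
    and UG: "\<And>c d. c \<in> J \<Longrightarrow> d \<in> J \<Longrightarrow> c < d \<Longrightarrow> AE t in lebesgue_on {c..d}. G t = U c d t"
    using loc by metis
  have sub: "U c d x = U c' d' x \<and> U1 c d x = U1 c' d' x"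
    if c: "c \<in> J" "d \<in> J" "c < d" and c': "c' \<in> J" "d' \<in> J" "c' \<le> c" "d \<le> d'" and x: "x \<in> {c..d}" for c d c' d' x
  proof -
    have "c' < d'" using c c' by simp
    have W: "W21_on c d (U c' d') (U1 c' d') (\<lambda>t. Q t (U c' d' t))"
      by (rule W21_on_restrict[OF U[OF c'(1,2) \<open>c' < d'\<close>]]) (use c c' in auto)
    have "AE t in lebesgue_on {c..d}. G t = U c' d' t"
      by (rule AE_lebesgue_on_subset[OF UG[OF c'(1,2) \<open>c' < d'\<close>]]) (use c' in auto)
    with UG[OF c] have "AE t in lebesgue_on {c..d}. U c d t = U c' d' t" by eventually_elim simp
    from W21_on_unique(1,2)[OF U[OF c] W c(3) this] x show ?thesis by blast
  qed
  have consistent: "U c d x = U c' d' x \<and> U1 c d x = U1 c' d' x"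
    if "c \<in> J" "d \<in> J" "c < d" "c' \<in> J" "d' \<in> J" "c' < d'" "x \<in> {c..d}" "x \<in> {c'..d'}" for c d c' d' x
  proof -
    have m: "min c c' \<in> J" "max d d' \<in> J" using that by (auto simp: min_def max_def)
    show ?thesis
      using sub[OF that(1-3) m _ _ that(7)] sub[OF that(4-6) m _ _ that(8)] by auto
  qed
  obtain c0 d0 where c0: "c0 \<in> J" "d0 \<in> J" "c0 < d0" using J_nonempty ex_less by blast
  \<comment> \<open>some interval that contains \<open>x\<close> and has positive length\<close>
  define g where "g x = U (min c0 x) (max d0 x) x" for x
  define g1 where "g1 x = U1 (min c0 x) (max d0 x) x" for x
  have g: "g x = U c d x \<and> g1 x = U1 c d x" if "c \<in> J" "d \<in> J" "c < d" "x \<in> {c..d}" for c d x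
  proof -
    have "x \<in> J" using Icc_subset that by blast
    then have "min c0 x \<in> J" "max d0 x \<in> J" using c0 by (auto simp: min_def max_def)
    then show ?thesis
      unfolding g_def g1_def by (rule consistent) (use that c0 in auto)
  qed
  show thesis
  proof (rule that)
    show "W21_loc_derivs J g g1 (\<lambda>t. Q t (g t))"
    proof (rule W21_loc_derivsI)
      fix c d assume cd: "c \<in> J" "d \<in> J" "c < d"
      show "W21_on c d g g1 (\<lambda>t. Q t (g t))"
        by (rule W21_on_cong[OF U[OF cd]]) (use cd g[OF cd] in auto)
    qed
    show "AE t in lebesgue_on J. G t = g t"
    proof (rule AE_on_J)
      fix c d assume cd: "c \<in> J" "d \<in> J" "c < d"
      have "AE t in lebesgue_on {c..d}. t \<in> {c..d}" by (rule AE_I2) simp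
      with UG[OF cd] show "AE t in lebesgue_on {c..d}. G t = g t"
        by eventually_elim (use g[OF cd] in auto)
    qed
  qed
qed

lemma W21_loc_derivs_subset:
  assumes "W21_loc_derivs J y y1 y2" "I \<subseteq> J"
  shows "W21_loc_derivs I y y1 y2"
  using assms unfolding W21_loc_derivs_def L1_loc_def by blast

end

section \<open>Classes of square integrable functions and adjoints\<close>

lemma L2_class_in: "f \<in> sq_integrable J \<Longrightarrow> L2_class J f \<in> L2 J"
  unfolding L2_class_def L2_def by (rule quotientI)

lemma L2_class_eq_iff:
  "f \<in> sq_integrable J \<Longrightarrow> g \<in> sq_integrable J \<Longrightarrow>
    L2_class J f = L2_class J g \<longleftrightarrow> (AE x in lebesgue_on J. f x = g x)"
  using eq_equiv_class_iff[OF equiv_ae_rel, of f J g] by (simp add: L2_class_def ae_rel_def)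

lemma L2_class_cong:
  assumes "f \<in> sq_integrable J" "\<And>t. t \<in> J \<Longrightarrow> g t = f t"
  shows "L2_class J g = L2_class J f"
  using L2_class_eq_iff[OF sq_integrable_cong[OF assms] assms(1)] assms(2) by (auto intro!: AE_I2)

lemma mem_L2_class_iff: "f \<in> sq_integrable J \<Longrightarrow> h \<in> L2_class J f \<longleftrightarrow> h \<in> sq_integrable J \<and> (AE x in lebesgue_on J. f x = h x)"
  by (simp add: L2_class_def ae_rel_def)

lemma L2_cases:
  assumes "F \<in> L2 J"
  obtains f where "f \<in> sq_integrable J" "F = L2_class J f"
  using L2_rep_in[OF assms] by metis

text \<open>
  The operations on classes are defined through chosen representatives; this is the link between the
  chosen one and any other.
\<close>

lemma L2_rep_class:
  assumes f: "f \<in> sq_integrable J"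
  shows "L2_rep (L2_class J f) \<in> sq_integrable J" "AE x in lebesgue_on J. L2_rep (L2_class J f) x = f x"
proof -
  note r = L2_rep_in[OF L2_class_in[OF f]]
  show "L2_rep (L2_class J f) \<in> sq_integrable J" by (rule r(2))
  show "AE x in lebesgue_on J. L2_rep (L2_class J f) x = f x"
    using L2_class_eq_iff[OF r(2) f] r(3) by simp
qed

lemma L2_add_class:
  assumes f: "f \<in> sq_integrable J" and g: "g \<in> sq_integrable J"
  shows "L2_add J (L2_class J f) (L2_class J g) = L2_class J (\<lambda>x. f x + g x)"
proof -
  have "AE x in lebesgue_on J. L2_rep (L2_class J f) x + L2_rep (L2_class J g) x = f x + g x"
    using L2_rep_class(2)[OF f] L2_rep_class(2)[OF g] by eventually_elim simp
  then show ?thesis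
    unfolding L2_add_def
    by (subst L2_class_eq_iff) (auto intro!: sq_integrable_add L2_rep_class(1) f g)
qed

lemma L2_scale_class:
  assumes f: "f \<in> sq_integrable J"
  shows "L2_scale J c (L2_class J f) = L2_class J (\<lambda>x. c *\<^sub>C f x)"
proof -
  have "AE x in lebesgue_on J. c *\<^sub>C L2_rep (L2_class J f) x = c *\<^sub>C f x"
    using L2_rep_class(2)[OF f] by eventually_elim simp
  then show ?thesis
    unfolding L2_scale_def
    by (subst L2_class_eq_iff) (auto intro!: sq_integrable_scaleC L2_rep_class(1) f)
qed

lemma L2_inner_class:
  assumes f: "f \<in> sq_integrable J" and g: "g \<in> sq_integrable J"
  shows "L2_inner J (L2_class J f) (L2_class J g) = fun_inner J f g"
  unfolding L2_inner_def fun_inner_def[symmetric]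
  by (intro fun_inner_cong_AE L2_rep_class(2) sq_integrable_measurable L2_rep_class(1) f g)

lemma L2_dist_class:
  assumes f: "f \<in> sq_integrable J" and g: "g \<in> sq_integrable J"
  shows "L2_dist J (L2_class J f) (L2_class J g) = sqrt (L2_norm_sq J (\<lambda>x. f x - g x))"
proof -
  note [measurable] = sq_integrable_measurable[OF f] sq_integrable_measurable[OF g]
    sq_integrable_measurable[OF L2_rep_class(1)[OF f]] sq_integrable_measurable[OF L2_rep_class(1)[OF g]]
  have "AE x in lebesgue_on J. (norm (L2_rep (L2_class J f) x - L2_rep (L2_class J g) x))\<^sup>2 = (norm (f x - g x))\<^sup>2"
    using L2_rep_class(2)[OF f] L2_rep_class(2)[OF g] by eventually_elim simp
  then have "(LINT x|lebesgue_on J. (norm (L2_rep (L2_class J f) x - L2_rep (L2_class J g) x))\<^sup>2) =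
      (LINT x|lebesgue_on J. (norm (f x - g x))\<^sup>2)"
    by (intro integral_cong_AE) measurable
  then show ?thesis by (simp add: L2_dist_def L2_norm_sq_def)
qed

lemma topspace_L2: "topspace (L2_topology J) = L2 J"
  unfolding L2_topology_def by (rule Metric_space.topspace_mtopology[OF Metric_space_L2])

lemma L2_limit:
  assumes f: "\<And>n. f n \<in> sq_integrable J" and g: "g \<in> sq_integrable J"
    and lim: "(\<lambda>n. L2_norm_sq J (\<lambda>x. f n x - g x)) \<longlonglongrightarrow> 0"
  shows "limitin (L2_topology J) (\<lambda>n. L2_class J (f n)) (L2_class J g) sequentially"
  unfolding L2_topology_def Metric_space.limitin_metric[OF Metric_space_L2]
proof (intro conjI allI impI)
  show "L2_class J g \<in> L2 J" by (rule L2_class_in[OF g])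
  fix e :: real assume "0 < e"
  have "(\<lambda>n. sqrt (L2_norm_sq J (\<lambda>x. f n x - g x))) \<longlonglongrightarrow> 0"
    using tendsto_real_sqrt[OF lim] by simp
  then have "\<forall>\<^sub>F n in sequentially. sqrt (L2_norm_sq J (\<lambda>x. f n x - g x)) < e"
    using \<open>0 < e\<close> by (rule order_tendstoD)
  then show "\<forall>\<^sub>F n in sequentially. L2_class J (f n) \<in> L2 J \<and> L2_dist J (L2_class J (f n)) (L2_class J g) < e"
    by eventually_elim (simp add: L2_class_in f L2_dist_class[OF f g])
qed

lemma limitin_sequentially_closure_of:
  assumes lim: "limitin T s l sequentially" and S: "\<And>n. s n \<in> S"
  shows "l \<in> T closure_of S"
  unfolding in_closure_of
proof (intro conjI allI impI)
  show "l \<in> topspace T" using lim by (simp add: limitin_def)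
  fix U assume "l \<in> U \<and> openin T U"
  then have "\<forall>\<^sub>F n in sequentially. s n \<in> U" using lim by (simp add: limitin_def)
  then obtain n where "s n \<in> U" by (auto simp: eventually_sequentially)
  then show "\<exists>y. y \<in> S \<and> y \<in> U" using S by blast
qed

text \<open>
  Lipschitz continuity, by the Cauchy-Schwarz inequality.
\<close>

lemma continuous_map_L2_inner:
  fixes F :: "'h::{complex_hilbert, second_countable_topology} L2_elem"
  assumes F: "F \<in> L2 J"
  shows "continuous_map (L2_topology J) euclidean (\<lambda>G. L2_inner J G F)"
proof -
  interpret Metric_space "L2 J" "L2_dist J :: 'h L2_elem \<Rightarrow> 'h L2_elem \<Rightarrow> real" by (rule Metric_space_L2)
  obtain f where f: "f \<in> sq_integrable J" "F = L2_class J f" using F by (rule L2_cases)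
  have le: "dist (L2_inner J A F) (L2_inner J B F) \<le> L2_dist J A B * sqrt (L2_norm_sq J f)"
    if AB: "A \<in> L2 J" "B \<in> L2 J" for A B :: "'h L2_elem"
  proof -
    obtain a where a: "a \<in> sq_integrable J" "A = L2_class J a" using AB(1) by (rule L2_cases)
    obtain b where b: "b \<in> sq_integrable J" "B = L2_class J b" using AB(2) by (rule L2_cases)
    have "dist (L2_inner J A F) (L2_inner J B F) = cmod (fun_inner J (\<lambda>x. a x - b x) f)"
      using a b f by (simp add: L2_inner_class dist_norm fun_inner_simps)
    also have "\<dots> \<le> sqrt (L2_norm_sq J (\<lambda>x. a x - b x)) * sqrt (L2_norm_sq J f)"
      by (intro fun_inner_Cauchy_Schwarz sq_integrable_diff a b f)
    also have "sqrt (L2_norm_sq J (\<lambda>x. a x - b x)) = L2_dist J A B"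
      using a b by (simp add: L2_dist_class)
    finally show ?thesis .
  qed
  let ?k = "sqrt (L2_norm_sq J f) + 1"
  have k: "?k > 0" by (simp add: add_nonneg_pos)
  have "continuous_map mtopology Met_TC.mtopology (\<lambda>G. L2_inner J G F)"
    unfolding metric_continuous_map[OF Met_TC.Metric_space_axioms]
  proof (intro conjI ballI allI impI)
    fix A :: "'h L2_elem" and e :: real assume A: "A \<in> L2 J" and e: "0 < e"
    have "dist (L2_inner J A F) (L2_inner J B F) < e" if B: "B \<in> L2 J" "L2_dist J A B < e / ?k" for B
    proof -
      have "dist (L2_inner J A F) (L2_inner J B F) \<le> L2_dist J A B * sqrt (L2_norm_sq J f)"
        by (rule le[OF A B(1)])
      also have "\<dots> \<le> L2_dist J A B * ?k" by (intro mult_left_mono) auto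
      also have "\<dots> < e" using B(2) k by (simp add: pos_less_divide_eq)
      finally show ?thesis .
    qed
    then show "\<exists>\<delta>>0. \<forall>x. x \<in> L2 J \<and> L2_dist J A x < \<delta> \<longrightarrow> dist (L2_inner J A F) (L2_inner J x F) < e"
      using e k by (intro exI[of _ "e / ?k"]) auto
  qed auto
  then show ?thesis by (simp add: L2_topology_def)
qed

text \<open>
  The adjoint is an intersection of zero sets of continuous functions of the pair, one for each element
  of the graph of \<open>A\<close>.
\<close>

lemma closedin_op_adjoint:
  assumes A: "A \<subseteq> L2 J \<times> L2 J"
  shows "closedin (prod_topology (L2_topology J) (L2_topology J)) (op_adjoint J A)"
proof -
  let ?T = "prod_topology (L2_topology J) (L2_topology J)"
  let ?C = "\<lambda>P. {Q \<in> topspace ?T. L2_inner J (fst Q) (snd P) - L2_inner J (snd Q) (fst P) \<in> {0}}"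
  have "closedin ?T (?C P)" if "P \<in> A" for P
  proof (rule closedin_continuous_map_preimage)
    have P: "fst P \<in> L2 J" "snd P \<in> L2 J" using A that by auto
    show "continuous_map ?T euclidean (\<lambda>Q. L2_inner J (fst Q) (snd P) - L2_inner J (snd Q) (fst P))"
      using continuous_map_compose[OF continuous_map_fst continuous_map_L2_inner[OF P(2)]]
        continuous_map_compose[OF continuous_map_snd continuous_map_L2_inner[OF P(1)]]
      by (intro continuous_map_diff) (simp_all add: o_def)
  qed simp
  then have C: "closedin ?T (\<Inter>P\<in>A. ?C P)" if "A \<noteq> {}" using that by (intro closedin_INT)
  have "closedin ?T (topspace ?T \<inter> (\<Inter>P\<in>A. ?C P))"
  proof (cases "A = {}")
    case True
    show ?thesis unfolding True INF_empty Int_UNIV_right by (rule closedin_topspace)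
  next
    case False
    show ?thesis by (rule closedin_Int[OF closedin_topspace C[OF False]])
  qed
  moreover have "op_adjoint J A = topspace ?T \<inter> (\<Inter>P\<in>A. ?C P)"
    by (fastforce simp: op_adjoint_def topspace_L2)
  ultimately show ?thesis by simp
qed

section \<open>Green's formula and weak solutions on the whole interval\<close>

locale schroedinger_setting = open_interval J for J +
  fixes V :: "real \<Rightarrow> ('h::{complex_hilbert, second_countable_topology} \<Rightarrow>\<^sub>L 'h)"
  assumes V_linear: "x \<in> J \<Longrightarrow> V x \<in> bounded_ops"
    and V_weakly: "weakly_measurable_on J V"
    and V_loc: "(\<lambda>x. norm (V x)) \<in> L1_loc J"
    and V_sym: "AE x in lebesgue_on J. is_adjoint_of (V x) (V x)"
begin

abbreviation \<tau> where "\<tau> \<equiv> schroedinger V"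

lemma V_admissible:
  assumes "c \<in> J" "d \<in> J"
  shows "admissible_potential c d V"
  unfolding admissible_potential_def
proof (intro conjI allI)
  show "integrable (lebesgue_on {c..d}) (\<lambda>t. norm (V t))" by (rule L1_loc_integrable[OF V_loc assms])
  fix h
  have "(\<lambda>t. V t h) \<in> borel_measurable (lebesgue_on J)"
    by (rule borel_measurable_if_weakly) (use V_weakly in \<open>simp add: weakly_measurable_on_def\<close>)
  then show "(\<lambda>t. V t h) \<in> borel_measurable (lebesgue_on {c..d})"
    by (rule measurable_restrict_mono) (rule Icc_subset[OF assms])
qed

lemma V_sym_on:
  assumes "c \<in> J" "d \<in> J"
  shows "AE t in lebesgue_on {c..d}. is_adjoint_of (V t) (V t)"
  by (rule AE_lebesgue_on_subset[OF V_sym Icc_subset[OF assms] _ J_sets]) simp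

text \<open>
  The functions underlying \<open>H_max\<close> and \<open>H_min_dot\<close>, together with their two derivatives.
\<close>

definition max_domain :: "(real \<Rightarrow> 'h) \<Rightarrow> (real \<Rightarrow> 'h) \<Rightarrow> (real \<Rightarrow> 'h) \<Rightarrow> bool"
  where "max_domain f f1 f2 \<longleftrightarrow> f \<in> sq_integrable J \<and> W21_loc_derivs J f f1 f2 \<and> \<tau> f f2 \<in> sq_integrable J"

definition min_domain :: "(real \<Rightarrow> 'h) \<Rightarrow> (real \<Rightarrow> 'h) \<Rightarrow> (real \<Rightarrow> 'h) \<Rightarrow> bool"
  where "min_domain f f1 f2 \<longleftrightarrow> max_domain f f1 f2 \<and> compact (supp_in J f)"

lemma compact_supp_in:
  assumes "c \<in> J" "d \<in> J" "\<And>x. x \<in> J \<Longrightarrow> x \<notin> {c..d} \<Longrightarrow> f x = 0"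
  shows "compact (supp_in J f)"
proof -
  have "{x \<in> J. f x \<noteq> 0} \<subseteq> {c..d}" using assms(3) by blast
  then have sub: "closure {x \<in> J. f x \<noteq> 0} \<subseteq> {c..d}" by (rule closure_minimal) simp
  then have "supp_in J f = closure {x \<in> J. f x \<noteq> 0}"
    using Icc_subset[OF assms(1,2)] by (auto simp: supp_in_def)
  moreover have "compact (closure {x \<in> J. f x \<noteq> 0})"
    using compact_Int_closed[OF compact_Icc closed_closure, of c d "{x \<in> J. f x \<noteq> 0}"] sub
    by (simp add: Int_absorb1)
  ultimately show ?thesis by simp
qed

lemma weak_solution_in_max_domain:
  assumes G: "G \<in> sq_integrable J" "G' \<in> sq_integrable J"
    and weak: "\<And>f f1 f2. min_domain f f1 f2 \<Longrightarrow> fun_inner J G (\<tau> f f2) = fun_inner J G' f"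
  obtains g g1 where "W21_loc_derivs J g g1 (\<lambda>t. V t (g t) - G' t)" "AE t in lebesgue_on J. G t = g t"
proof (rule W21_loc_glue[of "\<lambda>t v. V t v - G' t" G])
  fix c d assume cdJ: "c \<in> J" "d \<in> J" "c < d"
  interpret bounded_interval c d by standard (rule cdJ)
  show "\<exists>u u1. W21_on c d u u1 (\<lambda>t. V t (u t) - G' t) \<and> (AE t in lebesgue_on {c..d}. G t = u t)"
  proof (rule weak_solution_regular[OF Icc_subset[OF cdJ(1,2)] J_sets V_admissible[OF cdJ(1,2)] V_sym_on[OF cdJ(1,2)] G])
    fix f f1 f2
    assume f: "W21_loc_derivs J f f1 f2" "\<And>x. x \<notin> {c..d} \<Longrightarrow> f x = 0"
      "f \<in> sq_integrable J" "\<tau> f f2 \<in> sq_integrable J"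
    show "fun_inner J G (\<tau> f f2) = fun_inner J G' f"
      by (rule weak) (use f compact_supp_in[OF cdJ(1,2), of f] in \<open>auto simp: min_domain_def max_domain_def\<close>)
  qed blast
qed (use that in blast)

lemma W21_loc_derivs_zero: "W21_loc_derivs J (\<lambda>x. 0 :: 'h) (\<lambda>x. 0) (\<lambda>x. 0)"
  by (rule W21_loc_derivsI) (rule W21_on_zero)

text \<open>
  Beyond the support the function is zero on open intervals, and there
  its derivatives vanish by uniqueness.  The end points \<open>c\<close> and \<open>d\<close> are taken strictly outside of
  the support, so that they lie in these open intervals.
\<close>

lemma compact_support_vanishing:
  assumes f: "W21_loc_derivs J f f1 (f2 :: real \<Rightarrow> 'h)" and supp: "compact (supp_in J f)"
  obtains c d where "c \<in> J" "d \<in> J" "c < d" "\<And>x. x \<in> J \<Longrightarrow> x \<notin> {c<..<d} \<Longrightarrow> f x = 0 \<and> f1 x = 0"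
    "AE t in lebesgue_on J. t \<notin> {c..d} \<longrightarrow> f2 t = 0"
proof -
  have "supp_in J f \<subseteq> J" by (auto simp: supp_in_def)
  with supp obtain s r where sr: "s \<in> J" "r \<in> J" "s < r" "supp_in J f \<subseteq> {s..r}" by (rule compact_subset_Icc)
  have f0: "f x = 0" if "x \<in> J" "x \<notin> {s..r}" for x
    using that sr(4) closure_subset[of "{x \<in> J. f x \<noteq> 0}"] by (auto simp: supp_in_def)
  obtain c where c: "c \<in> J" "c < s" using ex_less[OF sr(1)] by blast
  obtain d where d: "d \<in> J" "r < d" using ex_greater[OF sr(2)] by blast
  have zero: "(\<forall>x\<in>I. f1 x = 0) \<and> (AE t in lebesgue. t \<in> I \<longrightarrow> f2 t = 0)"
    if I: "open I" "is_interval I" "I \<noteq> {}" "I \<subseteq> J" "\<And>x. x \<in> I \<Longrightarrow> f x = 0" for I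
  proof -
    interpret I: open_interval I by standard (fact I)+
    have z: "W21_loc_derivs I (\<lambda>x. 0 :: 'h) (\<lambda>x. 0) (\<lambda>x. 0)"
      by (rule I.W21_loc_derivsI) (rule W21_on_zero)
    have "AE t in lebesgue_on I. f t = 0" by (rule AE_I2) (simp add: I(5))
    from I.W21_loc_unique(2,3)[OF W21_loc_derivs_subset[OF f I(4)] z this] show ?thesis
      using I.J_sets by (auto simp: AE_restrict_space_iff)
  qed
  have int: "is_interval (J \<inter> {..<s})" "is_interval (J \<inter> {r<..})"
    by (intro is_interval_Int interval_J is_interval_io is_interval_oi)+
  have left: "(\<forall>x\<in>J \<inter> {..<s}. f1 x = 0) \<and> (AE t in lebesgue. t \<in> J \<inter> {..<s} \<longrightarrow> f2 t = 0)"
    by (rule zero) (use open_J int c f0 in auto)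
  have right: "(\<forall>x\<in>J \<inter> {r<..}. f1 x = 0) \<and> (AE t in lebesgue. t \<in> J \<inter> {r<..} \<longrightarrow> f2 t = 0)"
    by (rule zero) (use open_J int d f0 in auto)
  show thesis
  proof (rule that)
    show "c \<in> J" "d \<in> J" "c < d" using c d sr by auto
    show "f x = 0 \<and> f1 x = 0" if x: "x \<in> J" "x \<notin> {c<..<d}" for x
    proof -
      have "x < s \<or> r < x" using x c d by auto
      then show ?thesis using left right x f0[of x] by auto
    qed
    have "AE t in lebesgue. t \<in> J \<longrightarrow> t \<notin> {c..d} \<longrightarrow> f2 t = 0"
      using conjunct2[OF left] conjunct2[OF right] by eventually_elim (use c d in auto)
    then show "AE t in lebesgue_on J. t \<notin> {c..d} \<longrightarrow> f2 t = 0"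
      using J_sets by (simp add: AE_restrict_space_iff)
  qed
qed

lemma Green:
  assumes g: "max_domain g g1 g2" and f: "min_domain f f1 f2"
  shows "fun_inner J g (\<tau> f f2) = fun_inner J (\<tau> g g2) f"
proof -
  have fW: "W21_loc_derivs J f f1 f2" and fsq: "f \<in> sq_integrable J" "\<tau> f f2 \<in> sq_integrable J"
    and gW: "W21_loc_derivs J g g1 g2" and gsq: "g \<in> sq_integrable J" "\<tau> g g2 \<in> sq_integrable J"
    using f g by (auto simp: min_domain_def max_domain_def)
  have "compact (supp_in J f)" using f by (simp add: min_domain_def)
  from compact_support_vanishing[OF fW this] obtain c d where cdJ: "c \<in> J" "d \<in> J" "c < d"
    and f0: "\<And>x. x \<in> J \<Longrightarrow> x \<notin> {c<..<d} \<Longrightarrow> f x = 0 \<and> f1 x = 0"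
    and f20: "AE t in lebesgue_on J. t \<notin> {c..d} \<longrightarrow> f2 t = 0" by blast
  interpret bounded_interval c d by standard (rule cdJ)
  note I = Icc_subset[OF cdJ(1,2)]
  have F: "W21_on c d f f1 f2" and G: "W21_on c d g g1 g2"
    using W21_loc_derivs_imp_on[OF fW cdJ(1,2)] W21_loc_derivs_imp_on[OF gW cdJ(1,2)] by auto
  note cF = W21_on_continuous[OF F] and cG = W21_on_continuous[OF G]
  let ?h = "\<lambda>t. indicator {c..d} t *\<^sub>R \<tau> f f2 t"
  have "{c..d} \<in> sets (lebesgue_on J)" using I J_sets by (simp add: sets_restrict_space_iff)
  then have hm: "?h \<in> borel_measurable (lebesgue_on J)"
    by (intro borel_measurable_scaleR borel_measurable_indicator sq_integrable_measurable fsq)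
  have "fun_inner J g (\<tau> f f2) = fun_inner J g ?h"
  proof (rule fun_inner_cong_AE)
    have "AE t in lebesgue_on J. t \<in> J" by (rule AE_I2) simp
    with f20 show "AE t in lebesgue_on J. \<tau> f f2 t = ?h t"
    proof eventually_elim
      case (elim t)
      then show ?case using f0[of t] by (cases "t \<in> {c..d}") (auto simp: schroedinger_def)
    qed
  qed (use gsq fsq hm in \<open>auto intro: sq_integrable_measurable\<close>)
  also have "\<dots> = ip g ?h"
    by (rule fun_inner_ext_zero[OF _ I _ J_sets]) auto
  also have "\<dots> = (LINT t|M. cinner (g t) (V t (f t)) - cinner (g t) (f2 t))"
    unfolding fun_inner_def
    by (rule Bochner_Integration.integral_cong[OF refl]) (simp add: schroedinger_def cinner_simps)
  also have "\<dots> = ip g (\<lambda>t. V t (f t)) - (LINT t|M. cinner (g t) (f2 t))"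
    unfolding fun_inner_def
    by (intro Bochner_Integration.integral_diff cinner_integrable(2)[OF cG(2)]
        admissible_potential_continuous[OF V_admissible[OF cdJ(1,2)] cF(2)] W21_onD(1)[OF F])
  also have "ip g (\<lambda>t. V t (f t)) = ip (\<lambda>t. V t (g t)) f"
    using V_admissible[OF cdJ(1,2)]
    by (intro ip_symmetric_operator[OF V_sym_on[OF cdJ(1,2)] _
          continuous_on_Icc_measurable_bounded(1)[OF cG(2)] continuous_on_Icc_measurable_bounded(1)[OF cF(2)]])
      (simp add: admissible_potential_def)
  also have "(LINT t|M. cinner (g t) (f2 t)) = (LINT t|M. cinner (g2 t) (f t))"
  proof -
    have b0: "f c = 0" "f1 c = 0" "f d = 0" "f1 d = 0" using f0 cdJ by auto
    have "(LINT t|M. cinner (g t) (f2 t)) + (LINT t|M. cinner (g1 t) (f1 t)) = cinner (g d) (f1 d) - cinner (g c) (f1 c)"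
      by (rule integration_by_parts_antideriv(3)[OF bounded_bilinear_cinner cG(3) W21_onD(1)[OF F] W21_onD(2)[OF G] W21_onD(3)[OF F]])
        (use cdJ in auto)
    moreover have "(LINT t|M. cinner (g1 t) (f1 t)) + (LINT t|M. cinner (g2 t) (f t)) = cinner (g1 d) (f d) - cinner (g1 c) (f c)"
      by (rule integration_by_parts_antideriv(3)[OF bounded_bilinear_cinner W21_onD(1)[OF G] cF(3) W21_onD(3)[OF G] W21_onD(2)[OF F]])
        (use cdJ in auto)
    ultimately show ?thesis by (simp add: b0 add_eq_0_iff2)
  qed
  also have "ip (\<lambda>t. V t (g t)) f - (LINT t|M. cinner (g2 t) (f t)) =
      (LINT t|M. cinner (V t (g t)) (f t) - cinner (g2 t) (f t))"
    unfolding fun_inner_def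
    by (intro Bochner_Integration.integral_diff[symmetric] cinner_integrable(1)[OF _ cF(2)]
        admissible_potential_continuous[OF V_admissible[OF cdJ(1,2)] cG(2)] W21_onD(1)[OF G])
  also have "\<dots> = ip (\<tau> g g2) f"
    unfolding fun_inner_def
    by (rule Bochner_Integration.integral_cong[OF refl]) (simp add: schroedinger_def cinner_simps)
  also have "\<dots> = fun_inner J (\<tau> g g2) f"
    by (rule fun_inner_ext_zero[OF _ I _ J_sets, symmetric]) (use f0 in auto)
  finally show ?thesis .
qed

end

section \<open>Density, closedness and the second adjoint\<close>

lemma sq_integrable_Pair:
  fixes f g :: "real \<Rightarrow> 'h::{complex_hilbert, second_countable_topology}"
  assumes f: "f \<in> sq_integrable J" and g: "g \<in> sq_integrable J"
  shows "(\<lambda>t. (f t, g t)) \<in> sq_integrable J"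
    and "L2_norm_sq J (\<lambda>t. (f t, g t)) = L2_norm_sq J f + L2_norm_sq J g"
proof -
  have eq: "(norm (f t, g t))\<^sup>2 = (norm (f t))\<^sup>2 + (norm (g t))\<^sup>2" for t
    by (simp add: norm_prod_def)
  show "(\<lambda>t. (f t, g t)) \<in> sq_integrable J"
    using f g by (auto simp: sq_integrable_def eq)
  show "L2_norm_sq J (\<lambda>t. (f t, g t)) = L2_norm_sq J f + L2_norm_sq J g"
    unfolding L2_norm_sq_def eq using f g
    by (intro Bochner_Integration.integral_add sq_integrable_norm_sq)
qed

lemma sq_integrable_components:
  fixes w :: "real \<Rightarrow> 'h::{complex_hilbert, second_countable_topology} \<times> 'h"
  assumes w: "w \<in> sq_integrable J"
  shows "(\<lambda>t. fst (w t)) \<in> sq_integrable J" "(\<lambda>t. snd (w t)) \<in> sq_integrable J"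
proof -
  have wm: "w \<in> borel_measurable (lebesgue_on J)" using w by (rule sq_integrable_measurable)
  have fm: "(\<lambda>t. fst (w t)) \<in> borel_measurable (lebesgue_on J)"
    using borel_measurable_continuous_on[OF continuous_on_fst[OF continuous_on_id] wm] by simp
  have sm: "(\<lambda>t. snd (w t)) \<in> borel_measurable (lebesgue_on J)"
    using borel_measurable_continuous_on[OF continuous_on_snd[OF continuous_on_id] wm] by simp
  have le: "(norm (fst z))\<^sup>2 \<le> (norm z)\<^sup>2" "(norm (snd z))\<^sup>2 \<le> (norm z)\<^sup>2" for z :: "'h \<times> 'h"
    by (simp_all add: norm_prod_def)
  have "integrable (lebesgue_on J) (\<lambda>t. (norm (fst (w t)))\<^sup>2)"
    by (rule Bochner_Integration.integrable_bound[OF sq_integrable_norm_sq[OF w]])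
      (use fm le in \<open>auto intro!: borel_measurable_power\<close>)
  with fm show "(\<lambda>t. fst (w t)) \<in> sq_integrable J" by (simp add: sq_integrable_def)
  have "integrable (lebesgue_on J) (\<lambda>t. (norm (snd (w t)))\<^sup>2)"
    by (rule Bochner_Integration.integrable_bound[OF sq_integrable_norm_sq[OF w]])
      (use sm le in \<open>auto intro!: borel_measurable_power\<close>)
  with sm show "(\<lambda>t. snd (w t)) \<in> sq_integrable J" by (simp add: sq_integrable_def)
qed

lemma fun_inner_Pair:
  fixes w :: "real \<Rightarrow> 'h::{complex_hilbert, second_countable_topology} \<times> 'h"
  assumes w: "w \<in> sq_integrable J" and f: "f \<in> sq_integrable J" and g: "g \<in> sq_integrable J"
  shows "fun_inner J w (\<lambda>t. (f t, g t)) = fun_inner J (\<lambda>t. fst (w t)) f + fun_inner J (\<lambda>t. snd (w t)) g"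
  unfolding fun_inner_def cinner_prod_def fst_conv snd_conv
  by (intro Bochner_Integration.integral_add sq_integrable_cinner sq_integrable_components w f g)

lemma L2_inner_commute:
  assumes "F \<in> L2 J" "G \<in> L2 J"
  shows "L2_inner J F G = cnj (L2_inner J G F)"
proof -
  obtain f where "f \<in> sq_integrable J" "F = L2_class J f" using assms(1) by (rule L2_cases)
  moreover obtain g where "g \<in> sq_integrable J" "G = L2_class J g" using assms(2) by (rule L2_cases)
  ultimately show ?thesis using fun_inner_commute[of J f g] by (simp add: L2_inner_class)
qed

context open_interval
begin

lemma W21_loc_derivs_add:
  assumes y: "W21_loc_derivs J y y1 y2" and z: "W21_loc_derivs J z z1 z2"
  shows "W21_loc_derivs J (\<lambda>t. y t + z t) (\<lambda>t. y1 t + z1 t) (\<lambda>t. y2 t + z2 t)"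
  by (rule W21_loc_derivsI) (intro W21_on_add W21_loc_derivs_imp_on[OF y] W21_loc_derivs_imp_on[OF z])

lemma W21_loc_derivs_scaleC:
  fixes y :: "real \<Rightarrow> 'h::{complex_hilbert, second_countable_topology}"
  assumes y: "W21_loc_derivs J y y1 y2"
  shows "W21_loc_derivs J (\<lambda>t. k *\<^sub>C y t) (\<lambda>t. k *\<^sub>C y1 t) (\<lambda>t. k *\<^sub>C y2 t)"
proof (rule W21_loc_derivsI)
  fix c d assume cd: "c \<in> J" "d \<in> J" "c < d"
  note Y = W21_loc_derivs_imp_on[OF y cd(1,2)]
  note lin = antideriv_bounded_linear[OF bounded_linear_scaleC]
  show "W21_on c d (\<lambda>t. k *\<^sub>C y t) (\<lambda>t. k *\<^sub>C y1 t) (\<lambda>t. k *\<^sub>C y2 t)"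
    unfolding W21_on_def
  proof (intro conjI ballI)
    show "integrable (lebesgue_on {c..d}) (\<lambda>t. k *\<^sub>C y2 t)"
      by (rule integrable_bounded_linear[OF bounded_linear_scaleC W21_onD(1)[OF Y]])
    fix x assume x: "x \<in> {c..d}"
    show "k *\<^sub>C y x = k *\<^sub>C y c + antideriv c d (\<lambda>t. k *\<^sub>C y1 t) x"
      using W21_onD(2)[OF Y x] by (simp add: lin[OF W21_on_continuous(3)[OF Y]] scaleC_add_right)
    show "k *\<^sub>C y1 x = k *\<^sub>C y1 c + antideriv c d (\<lambda>t. k *\<^sub>C y2 t) x"
      using W21_onD(3)[OF Y x] by (simp add: lin[OF W21_onD(1)[OF Y]] scaleC_add_right)
  qed
qed

text \<open>
  Sobolev functions are continuous on the open interval, hence measurable.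
\<close>

lemma W21_loc_derivs_measurable:
  fixes y :: "real \<Rightarrow> 'b::{banach, second_countable_topology}"
  assumes y: "W21_loc_derivs J y y1 y2"
  shows "y \<in> borel_measurable (lebesgue_on J)"
proof (rule continuous_imp_measurable_on_sets_lebesgue[OF _ J_sets])
  have "isCont y x" if x: "x \<in> J" for x
  proof -
    obtain c d where cd: "c \<in> J" "c < x" "d \<in> J" "x < d" using ex_less[OF x] ex_greater[OF x] by blast
    have "continuous_on {c<..<d} y"
      by (rule continuous_on_subset[OF W21_on_continuous(2)[OF W21_loc_derivs_imp_on[OF y cd(1,3)]]]) auto
    then show ?thesis using cd by (simp add: continuous_on_eq_continuous_at)
  qed
  then show "continuous_on J y" by (simp add: continuous_on_eq_continuous_at open_J)
qed

end

context schroedinger_setting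
begin

lemma tau_add: "\<tau> (\<lambda>t. f t + g t) (\<lambda>t. f2 t + g2 t) = (\<lambda>t. \<tau> f f2 t + \<tau> g g2 t)"
  by (auto simp: schroedinger_def blinfun.add_right)

lemma tau_scaleC: "t \<in> J \<Longrightarrow> \<tau> (\<lambda>t. k *\<^sub>C f t) (\<lambda>t. k *\<^sub>C f2 t) t = k *\<^sub>C \<tau> f f2 t"
  using V_linear[of t] by (simp add: schroedinger_def bounded_ops_def scaleC_diff_right)

lemma max_domain_add:
  assumes "max_domain f f1 f2" "max_domain g g1 g2"
  shows "max_domain (\<lambda>t. f t + g t) (\<lambda>t. f1 t + g1 t) (\<lambda>t. f2 t + g2 t)"
  using assms unfolding max_domain_def tau_add by (auto intro: sq_integrable_add W21_loc_derivs_add)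

lemma max_domain_scaleC:
  assumes "max_domain f f1 f2"
  shows "max_domain (\<lambda>t. k *\<^sub>C f t) (\<lambda>t. k *\<^sub>C f1 t) (\<lambda>t. k *\<^sub>C f2 t)"
  using assms sq_integrable_cong[OF sq_integrable_scaleC tau_scaleC]
  unfolding max_domain_def by (auto intro: sq_integrable_scaleC W21_loc_derivs_scaleC)

text \<open>
  This covers sums and multiples, whose supports need not be described exactly.
\<close>

lemma compact_supp_in_subset:
  assumes "compact (supp_in J f)" "compact (supp_in J g)"
    and sub: "\<And>x. x \<in> J \<Longrightarrow> f x = 0 \<Longrightarrow> g x = 0 \<Longrightarrow> h x = 0"
  shows "compact (supp_in J h)"
proof -
  have K: "compact (supp_in J f \<union> supp_in J g)" "supp_in J f \<union> supp_in J g \<subseteq> J"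
    using assms by (auto simp: supp_in_def)
  then obtain c d where cd: "c \<in> J" "d \<in> J" "supp_in J f \<union> supp_in J g \<subseteq> {c..d}"
    using compact_subset_Icc by metis
  show ?thesis
  proof (rule compact_supp_in[OF cd(1,2)])
    fix x assume x: "x \<in> J" "x \<notin> {c..d}"
    then have "x \<notin> supp_in J f" "x \<notin> supp_in J g" using cd(3) by auto
    then show "h x = 0"
      using x sub closure_subset[of "{x \<in> J. f x \<noteq> 0}"] closure_subset[of "{x \<in> J. g x \<noteq> 0}"]
      by (auto simp: supp_in_def)
  qed
qed

lemma min_domain_add:
  assumes "min_domain f f1 f2" "min_domain g g1 g2"
  shows "min_domain (\<lambda>t. f t + g t) (\<lambda>t. f1 t + g1 t) (\<lambda>t. f2 t + g2 t)"
  using assms max_domain_add compact_supp_in_subset[of f g "\<lambda>t. f t + g t"] by (auto simp: min_domain_def)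

lemma min_domain_scaleC:
  assumes "min_domain f f1 f2"
  shows "min_domain (\<lambda>t. k *\<^sub>C f t) (\<lambda>t. k *\<^sub>C f1 t) (\<lambda>t. k *\<^sub>C f2 t)"
  using assms max_domain_scaleC compact_supp_in_subset[of f f "\<lambda>t. k *\<^sub>C f t"] by (auto simp: min_domain_def)

lemma min_domain_zero: "min_domain (\<lambda>t. 0) (\<lambda>t. 0) (\<lambda>t. 0)"
proof -
  have "\<tau> (\<lambda>t. 0) (\<lambda>t. 0) = (\<lambda>t. 0)" by (auto simp: schroedinger_def)
  then show ?thesis using W21_loc_derivs_zero by (simp add: min_domain_def max_domain_def supp_in_def)
qed

text \<open>
  Orthogonality says that \<open>0\<close> is a weak solution of \<open>\<tau> G = w\<close>.  By regularity the zero function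
  is an honest solution, hence \<open>w = 0\<close>.
\<close>

lemma orthogonal_min_domain_imp_zero:
  assumes w: "w \<in> sq_integrable J" and orth: "\<And>f f1 f2. min_domain f f1 f2 \<Longrightarrow> fun_inner J w f = 0"
  shows "AE t in lebesgue_on J. w t = 0"
proof -
  obtain g g1 where g: "W21_loc_derivs J g g1 (\<lambda>t. V t (g t) - w t)" "AE t in lebesgue_on J. 0 = g t"
    by (rule weak_solution_in_max_domain[OF sq_integrable_zero w]) (use orth in auto)
  have ae: "AE t in lebesgue_on J. g t = 0" using g(2) by eventually_elim simp
  have "AE t in lebesgue_on J. V t (g t) - w t = 0"
    by (rule W21_loc_unique(3)[OF g(1) W21_loc_derivs_zero ae])
  with ae show ?thesis by eventually_elim simp
qed

lemma H_max_iff: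
  "(F, F') \<in> H_max J V \<longleftrightarrow> (\<exists>g g1 g2. max_domain g g1 g2 \<and> F = L2_class J g \<and> F' = L2_class J (\<tau> g g2))"
  by (auto simp: H_max_def max_domain_def)

lemma H_max_subset: "H_max J V \<subseteq> L2 J \<times> L2 J"
  by (auto simp: H_max_def intro: L2_class_in)

lemma H_min_dot_subset: "H_min_dot J V \<subseteq> H_max J V"
  by (auto simp: H_min_dot_def)

text \<open>
  A class belongs to the domain if one of its members is a Sobolev function of compact support; by uniqueness of continuous
  representatives the Sobolev function that defines the value of \<open>H_max\<close> is the same function.
\<close>

lemma H_min_dot_iff:
  "(F, F') \<in> H_min_dot J V \<longleftrightarrow> (\<exists>f f1 f2. min_domain f f1 f2 \<and> F = L2_class J f \<and> F' = L2_class J (\<tau> f f2))"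
proof
  assume "(F, F') \<in> H_min_dot J V"
  then have "(F, F') \<in> H_max J V" and "\<exists>h\<in>F. h \<in> W21_loc J \<and> compact (supp_in J h)"
    by (auto simp: H_min_dot_def dom_H_min_dot_def)
  then obtain g g1 g2 h h1 h2 where g: "max_domain g g1 g2" "F = L2_class J g" "F' = L2_class J (\<tau> g g2)"
    and h: "h \<in> F" "W21_loc_derivs J h h1 h2" "compact (supp_in J h)"
    unfolding H_max_iff W21_loc_def by blast
  have gsq: "g \<in> sq_integrable J" and gW: "W21_loc_derivs J g g1 g2" using g(1) by (auto simp: max_domain_def)
  have "AE x in lebesgue_on J. g x = h x" using h(1) gsq by (simp add: g(2) mem_L2_class_iff)
  then have eq: "g x = h x" if "x \<in> J" for x using W21_loc_unique(1)[OF gW h(2)] that by blast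
  have "{x \<in> J. g x \<noteq> 0} = {x \<in> J. h x \<noteq> 0}" using eq by auto
  then have "supp_in J g = supp_in J h" by (simp add: supp_in_def)
  then have "min_domain g g1 g2" using g(1) h(3) by (simp add: min_domain_def)
  then show "\<exists>f f1 f2. min_domain f f1 f2 \<and> F = L2_class J f \<and> F' = L2_class J (\<tau> f f2)" using g by blast
next
  assume "\<exists>f f1 f2. min_domain f f1 f2 \<and> F = L2_class J f \<and> F' = L2_class J (\<tau> f f2)"
  then obtain f f1 f2 where f: "max_domain f f1 f2" "compact (supp_in J f)" "F = L2_class J f" "F' = L2_class J (\<tau> f f2)"
    unfolding min_domain_def by blast
  then have FF: "(F, F') \<in> H_max J V" unfolding H_max_iff by blast
  have "f \<in> F" using f by (simp add: mem_L2_class_iff max_domain_def)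
  moreover have "f \<in> W21_loc J" using f(1) by (auto simp: max_domain_def W21_loc_def)
  ultimately show "(F, F') \<in> H_min_dot J V"
    using FF f(2) by (auto simp: H_min_dot_def dom_H_min_dot_def)
qed

theorem H_max_eq_adjoint: "H_max J V = op_adjoint J (H_min_dot J V)"
proof (intro equalityI subrelI)
  fix G G' assume GG: "(G, G') \<in> H_max J V"
  then obtain g g1 g2 where g: "max_domain g g1 g2" "G = L2_class J g" "G' = L2_class J (\<tau> g g2)"
    unfolding H_max_iff by blast
  have "L2_inner J G F' = L2_inner J G' F" if "(F, F') \<in> H_min_dot J V" for F F'
  proof -
    obtain f f1 f2 where f: "min_domain f f1 f2" "F = L2_class J f" "F' = L2_class J (\<tau> f f2)"
      using \<open>(F, F') \<in> H_min_dot J V\<close> unfolding H_min_dot_iff by blast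
    have "max_domain f f1 f2" using f(1) by (simp add: min_domain_def)
    then show ?thesis
      using Green[OF g(1) f(1)] g(1) unfolding f(2,3) g(2,3) by (simp add: L2_inner_class max_domain_def)
  qed
  then show "(G, G') \<in> op_adjoint J (H_min_dot J V)"
    using GG H_max_subset by (auto simp: op_adjoint_def)
next
  fix G G' assume GG: "(G, G') \<in> op_adjoint J (H_min_dot J V)"
  then have GL: "G \<in> L2 J" "G' \<in> L2 J"
    and adj: "\<And>F F'. (F, F') \<in> H_min_dot J V \<Longrightarrow> L2_inner J G F' = L2_inner J G' F"
    by (auto simp: op_adjoint_def)
  obtain u where u: "u \<in> sq_integrable J" "G = L2_class J u" using GL(1) by (rule L2_cases)
  obtain u' where u': "u' \<in> sq_integrable J" "G' = L2_class J u'" using GL(2) by (rule L2_cases)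
  obtain g g1 where g: "W21_loc_derivs J g g1 (\<lambda>t. V t (g t) - u' t)" "AE t in lebesgue_on J. u t = g t"
  proof (rule weak_solution_in_max_domain[OF u(1) u'(1)])
    fix f f1 f2 assume f: "min_domain f f1 f2"
    then have "(L2_class J f, L2_class J (\<tau> f f2)) \<in> H_min_dot J V" unfolding H_min_dot_iff by blast
    from adj[OF this] show "fun_inner J u (\<tau> f f2) = fun_inner J u' f"
      using f u u' by (simp add: L2_inner_class min_domain_def max_domain_def)
  qed blast
  have gsq: "g \<in> sq_integrable J"
    by (rule sq_integrable_AE_cong[OF u(1) g(2) W21_loc_derivs_measurable[OF g(1)]])
  have tau: "\<tau> g (\<lambda>t. V t (g t) - u' t) = u'" by (auto simp: schroedinger_def)
  have "max_domain g g1 (\<lambda>t. V t (g t) - u' t)" unfolding max_domain_def tau using gsq g(1) u'(1) by blast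
  moreover have "G = L2_class J g" using L2_class_eq_iff[OF u(1) gsq] g(2) u(2) by simp
  ultimately show "(G, G') \<in> H_max J V" unfolding H_max_iff using u'(2) tau by metis
qed

text \<open>
  Two values for the same class have the same inner products with the dense domain of \<open>H_min_dot\<close>.
\<close>

lemma single_valued_H_max: "single_valued (H_max J V)"
proof (rule single_valuedI)
  fix F F1 F2 assume F: "(F, F1) \<in> H_max J V" "(F, F2) \<in> H_max J V"
  then have "F1 \<in> L2 J" "F2 \<in> L2 J" using H_max_subset by auto
  then obtain h1 h2 where h: "h1 \<in> sq_integrable J" "F1 = L2_class J h1" "h2 \<in> sq_integrable J" "F2 = L2_class J h2"
    by (metis L2_cases)
  have "AE t in lebesgue_on J. h1 t - h2 t = 0"
  proof (rule orthogonal_min_domain_imp_zero)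
    show "(\<lambda>t. h1 t - h2 t) \<in> sq_integrable J" using h by (intro sq_integrable_diff)
    fix f f1 f2 assume f: "min_domain f f1 f2"
    then have "(L2_class J f, L2_class J (\<tau> f f2)) \<in> H_min_dot J V" unfolding H_min_dot_iff by blast
    then have "L2_inner J F1 (L2_class J f) = L2_inner J F2 (L2_class J f)"
      using F unfolding H_max_eq_adjoint op_adjoint_def by fastforce
    moreover have "f \<in> sq_integrable J" using f by (simp add: min_domain_def max_domain_def)
    ultimately show "fun_inner J (\<lambda>t. h1 t - h2 t) f = 0"
      using h by (simp add: L2_inner_class fun_inner_simps)
  qed
  then have "AE t in lebesgue_on J. h1 t = h2 t" by eventually_elim simp
  then show "F1 = F2" using h L2_class_eq_iff[of h1 J h2] by simp
qed

text \<open>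
  A common treatment of the maximal operator and of its restriction to functions of compact support,
  which differ in the predicate \<open>P\<close> only.
\<close>

lemma linear_operator_if_class_graph:
  assumes graph: "\<And>F F'. (F, F') \<in> A \<longleftrightarrow> (\<exists>f f1 f2. P f f1 f2 \<and> F = L2_class J f \<and> F' = L2_class J (\<tau> f f2))"
    and sub: "A \<subseteq> H_max J V" and max: "\<And>f f1 f2. P f f1 f2 \<Longrightarrow> max_domain f f1 f2"
    and zero: "P (\<lambda>t. 0) (\<lambda>t. 0) (\<lambda>t. 0)"
    and add: "\<And>f f1 f2 g g1 g2. P f f1 f2 \<Longrightarrow> P g g1 g2 \<Longrightarrow>
      P (\<lambda>t. f t + g t) (\<lambda>t. f1 t + g1 t) (\<lambda>t. f2 t + g2 t)"
    and scale: "\<And>k f f1 f2. P f f1 f2 \<Longrightarrow> P (\<lambda>t. k *\<^sub>C f t) (\<lambda>t. k *\<^sub>C f1 t) (\<lambda>t. k *\<^sub>C f2 t)"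
  shows "linear_operator J A"
  unfolding linear_operator_def
proof (intro conjI allI)
  show "A \<subseteq> L2 J \<times> L2 J" using sub H_max_subset by blast
  show "A \<noteq> {}" using zero graph by blast
  show "single_valued A" using single_valued_subset[OF sub] single_valued_H_max by blast
  show "\<forall>(F, F')\<in>A. \<forall>(G, G')\<in>A. (L2_add J F G, L2_add J F' G') \<in> A"
  proof (intro ballI, clarify)
    fix F F' G G' assume "(F, F') \<in> A" "(G, G') \<in> A"
    then obtain f f1 f2 g g1 g2 where f: "P f f1 f2" "F = L2_class J f" "F' = L2_class J (\<tau> f f2)"
      and g: "P g g1 g2" "G = L2_class J g" "G' = L2_class J (\<tau> g g2)"
      unfolding graph by blast
    have "L2_add J F G = L2_class J (\<lambda>t. f t + g t)"
      "L2_add J F' G' = L2_class J (\<tau> (\<lambda>t. f t + g t) (\<lambda>t. f2 t + g2 t))"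
      using f(2,3) g(2,3) max[OF f(1)] max[OF g(1)] by (simp_all add: tau_add L2_add_class max_domain_def)
    then show "(L2_add J F G, L2_add J F' G') \<in> A"
      unfolding graph using add[OF f(1) g(1)] by blast
  qed
  fix k
  show "\<forall>(F, F')\<in>A. (L2_scale J k F, L2_scale J k F') \<in> A"
  proof (intro ballI, clarify)
    fix F F' assume "(F, F') \<in> A"
    then obtain f f1 f2 where f: "P f f1 f2" "F = L2_class J f" "F' = L2_class J (\<tau> f f2)"
      unfolding graph by blast
    have sq: "f \<in> sq_integrable J" "\<tau> f f2 \<in> sq_integrable J" using max[OF f(1)] by (auto simp: max_domain_def)
    have "L2_scale J k F = L2_class J (\<lambda>t. k *\<^sub>C f t)" by (simp add: f(2) L2_scale_class[OF sq(1)])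
    moreover have "L2_scale J k F' = L2_class J (\<tau> (\<lambda>t. k *\<^sub>C f t) (\<lambda>t. k *\<^sub>C f2 t))"
      unfolding f(3) L2_scale_class[OF sq(2)]
      by (rule L2_class_cong[OF sq_integrable_scaleC[OF sq(2)] tau_scaleC, symmetric])
    ultimately show "(L2_scale J k F, L2_scale J k F') \<in> A"
      unfolding graph using scale[OF f(1)] by blast
  qed
qed

lemma linear_operator_H_max: "linear_operator J (H_max J V)"
  using min_domain_zero
  by (intro linear_operator_if_class_graph[of _ max_domain] H_max_iff max_domain_add max_domain_scaleC)
    (auto simp: min_domain_def)

lemma linear_operator_H_min_dot: "linear_operator J (H_min_dot J V)"
  by (rule linear_operator_if_class_graph[of _ min_domain, OF H_min_dot_iff H_min_dot_subset _
        min_domain_zero min_domain_add min_domain_scaleC])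
    (simp add: min_domain_def)

lemma densely_defined_H_min_dot: "densely_defined J (H_min_dot J V)"
  unfolding densely_defined_def
proof (intro conjI linear_operator_H_min_dot equalityI subsetI)
  show "F \<in> L2 J" if "F \<in> L2_topology J closure_of Domain (H_min_dot J V)" for F
    using that closure_of_subset_topspace[of "L2_topology J"] topspace_L2 by blast
  fix F :: "'h L2_elem" assume "F \<in> L2 J"
  then obtain x where x: "x \<in> sq_integrable J" "F = L2_class J x" by (rule L2_cases)
  let ?Y = "{f. \<exists>f1 f2. min_domain f f1 f2}"
  obtain y where y: "\<And>n. y n \<in> ?Y" "(\<lambda>n. L2_norm_sq J (\<lambda>t. y n t - x t)) \<longlonglongrightarrow> 0"
  proof (rule L2_double_orthogonal[of ?Y J x])
    show "?Y \<subseteq> sq_integrable J" by (auto simp: min_domain_def max_domain_def)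
    show "?Y \<noteq> {}" using min_domain_zero by blast
    show "(\<lambda>t. f t + g t) \<in> ?Y" if "f \<in> ?Y" "g \<in> ?Y" for f g using that min_domain_add by blast
    show "(\<lambda>t. k *\<^sub>C f t) \<in> ?Y" if "f \<in> ?Y" for k f using that min_domain_scaleC by blast
    show "fun_inner J w x = 0" if w: "w \<in> sq_integrable J" "\<And>f. f \<in> ?Y \<Longrightarrow> fun_inner J w f = 0" for w
    proof -
      have "AE t in lebesgue_on J. w t = 0"
        by (rule orthogonal_min_domain_imp_zero[OF w(1)]) (use w(2) in blast)
      then have "fun_inner J w x = fun_inner J (\<lambda>t. 0) x"
        by (rule fun_inner_cong_AE) (use w x in \<open>auto intro: sq_integrable_measurable\<close>)
      then show ?thesis by simp
    qed
  qed (use x in blast)+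
  have ysq: "y n \<in> sq_integrable J" for n using y(1)[of n] by (auto simp: min_domain_def max_domain_def)
  show "F \<in> L2_topology J closure_of Domain (H_min_dot J V)"
  proof (rule limitin_sequentially_closure_of)
    show "limitin (L2_topology J) (\<lambda>n. L2_class J (y n)) F sequentially"
      unfolding x(2) by (rule L2_limit[OF ysq x(1) y(2)])
    show "L2_class J (y n) \<in> Domain (H_min_dot J V)" for n
      using y(1)[of n] H_min_dot_iff by blast
  qed
qed

lemma closed_operator_H_max: "closed_operator J (H_max J V)"
  unfolding closed_operator_def
proof
  have "H_min_dot J V \<subseteq> L2 J \<times> L2 J" using H_min_dot_subset H_max_subset by blast
  then show "closedin (prod_topology (L2_topology J) (L2_topology J)) (H_max J V)"
    unfolding H_max_eq_adjoint by (rule closedin_op_adjoint)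
qed (rule linear_operator_H_max)

lemma symmetric_H_min_dot: "symmetric_operator J (H_min_dot J V)"
  unfolding symmetric_operator_def
proof (intro conjI densely_defined_H_min_dot ballI, clarify)
  fix F F' G G' assume "(F, F') \<in> H_min_dot J V" "(G, G') \<in> H_min_dot J V"
  then show "L2_inner J F G' = L2_inner J F' G"
    using H_min_dot_subset unfolding H_max_eq_adjoint op_adjoint_def by blast
qed

text \<open>
  A pair \<open>(w1, w2)\<close> is orthogonal to the graph of \<open>H_min_dot\<close> if and only if \<open>(w2, - w1)\<close> belongs to
  the graph of its adjoint \<open>H_max\<close>.  So a pair in the adjoint of \<open>H_max\<close> is annihilated by everything
  orthogonal to the graph of \<open>H_min_dot\<close>, which puts it into the closure.
\<close>

lemma adjoint_H_max_subset_closure: "op_adjoint J (H_max J V) \<subseteq> op_closure J (H_min_dot J V)"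
proof (rule subrelI)
  fix X X' assume XX: "(X, X') \<in> op_adjoint J (H_max J V)"
  then have "X \<in> L2 J" "X' \<in> L2 J" by (auto simp: op_adjoint_def)
  then obtain x x' where x: "x \<in> sq_integrable J" "X = L2_class J x" and x': "x' \<in> sq_integrable J" "X' = L2_class J x'"
    by (metis L2_cases)
  \<comment> \<open>outside of \<open>J\<close> the second component is left free, since there \<open>V\<close> need not be complex linear\<close>
  let ?Y = "{\<lambda>t. (f t, h t) | f h. \<exists>f1 f2. min_domain f f1 f2 \<and> (\<forall>t\<in>J. h t = \<tau> f f2 t)}"
  have Ysq: "f \<in> sq_integrable J \<and> h \<in> sq_integrable J"
    if "min_domain f f1 f2" "\<forall>t\<in>J. h t = \<tau> f f2 t" for f f1 f2 h
    using that sq_integrable_cong[of "\<tau> f f2" J h] by (auto simp: min_domain_def max_domain_def)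
  have YI: "(\<lambda>t. (f t, h t)) \<in> ?Y"
    if "min_domain f f1 f2" "\<And>t. t \<in> J \<Longrightarrow> h t = \<tau> f f2 t" for f f1 f2 h
    unfolding mem_Collect_eq using that
    by - (rule exI[of _ f], rule exI[of _ h], rule conjI[OF refl], rule exI[of _ f1], rule exI[of _ f2], simp)
  obtain y where y: "\<And>n. y n \<in> ?Y" "(\<lambda>n. L2_norm_sq J (\<lambda>t. y n t - (x t, x' t))) \<longlonglongrightarrow> 0"
  proof (rule L2_double_orthogonal[of ?Y J "\<lambda>t. (x t, x' t)"])
    show "?Y \<subseteq> sq_integrable J" using Ysq by (auto intro!: sq_integrable_Pair(1))
    show "?Y \<noteq> {}" using YI[OF min_domain_zero refl] by blast
    show "(\<lambda>t. u t + v t) \<in> ?Y" if "u \<in> ?Y" "v \<in> ?Y" for u v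
    proof -
      from that obtain f f1 f2 h g g1 g2 k where
        f: "u = (\<lambda>t. (f t, h t))" "min_domain f f1 f2" "\<forall>t\<in>J. h t = \<tau> f f2 t" and
        g: "v = (\<lambda>t. (g t, k t))" "min_domain g g1 g2" "\<forall>t\<in>J. k t = \<tau> g g2 t" by blast
      have "(\<lambda>t. u t + v t) = (\<lambda>t. (f t + g t, h t + k t))" by (simp add: f g)
      moreover have "\<forall>t\<in>J. h t + k t = \<tau> (\<lambda>t. f t + g t) (\<lambda>t. f2 t + g2 t) t" using f g by (simp add: tau_add)
      ultimately show ?thesis using YI[OF min_domain_add[OF f(2) g(2)]] by simp
    qed
    show "(\<lambda>t. k *\<^sub>C u t) \<in> ?Y" if "u \<in> ?Y" for k u
    proof -
      from that obtain f f1 f2 h where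
        f: "u = (\<lambda>t. (f t, h t))" "min_domain f f1 f2" "\<forall>t\<in>J. h t = \<tau> f f2 t" by blast
      have "(\<lambda>t. k *\<^sub>C u t) = (\<lambda>t. (k *\<^sub>C f t, k *\<^sub>C h t))" by (simp add: f scaleC_prod_def)
      moreover have "\<forall>t\<in>J. k *\<^sub>C h t = \<tau> (\<lambda>t. k *\<^sub>C f t) (\<lambda>t. k *\<^sub>C f2 t) t" using f by (simp add: tau_scaleC)
      ultimately show ?thesis using YI[OF min_domain_scaleC[OF f(2)]] by simp
    qed
    show "(\<lambda>t. (x t, x' t)) \<in> sq_integrable J" by (rule sq_integrable_Pair(1)[OF x(1) x'(1)])
    fix w :: "real \<Rightarrow> 'h \<times> 'h"
    assume w: "w \<in> sq_integrable J" and orth: "\<And>u. u \<in> ?Y \<Longrightarrow> fun_inner J w u = 0"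
    let ?w1 = "\<lambda>t. fst (w t)" and ?w2 = "\<lambda>t. snd (w t)"
    note wsq = sq_integrable_components[OF w]
    have mw1: "(\<lambda>t. - ?w1 t) \<in> sq_integrable J" by (rule sq_integrable_minus[OF wsq(1)])
    have "(L2_class J ?w2, L2_class J (\<lambda>t. - ?w1 t)) \<in> op_adjoint J (H_min_dot J V)"
    proof -
      have "L2_inner J (L2_class J ?w2) F' = L2_inner J (L2_class J (\<lambda>t. - ?w1 t)) F"
        if "(F, F') \<in> H_min_dot J V" for F F'
      proof -
        obtain f f1 f2 where f: "min_domain f f1 f2" "F = L2_class J f" "F' = L2_class J (\<tau> f f2)"
          using \<open>(F, F') \<in> H_min_dot J V\<close> unfolding H_min_dot_iff by blast
        have fsq: "f \<in> sq_integrable J" "\<tau> f f2 \<in> sq_integrable J" using f(1) by (auto simp: min_domain_def max_domain_def)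
        from orth[OF YI[OF f(1) refl]] have "fun_inner J ?w1 f + fun_inner J ?w2 (\<tau> f f2) = 0"
          by (simp add: fun_inner_Pair[OF w fsq])
        then have "fun_inner J ?w2 (\<tau> f f2) = - fun_inner J ?w1 f" by (simp add: add_eq_0_iff)
        then show ?thesis
          using f fsq wsq mw1 by (simp add: L2_inner_class fun_inner_minus)
      qed
      then show ?thesis using L2_class_in[OF wsq(2)] L2_class_in[OF mw1] by (auto simp: op_adjoint_def)
    qed
    then have "(L2_class J ?w2, L2_class J (\<lambda>t. - ?w1 t)) \<in> H_max J V" by (simp add: H_max_eq_adjoint)
    then have "L2_inner J X (L2_class J (\<lambda>t. - ?w1 t)) = L2_inner J X' (L2_class J ?w2)"
      using XX unfolding op_adjoint_def by blast
    then have "- fun_inner J x ?w1 = fun_inner J x' ?w2"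
      using x x' mw1 wsq by (simp add: L2_inner_class fun_inner_minus)
    then have "cnj (fun_inner J x ?w1) + cnj (fun_inner J x' ?w2) = 0"
      by (metis complex_cnj_add complex_cnj_zero add.right_inverse)
    then have "fun_inner J ?w1 x + fun_inner J ?w2 x' = 0"
      using fun_inner_commute[of J ?w1 x] fun_inner_commute[of J ?w2 x'] by simp
    then show "fun_inner J w (\<lambda>t. (x t, x' t)) = 0" by (simp add: fun_inner_Pair[OF w x(1) x'(1)])
  qed blast
  from y(1) obtain f h where fh: "\<And>n. y n = (\<lambda>t. (f n t, h n t))"
    and f12: "\<And>n. \<exists>f1 f2. min_domain (f n) f1 f2 \<and> (\<forall>t\<in>J. h n t = \<tau> (f n) f2 t)"
    unfolding mem_Collect_eq by metis
  have fsq: "f n \<in> sq_integrable J" and hsq: "h n \<in> sq_integrable J" for n using f12[of n] Ysq by blast+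
  have split: "L2_norm_sq J (\<lambda>t. y n t - (x t, x' t)) =
      L2_norm_sq J (\<lambda>t. f n t - x t) + L2_norm_sq J (\<lambda>t. h n t - x' t)" for n
    unfolding fh diff_Pair
    by (intro sq_integrable_Pair(2) sq_integrable_diff fsq hsq x(1) x'(1))
  have lim1: "(\<lambda>n. L2_norm_sq J (\<lambda>t. f n t - x t)) \<longlonglongrightarrow> 0"
    by (rule tendsto_sandwich[OF _ _ tendsto_const y(2)]) (auto simp: split)
  have lim2: "(\<lambda>n. L2_norm_sq J (\<lambda>t. h n t - x' t)) \<longlonglongrightarrow> 0"
    by (rule tendsto_sandwich[OF _ _ tendsto_const y(2)]) (auto simp: split)
  show "(X, X') \<in> op_closure J (H_min_dot J V)"
    unfolding op_closure_def
  proof (rule limitin_sequentially_closure_of)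
    show "limitin (prod_topology (L2_topology J) (L2_topology J)) (\<lambda>n. (L2_class J (f n), L2_class J (h n))) (X, X') sequentially"
      using L2_limit[OF fsq x(1) lim1] L2_limit[OF hsq x'(1) lim2]
      by (simp add: limitin_pairwise o_def x(2) x'(2))
    show "(L2_class J (f n), L2_class J (h n)) \<in> H_min_dot J V" for n
    proof -
      obtain f1 f2 where m: "min_domain (f n) f1 f2" "\<forall>t\<in>J. h n t = \<tau> (f n) f2 t" using f12[of n] by blast
      then have "L2_class J (h n) = L2_class J (\<tau> (f n) f2)"
        by (intro L2_class_cong) (auto simp: min_domain_def max_domain_def)
      then show ?thesis unfolding H_min_dot_iff using m(1) by blast
    qed
  qed
qed

lemma adjoint_H_max: "op_adjoint J (H_max J V) = op_closure J (H_min_dot J V)"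
proof (rule equalityI[OF adjoint_H_max_subset_closure])
  have "H_min_dot J V \<subseteq> op_adjoint J (H_max J V)"
  proof (rule subrelI)
    fix F F' assume FF: "(F, F') \<in> H_min_dot J V"
    then have FL: "F \<in> L2 J" "F' \<in> L2 J" using H_min_dot_subset H_max_subset by auto
    have "L2_inner J F G' = L2_inner J F' G" if GG: "(G, G') \<in> H_max J V" for G G'
    proof -
      have "G \<in> L2 J" "G' \<in> L2 J" using GG H_max_subset by auto
      moreover have "L2_inner J G F' = L2_inner J G' F"
        using GG FF unfolding H_max_eq_adjoint op_adjoint_def by blast
      ultimately show ?thesis using L2_inner_commute FL by metis
    qed
    then show "(F, F') \<in> op_adjoint J (H_max J V)" using FL by (auto simp: op_adjoint_def)
  qed
  then show "op_closure J (H_min_dot J V) \<subseteq> op_adjoint J (H_max J V)"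
    unfolding op_closure_def by (rule closure_of_minimal[OF _ closedin_op_adjoint[OF H_max_subset]])
qed

end

theorem theorem3p4:
  fixes a b :: ereal
    and V :: "real \<Rightarrow> ('h::{complex_hilbert, second_countable_topology} \<Rightarrow>\<^sub>L 'h)"
  defines "J \<equiv> einterval a b"
  assumes "a < b"
    and "\<And>x. x \<in> J \<Longrightarrow> V x \<in> bounded_ops"
    and "weakly_measurable_on J V"
    and "(\<lambda>x. norm (V x)) \<in> L1_loc J"
    and "AE x in lebesgue_on J. is_adjoint_of (V x) (V x)"
  shows "densely_defined J (H_min_dot J V) \<and>
    H_max J V = op_adjoint J (H_min_dot J V) \<and>
    closed_operator J (H_max J V) \<and>
    symmetric_operator J (H_min_dot J V) \<and>
    op_adjoint J (H_max J V) = op_closure J (H_min_dot J V) \<and>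
    op_closure J (H_min_dot J V) = H_min J V"
proof -
  interpret schroedinger_setting J V
  proof
    show "open J" unfolding J_def by simp
    show "is_interval J"
      unfolding is_interval_1
    proof (intro ballI allI impI)
      fix u v x assume "u \<in> J" "v \<in> J" and "u \<le> x \<and> x \<le> v"
      then have "a < ereal u" "ereal u \<le> ereal x" "ereal x \<le> ereal v" "ereal v < b"
        by (simp_all add: J_def einterval_iff)
      then have "a < ereal x" "ereal x < b" by (blast intro: less_le_trans le_less_trans)+
      then show "x \<in> J" by (simp add: J_def einterval_iff)
    qed
    show "J \<noteq> {}" unfolding J_def using einterval_nonempty[OF \<open>a < b\<close>] by blast
  qed (fact assms)+
  show ?thesis
    using densely_defined_H_min_dot H_max_eq_adjoint closed_operator_H_max symmetric_H_min_dot
      adjoint_H_max by (simp add: H_min_def)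
qed

end
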